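(* Let $\mathscr{X}=(\mathcal{X},d,\mu)$ be a compact homogeneous space, $\varphi\in\mathscr{C}(\mathbb{R}^{\binom p2})$ a continuous function and $\Phi=\Phi^{p,\varphi}$. Suppose that $$\sigma_{\mathrm{hom}}^2(\varphi,\mathscr{X})=\lim_{n\to\infty}\frac{\mathrm{var}(S_n(\varphi,\mathscr{X}))}{n^{2(p-1)}}>0 ;$$ this quantity has the combinatorial expansion $$\sigma^2_{\mathrm{hom}}(\varphi,\mathscr{X})=\sum_{\substack{1\leq k_1,l_1,k_2,l_2\leq p\\ k_1<k_2,\ l_1\neq l_2}}\kappa(\pi_{k_1,l_1,k_2,l_2},\varphi).$$ Then the sequence $$Y_n(\varphi,\mathscr{X})=\frac{\Phi(\mathscr{X}_n)-\Phi(\mathscr{X})}{\sqrt{\mathrm{var}(\Phi(\mathscr{X}_n))}}$$ converges in distribution toward a real-valued random variable $Y(\varphi,\mathscr{X})$ having for cumulants the sequence $$\kappa^{(r)}(Y(\varphi,\mathscr{X}))=a_r=\frac{1}{(\sigma_{\mathrm{hom}})^{r}}\sum_{\substack{\pi\in\mathfrak{Q}(pr),\ \ell(\pi)=(p-1)r\\ \pi\text{ not homogeneously vanishing}}}\kappa(\pi,\varphi).$$ The law of the limit $Y(\varphi,\mathscr{X})$ is determined by these cumulants $(a_r)_{r\geq1}$. Under the assumption $\sigma_{\mathrm{hom}}(\varphi,\mathscr{X})>0$, the renormalisation $\sqrt{\mathrm{var}(\Phi(\mathscr{X}_n))}$ is of order $n^{-1}$, and more precisely, $\mathrm{var}(\Phi(\mathscr{X}_n))$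 is a polynomial in $n^{-1}$ without constant term and without term $\alpha\,n^{-1}$; its leading term is $\sigma^2_{\mathrm{hom}}(\varphi,\mathscr{X})\,n^{-2}$.
   Context: A metric measure space (mm-space) $\mathscr{X}=(\mathcal{X},d,\mu)$ is a complete separable metric space with a Borel probability measure $\mu$, with $\mathcal{X}=\mathrm{supp}(\mu)$. It is a compact homogeneous space if, up to a measure-preserving isometry, it equals $(G/K,d_{G/K},\mu_{G/K})$ with $G$ a compact topological group, $K$ a closed subgroup, $d_{G/K}$ a $G$-invariant distance and $\mu_{G/K}$ the push-forward of the Haar probability measure of $G$; equivalently, the group of measure-preserving isometries of $\mathcal{X}$ acts transitively on $\mathcal{X}$. For a function $\varphi$ on $\mathbb{R}^{\binom p2}$, $\Phi^{p,\varphi}(\mathcal{X},d,\mu)=\int_{\mathcal{X}^p}\varphi((d(x_a,x_b))_{1\leq a<b\leq p})\,\mu^{\otimes p}(dx_1\cdots dx_p)$. Let $(X_i)_{i\geq1}$ be i.i.d. with law $\mu$, and $\mathscr{X}_n=(\{X_1,\dots,X_n\},d,\frac1n\sum_{i=1}^n\delta_{X_i})$. For $\bar\imath=(i_1,\dots,i_p)$ write $\varphi(d(X_{\bar\imath}))=\varphi((d(X_{i_a},X_{i_b}))_{1\leq a<b\leq p})$; then $S_n(\varphi,\mathscr{X})=n^p\Phi(\mathscr{X}_n)=\sum_{\bar\imath\in\{1,\dots,n\}^p}\varphi(d(X_{\bar\imath}))$. The joint cumulant of $(Z_1,\dots,Z_r)$ is $\kappa(Z_1,\dots,Z_r)=[t_1\cdots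 t_r]\log\mathbb{E}[e^{t_1Z_1+\cdots+t_rZ_r}]$, and $\kappa^{(r)}(Z)=\kappa(Z,\dots,Z)$. $\mathfrak{Q}(pr)$ is the set of set partitions of $\{1,\dots,pr\}$, and $\ell(\pi)$ is the number of parts of $\pi$. Given $I=(\bar\imath^1,\dots,\bar\imath^r)$ with $\bar\imath^k\in\{1,\dots,n\}^p$, identify $I$ with $(x_1,\dots,x_{pr})$ by $x_{(k-1)p+l}=\bar\imath^k_l$, and let $\mathrm{Sp}_n(I)\in\mathfrak{Q}(pr)$ be the set partition for which $a,b$ lie in the same part iff $x_a=x_b$. For $\pi\in\mathfrak{Q}(pr)$, $\kappa(\pi,\varphi)$ is the common value of $\kappa(\varphi(d(X_{\bar\imath^1})),\dots,\varphi(d(X_{\bar\imath^r})))$ for all $I$ (with $n$ large enough) such that $\mathrm{Sp}_n(I)=\pi$. A set partition $\pi\in\mathfrak{Q}(pr)$ is homogeneously vanishing if there exists $k\in\{1,\dots,r\}$ such that, among the integers $(k-1)p+1,\dots,kp$, at least $p-1$ form singleton parts of $\pi$ (the remaining integer of this block may be connected to integers of other blocks). For $k_1\neq k_2$ and $l_1\neq l_2$, $\pi_{k_1,l_1,k_2,l_2}\in\mathfrak{Q}(2p)$ is the set partition with the two parts $\{k_1,l_1+p\}$ and $\{k_2,l_2+p\}$, all other parts being singletons.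
   Formalization: The printed a_1 is false in general (two uniform points at distance 1, p=2, φ(d)=d: a_1=0, but E[Y_n]→−1/√2). The first cumulant proved is a_1 − C(p,2)Φ(X)/σ_hom, which is the printed one when Φ(X)=0; all orders r≥2 are as printed. *)

theory Defs
  imports
    "HOL-Probability.Probability"
    "HOL-Algebra.Coset"
    "HOL-Library.Disjoint_Sets"
    "HOL-Library.Landau_Symbols"
    "HOL-Computational_Algebra.Polynomial"
begin

text \<open>
  The complete separable metric space is a type of class \<^class>\<open>polish_space\<close>,
  with its distance \<^const>\<open>dist\<close>; only the measure is an explicit parameter.
\<close>

definition supp :: "'a::topological_space measure \<Rightarrow> 'a set" where
  "supp \<mu> = {x. \<forall>U. open U \<and> x \<in> U \<longrightarrow> emeasure \<mu> U > 0}"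

definition mm_space :: "'a::polish_space measure \<Rightarrow> bool" where
  "mm_space \<mu> \<longleftrightarrow> prob_space \<mu> \<and> sets \<mu> = sets borel \<and> supp \<mu> = UNIV"

definition compact_topological_group :: "'g monoid \<Rightarrow> 'g topology \<Rightarrow> bool" where
  "compact_topological_group G T \<longleftrightarrow>
     group G \<and> topspace T = carrier G \<and> compact_space T \<and> Hausdorff_space T \<and>
     continuous_map (prod_topology T T) T (\<lambda>(x, y). x \<otimes>\<^bsub>G\<^esub> y) \<and>
     continuous_map T T (\<lambda>x. inv\<^bsub>G\<^esub> x)"

text \<open>
  Inner regularity is part of the notion of Haar measure: it is automatic when the group is
  metrisable, but not in general.
\<close>

definition haar_probability :: "'g monoid \<Rightarrow> 'g topology \<Rightarrow> 'g measure \<Rightarrow> bool" where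
  "haar_probability G T \<nu> \<longleftrightarrow>
     prob_space \<nu> \<and> space \<nu> = carrier G \<and>
     sets \<nu> = sigma_sets (carrier G) {U. openin T U} \<and>
     (\<forall>g\<in>carrier G. \<forall>A\<in>sets \<nu>. emeasure \<nu> (l_coset G g A) = emeasure \<nu> A) \<and>
     (\<forall>A\<in>sets \<nu>. emeasure \<nu> A = (SUP C\<in>{C. compactin T C \<and> C \<subseteq> A}. emeasure \<nu> C))"

definition quotient_space :: "'g monoid \<Rightarrow> 'g set \<Rightarrow> 'g set set" where
  "quotient_space G K = (\<lambda>g. l_coset G g K) ` carrier G"

definition invariant_distance ::
    "'g monoid \<Rightarrow> 'g topology \<Rightarrow> 'g set \<Rightarrow> ('g set \<Rightarrow> 'g set \<Rightarrow> real) \<Rightarrow> bool" where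
  "invariant_distance G T K D \<longleftrightarrow>
     Metric_space (quotient_space G K) D \<and>
     quotient_map T (Metric_space.mtopology (quotient_space G K) D) (\<lambda>g. l_coset G g K) \<and>
     (\<forall>g\<in>carrier G. \<forall>A\<in>quotient_space G K. \<forall>B\<in>quotient_space G K.
        D (l_coset G g A) (l_coset G g B) = D A B)"

definition quotient_measure ::
    "'g monoid \<Rightarrow> 'g set \<Rightarrow> ('g set \<Rightarrow> 'g set \<Rightarrow> real) \<Rightarrow> 'g measure \<Rightarrow> 'g set measure" where
  "quotient_measure G K D \<nu> =
     distr \<nu>
       (sigma (quotient_space G K)
          {U. openin (Metric_space.mtopology (quotient_space G K) D) U})
       (\<lambda>g. l_coset G g K)"

text \<open>
  HOL cannot quantify over the type in which the group lives, so this type is a parameter; it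
  is arbitrary in a statement assuming \<open>compact_homogeneous_space TYPE('g) \<mu>\<close>.
\<close>

definition compact_homogeneous_space :: "'g itself \<Rightarrow> 'a::polish_space measure \<Rightarrow> bool" where
  "compact_homogeneous_space _ \<mu> \<longleftrightarrow>
     (\<exists>(G :: 'g monoid) T K D \<nu> (f :: 'g set \<Rightarrow> 'a).
        compact_topological_group G T \<and> subgroup K G \<and> closedin T K \<and>
        invariant_distance G T K D \<and> haar_probability G T \<nu> \<and>
        bij_betw f (quotient_space G K) UNIV \<and>
        (\<forall>A\<in>quotient_space G K. \<forall>B\<in>quotient_space G K. dist (f A) (f B) = D A B) \<and>
        distr (quotient_measure G K D \<nu>) borel f = \<mu>)"

definition pairs :: "nat \<Rightarrow> (nat \<times> nat) set" where
  "pairs p = {(a, b). 1 \<le> a \<and> a < b \<and> b \<le> p}"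

text \<open>
  The space of vectors indexed by the pairs \<open>a < b\<close> is the function space
  \<open>PiE (pairs p) (\<lambda>_. UNIV)\<close>, with the topology \<open>powertop_real (pairs p)\<close>.
\<close>

definition dist_vector :: "nat \<Rightarrow> (nat \<Rightarrow> 'a::metric_space) \<Rightarrow> nat \<times> nat \<Rightarrow> real" where
  "dist_vector p x = (\<lambda>(a, b)\<in>pairs p. dist (x a) (x b))"

definition Phi :: "nat \<Rightarrow> ((nat \<times> nat \<Rightarrow> real) \<Rightarrow> real) \<Rightarrow> 'a::metric_space measure \<Rightarrow> real" where
  "Phi p \<phi> \<mu> = (\<integral>x. \<phi> (dist_vector p x) \<partial>(PiM {1..p} (\<lambda>_. \<mu>)))"

definition empirical_measure ::
    "(nat \<Rightarrow> 'w \<Rightarrow> 'a::metric_space) \<Rightarrow> nat \<Rightarrow> 'w \<Rightarrow> 'a measure" where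
  "empirical_measure X n \<omega> = distr (uniform_count_measure {1..n}) borel (\<lambda>i. X i \<omega>)"

definition S_stat ::
    "(nat \<Rightarrow> 'w \<Rightarrow> 'a::metric_space) \<Rightarrow> nat \<Rightarrow> ((nat \<times> nat \<Rightarrow> real) \<Rightarrow> real) \<Rightarrow> nat \<Rightarrow> 'w \<Rightarrow> real"
  where
  "S_stat X p \<phi> n \<omega> = (\<Sum>i\<in>PiE {1..p} (\<lambda>_. {1..n}). \<phi> (dist_vector p (\<lambda>a. X (i a) \<omega>)))"

definition Phi_sample ::
    "(nat \<Rightarrow> 'w \<Rightarrow> 'a::metric_space) \<Rightarrow> nat \<Rightarrow> ((nat \<times> nat \<Rightarrow> real) \<Rightarrow> real) \<Rightarrow> nat \<Rightarrow> 'w \<Rightarrow> real"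
  where
  "Phi_sample X p \<phi> n \<omega> = Phi p \<phi> (empirical_measure X n \<omega>)"

definition var :: "'w measure \<Rightarrow> ('w \<Rightarrow> real) \<Rightarrow> real" where
  "var M Z = prob_space.variance M Z"

definition Y_stat ::
    "'w measure \<Rightarrow> 'a::metric_space measure \<Rightarrow> (nat \<Rightarrow> 'w \<Rightarrow> 'a) \<Rightarrow> nat \<Rightarrow>
     ((nat \<times> nat \<Rightarrow> real) \<Rightarrow> real) \<Rightarrow> nat \<Rightarrow> 'w \<Rightarrow> real" where
  "Y_stat M \<mu> X p \<phi> n \<omega> =
     (Phi_sample X p \<phi> n \<omega> - Phi p \<phi> \<mu>) / sqrt (var M (Phi_sample X p \<phi> n))"

definition sigma2_hom_seq ::
    "'w measure \<Rightarrow> (nat \<Rightarrow> 'w \<Rightarrow> 'a::metric_space) \<Rightarrow> nat \<Rightarrow>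
     ((nat \<times> nat \<Rightarrow> real) \<Rightarrow> real) \<Rightarrow> nat \<Rightarrow> real" where
  "sigma2_hom_seq M X p \<phi> n = var M (S_stat X p \<phi> n) / real n ^ (2 * (p - 1))"

definition sigma2_hom ::
    "'w measure \<Rightarrow> (nat \<Rightarrow> 'w \<Rightarrow> 'a::metric_space) \<Rightarrow> nat \<Rightarrow>
     ((nat \<times> nat \<Rightarrow> real) \<Rightarrow> real) \<Rightarrow> real" where
  "sigma2_hom M X p \<phi> = lim (sigma2_hom_seq M X p \<phi>)"

fun mixed_deriv :: "nat \<Rightarrow> ((nat \<Rightarrow> real) \<Rightarrow> real) \<Rightarrow> (nat \<Rightarrow> real) \<Rightarrow> real" where
  "mixed_deriv 0 F t = F t"
| "mixed_deriv (Suc r) F t = deriv (\<lambda>s. mixed_deriv r F (t(Suc r := s))) (t (Suc r))"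

text \<open>
  The coefficient of \<open>t 1 * \<dots> * t r\<close> in the power series of the log-Laplace transform is its
  derivative at the origin, once in each variable. This is meaningful when the variables have exponential
  moments near \<open>0\<close>.
\<close>

definition joint_cumulant :: "'w measure \<Rightarrow> nat \<Rightarrow> (nat \<Rightarrow> 'w \<Rightarrow> real) \<Rightarrow> real" where
  "joint_cumulant M r Z =
     mixed_deriv r (\<lambda>t. ln (\<integral>\<omega>. exp (\<Sum>i=1..r. t i * Z i \<omega>) \<partial>M)) (\<lambda>_. 0)"

definition exponential_moments :: "real measure \<Rightarrow> bool" where
  "exponential_moments L \<longleftrightarrow>
     (\<exists>\<epsilon>>0. \<forall>t. \<bar>t\<bar> < \<epsilon> \<longrightarrow> integrable L (\<lambda>x. exp (t * x)))"

definition law_cumulant :: "nat \<Rightarrow> real measure \<Rightarrow> real" where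
  "law_cumulant r L = joint_cumulant L r (\<lambda>_ y. y)"

definition set_partitions :: "nat \<Rightarrow> nat set set set" where
  "set_partitions m = {\<pi>. partition_on {1..m} \<pi>}"

definition multi_indices :: "nat \<Rightarrow> nat \<Rightarrow> nat \<Rightarrow> (nat \<Rightarrow> nat \<Rightarrow> nat) set" where
  "multi_indices n p r = PiE {1..r} (\<lambda>_. PiE {1..p} (\<lambda>_. {1..n}))"

text \<open>For \<open>1 \<le> k\<close> and \<open>1 \<le> l \<le> p\<close>, the entry of index \<open>(k - 1) * p + l\<close> is \<open>I k l\<close>.\<close>

definition flat_index :: "nat \<Rightarrow> (nat \<Rightarrow> nat \<Rightarrow> nat) \<Rightarrow> nat \<Rightarrow> nat" where
  "flat_index p I j = I ((j - 1) div p + 1) ((j - 1) mod p + 1)"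

definition Sp :: "nat \<Rightarrow> nat \<Rightarrow> (nat \<Rightarrow> nat \<Rightarrow> nat) \<Rightarrow> nat set set" where
  "Sp p r I = (\<lambda>a. {b\<in>{1..p * r}. flat_index p I a = flat_index p I b}) ` {1..p * r}"

definition kappa ::
    "'w measure \<Rightarrow> (nat \<Rightarrow> 'w \<Rightarrow> 'a::metric_space) \<Rightarrow> nat \<Rightarrow> nat \<Rightarrow> nat set set \<Rightarrow>
     ((nat \<times> nat \<Rightarrow> real) \<Rightarrow> real) \<Rightarrow> real" where
  "kappa M X p r \<pi> \<phi> =
     (THE c. \<forall>n. \<forall>I\<in>multi_indices n p r. Sp p r I = \<pi> \<longrightarrow>
        joint_cumulant M r (\<lambda>k \<omega>. \<phi> (dist_vector p (\<lambda>a. X (I k a) \<omega>))) = c)"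

definition homogeneously_vanishing :: "nat \<Rightarrow> nat \<Rightarrow> nat set set \<Rightarrow> bool" where
  "homogeneously_vanishing p r \<pi> \<longleftrightarrow>
     (\<exists>k\<in>{1..r}. card {j\<in>{(k - 1) * p + 1..k * p}. {j} \<in> \<pi>} \<ge> p - 1)"

definition pair_partition :: "nat \<Rightarrow> nat \<Rightarrow> nat \<Rightarrow> nat \<Rightarrow> nat \<Rightarrow> nat set set" where
  "pair_partition p k1 l1 k2 l2 =
     {{k1, l1 + p}, {k2, l2 + p}} \<union>
     (\<lambda>j. {j}) ` ({1..2 * p} - {k1, l1 + p, k2, l2 + p})"

definition a_coeff ::
    "'w measure \<Rightarrow> (nat \<Rightarrow> 'w \<Rightarrow> 'a::metric_space) \<Rightarrow> nat \<Rightarrow>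
     ((nat \<times> nat \<Rightarrow> real) \<Rightarrow> real) \<Rightarrow> nat \<Rightarrow> real" where
  "a_coeff M X p \<phi> r =
     1 / sqrt (sigma2_hom M X p \<phi>) ^ r *
     (\<Sum>\<pi> | \<pi> \<in> set_partitions (p * r) \<and> card \<pi> = (p - 1) * r \<and>
            \<not> homogeneously_vanishing p r \<pi>. kappa M X p r \<pi> \<phi>)"

text \<open>
  The sum \<open>a_coeff\<close> is the cumulant of the limit in each order \<open>r \<ge> 2\<close>. In order \<open>1\<close> it is so
  only when \<open>Phi p \<phi> \<mu> = 0\<close>: adding a constant to \<open>\<phi>\<close> does not change \<open>Y_stat\<close>, but it changes
  \<open>a_coeff\<close> in order \<open>1\<close>, where each of the \<open>p choose 2\<close> partitions made of one pair and
  singletons contributes an expectation of \<open>\<phi>\<close>. Equivalently, \<open>limit_cumulant\<close> is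
  \<open>a_coeff\<close> with \<open>\<phi>\<close> replaced by \<open>\<phi> - Phi p \<phi> \<mu>\<close>.
\<close>

definition limit_cumulant ::
    "'w measure \<Rightarrow> 'a::metric_space measure \<Rightarrow> (nat \<Rightarrow> 'w \<Rightarrow> 'a) \<Rightarrow> nat \<Rightarrow>
     ((nat \<times> nat \<Rightarrow> real) \<Rightarrow> real) \<Rightarrow> nat \<Rightarrow> real" where
  "limit_cumulant M \<mu> X p \<phi> r =
     (if r = 1
      then a_coeff M X p \<phi> 1 - real (p choose 2) * Phi p \<phi> \<mu> / sqrt (sigma2_hom M X p \<phi>)
      else a_coeff M X p \<phi> r)"

end

theory Submission
  imports Defs "HOL-Complex_Analysis.Complex_Analysis"
begin

text \<open>
  Homogeneity makes the expectation of \<open>\<phi>(d(x\<^sub>1, \<dots>, x\<^sub>p))\<close> with one coordinate fixed a constant, so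
  the centred kernel \<open>g = \<phi> - \<Phi>\<close> integrates to \<open>0\<close> over any \<open>p - 1\<close> of its coordinates. Hence a mixed
  moment or joint cumulant of the variables \<open>g(X\<^sub>i)\<close> vanishes as soon as its partition of indices is
  homogeneously vanishing. A partition that is not has at most \<open>(p - 1) r\<close> parts, and when
  it has exactly that many it consists of \<open>r\<close> pairs and singletons. Summing over the multi-indices
  by their partition, the moments and the cumulants of order \<open>r\<close> of
  \<open>W\<^sub>n = n * (\<Phi>(\<X>\<^sub>n) - \<Phi>(\<X>))\<close> are polynomials in \<open>1 / n\<close> whose constant terms are sums over these leading
  partitions.

  There are at most \<open>K ^ r * r!\<close> leading partitions, so the limits of the moments (rather than those of the
  cumulants) are at most \<open>K ^ r * r!\<close>: this yields tightness, convergence and determinacy. Since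
  cumulants are one and the same polynomial in the moments along the sequence and in the limit, the
  cumulants of the limit law are the limits of the cumulants.
\<close>

text \<open>The growth \<open>K ^ r * r!\<close> is that of a second-order chaos, and it decides the
  analysis: the limit law has exponential moments near 0 and perhaps nowhere else, so determinacy
  rests on a Laplace transform that is holomorphic in a strip. Moments keep this growth because a
  product of \<open>r\<close> kernel values is bounded by the \<open>r\<close>-th power of a
  constant. A cumulant is a signed sum of products of moments whose coefficients already add up to a
  factorial, so that a direct estimate would cost a second factorial.

  The expansion in \<open>1 / n\<close> is exact: the multi-indices with a given partition are
  counted by a falling factorial, a polynomial in \<open>n\<close> whose degree is the number of
  parts.

  Cumulants are defined by derivatives of a log-Laplace transform, and the recursion in terms of
  moments is obtained by differentiating under exponential tilting, where the derivative of a moment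
  is a covariance. This is done under exponential integrability rather than boundedness, because it
  must also apply to the limit law.\<close>

section \<open>Cumulants of set functions\<close>

text \<open>
  If \<open>m B\<close> is the expectation of the product of the variables indexed by \<open>B\<close>, then \<open>cum a m A\<close>
  is the joint cumulant of the variables indexed by \<open>A\<close>; the recursion isolates the part \<open>B\<close> containing
  the root \<open>a\<close> in the moment-cumulant formula, so that no Moebius function is needed.
\<close>

function cum :: "'i \<Rightarrow> ('i set \<Rightarrow> real) \<Rightarrow> 'i set \<Rightarrow> real" where
  "cum a m A =
     (if finite A \<and> a \<in> A then m A - (\<Sum>B | a \<in> B \<and> B \<subset> A. cum a m B * m (A - B)) else 0)"
  by auto
termination
  by (relation "Wellfounded.measure (\<lambda>(a, m, A). card A)") (auto intro: psubset_card_mono)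

declare cum.simps [simp del]

lemma cum_eq:
  assumes "finite A" "a \<in> A"
  shows "cum a m A = m A - (\<Sum>B | a \<in> B \<and> B \<subset> A. cum a m B * m (A - B))"
  unfolding cum.simps[of a m A] using assms by (simp only: simp_thms if_True)

lemma cum_induct [consumes 2, case_names step]:
  assumes "finite A" "a \<in> A"
    and step: "\<And>A. finite A \<Longrightarrow> a \<in> A \<Longrightarrow> (\<And>B. a \<in> B \<Longrightarrow> B \<subset> A \<Longrightarrow> P B) \<Longrightarrow> P A"
  shows "P A"
  using assms(1,2)
proof (induction A rule: finite_psubset_induct)
  case (psubset A)
  show ?case by (rule step[OF psubset(1,3)]) (use psubset in \<open>auto intro: finite_subset\<close>)
qed

lemma cum_cong:
  assumes "finite A" "\<And>B. B \<subseteq> A \<Longrightarrow> m B = m' B"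
  shows "cum a m A = cum a m' A"
proof (cases "a \<in> A")
  case True
  with assms(1) show ?thesis using assms(2)
  proof (induction A rule: cum_induct)
    case (step A)
    have "cum a m B * m (A - B) = cum a m' B * m' (A - B)" if "a \<in> B" "B \<subset> A" for B
    proof -
      have "cum a m B = cum a m' B"
        using step.IH[OF that] step.prems that by (meson dual_order.trans psubset_imp_subset)
      then show ?thesis using step.prems[of "A - B"] by auto
    qed
    then have "(\<Sum>B | a \<in> B \<and> B \<subset> A. cum a m B * m (A - B))
      = (\<Sum>B | a \<in> B \<and> B \<subset> A. cum a m' B * m' (A - B))"
      by (intro sum.cong) auto
    then show ?case using step.prems by (simp add: cum_eq[OF step.hyps])
  qed
qed (simp add: cum.simps[of a _ A])

lemma cum_singleton: "cum a m {a} = m {a}"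
proof -
  have *: "{B. a \<in> B \<and> B \<subset> {a}} = {}" by auto
  show ?thesis by (simp add: cum_eq[of "{a}"] *)
qed

lemma cum_pair:
  assumes "a \<noteq> b"
  shows "cum a m {a, b} = m {a, b} - m {a} * m {b}"
proof -
  have "{B. a \<in> B \<and> B \<subset> {a, b}} = {{a}}" using assms by auto
  then show ?thesis using assms by (simp add: cum_eq[of "{a, b}"] cum_singleton insert_Diff_if)
qed

text \<open>In every product \<open>cum a m B * m (A - B)\<close> the index \<open>k\<close> belongs
  to one of the two factors, which then vanishes. This carries the vanishing of moments over to
  cumulants.\<close>

lemma cum_eq_0:
  assumes "finite A" "a \<in> A" "k \<in> A" "\<And>B. B \<subseteq> A \<Longrightarrow> k \<in> B \<Longrightarrow> m B = 0"
  shows "cum a m A = 0"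
  using assms
proof (induction A rule: cum_induct)
  case (step A)
  have "cum a m B * m (A - B) = 0" if "a \<in> B" "B \<subset> A" for B
  proof (cases "k \<in> B")
    case True
    then have "cum a m B = 0" using step.IH[OF that] step.prems that by (meson dual_order.trans psubset_imp_subset)
    then show ?thesis by simp
  next
    case False
    then show ?thesis using step.prems by auto
  qed
  then have "(\<Sum>B | a \<in> B \<and> B \<subset> A. cum a m B * m (A - B)) = 0" by (intro sum.neutral) auto
  then show ?case using step.hyps step.prems by (simp add: cum_eq[OF step.hyps])
qed

text \<open>Homogeneity holds because the sizes of \<open>B\<close> and \<open>A - B\<close> add up
  to that of \<open>A\<close>. It moves normalisations such as \<open>real n ^ (p - 1)\<close> in
  and out of a cumulant.\<close>

lemma cum_scale:
  assumes "finite A" "a \<in> A"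
  shows "cum a (\<lambda>B. c ^ card B * m B) A = c ^ card A * cum a m A"
  using assms
proof (induction A rule: cum_induct)
  case (step A)
  have "cum a (\<lambda>B. c ^ card B * m B) B * (c ^ card (A - B) * m (A - B))
      = c ^ card A * (cum a m B * m (A - B))" if "a \<in> B" "B \<subset> A" for B
  proof -
    have "finite B" "card B \<le> card A" using that step.hyps
      by (auto intro: card_mono finite_subset)
    then have "card (A - B) + card B = card A" using that by (subst card_Diff_subset) auto
    then have "c ^ card A = c ^ card (A - B) * c ^ card B" by (simp flip: power_add)
    then show ?thesis using step.IH[OF that] by simp
  qed
  then have "(\<Sum>B | a \<in> B \<and> B \<subset> A. cum a (\<lambda>B. c ^ card B * m B) B * (c ^ card (A - B) * m (A - B)))
    = c ^ card A * (\<Sum>B | a \<in> B \<and> B \<subset> A. cum a m B * m (A - B))"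
    unfolding sum_distrib_left by (intro sum.cong) auto
  then show ?case by (simp add: cum_eq[OF step.hyps] right_diff_distrib)
qed

text \<open>A cumulant is a fixed polynomial in the finitely many values \<open>m B\<close> with
  \<open>B \<subseteq> A\<close>, hence continuous in them.\<close>

lemma tendsto_cum:
  assumes "finite A" "a \<in> A" "\<And>B. B \<subseteq> A \<Longrightarrow> ((\<lambda>n. m n B) \<longlongrightarrow> l B) F"
  shows "((\<lambda>n. cum a (m n) A) \<longlongrightarrow> cum a l A) F"
  using assms
proof (induction A rule: cum_induct)
  case (step A)
  have "((\<lambda>n. cum a (m n) B) \<longlongrightarrow> cum a l B) F" if "a \<in> B" "B \<subset> A" for B
    using step.IH[OF that] step.prems that by (meson dual_order.trans psubset_imp_subset)
  moreover have "((\<lambda>n. m n A) \<longlongrightarrow> l A) F" by (rule step.prems) simp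
  moreover have "((\<lambda>n. m n (A - B)) \<longlongrightarrow> l (A - B)) F" for B by (rule step.prems) auto
  ultimately show ?case unfolding cum_eq[OF step.hyps]
    by (intro tendsto_diff tendsto_sum tendsto_mult) auto
qed

lemma sum_PiE_split:
  assumes "finite A" "B \<subseteq> A"
  shows "(\<Sum>f\<in>PiE B (\<lambda>_. J). u f) * (\<Sum>g\<in>PiE (A - B) (\<lambda>_. J). v g)
    = (\<Sum>f\<in>PiE A (\<lambda>_. J). u (restrict f B) * v (restrict f (A - B)) :: real)"
proof -
  have "(\<Sum>f\<in>PiE B (\<lambda>_. J). u f) * (\<Sum>g\<in>PiE (A - B) (\<lambda>_. J). v g)
    = (\<Sum>(f, g)\<in>PiE B (\<lambda>_. J) \<times> PiE (A - B) (\<lambda>_. J). u f * v g)"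
    by (simp add: sum_product sum.cartesian_product)
  also have "\<dots> = (\<Sum>f\<in>PiE A (\<lambda>_. J). u (restrict f B) * v (restrict f (A - B)))"
  proof (rule sum.reindex_bij_witness[where
        j = "\<lambda>(f, g). (\<lambda>x. if x \<in> B then f x else g x)" and
        i = "\<lambda>f. (restrict f B, restrict f (A - B))"], goal_cases)
    case (1 x)
    then show ?case by (auto simp: PiE_def extensional_def fun_eq_iff)
  next
    case (2 x)
    then show ?case using assms by (auto simp: PiE_def extensional_def fun_eq_iff Pi_def split: if_splits)
  next
    case (3 f)
    then show ?case using assms by (auto simp: PiE_def extensional_def fun_eq_iff)
  next
    case (4 f)
    then show ?case using assms by (auto simp: PiE_def)
  next
    case (5 x)
    obtain f g where x: "x = (f, g)" by (cases x)
    have "restrict (\<lambda>x. if x \<in> B then f x else g x) B = f"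
      "restrict (\<lambda>x. if x \<in> B then f x else g x) (A - B) = g"
      using 5 by (auto simp: x PiE_def extensional_def fun_eq_iff)
    then show ?case by (simp add: x)
  qed
  finally show ?thesis .
qed

text \<open>Multilinearity of joint cumulants. When each variable is a sum over \<open>J\<close>,
  \<open>m' B f\<close> is the moment of the summands selected by \<open>f\<close>; since it depends
  on \<open>restrict f B\<close> alone, both factors of the recursion can be read from one selection
  on \<open>A\<close>.\<close>

lemma cum_multilinear:
  assumes "finite A" "a \<in> A" "\<And>B f. B \<subseteq> A \<Longrightarrow> m' B f = m' B (restrict f B)"
    and "\<And>B. B \<subseteq> A \<Longrightarrow> m B = (\<Sum>f\<in>PiE B (\<lambda>_. J). m' B f)"
  shows "cum a m A = (\<Sum>f\<in>PiE A (\<lambda>_. J). cum a (\<lambda>B. m' B f) A)"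
  using assms
proof (induction A rule: cum_induct)
  case (step A)
  have "cum a m B * m (A - B) = (\<Sum>f\<in>PiE A (\<lambda>_. J). cum a (\<lambda>B. m' B f) B * m' (A - B) f)"
    if B: "a \<in> B" "B \<subset> A" for B
  proof -
    have fin: "finite B" using step.hyps B by (auto intro: finite_subset)
    have sub: "C \<subseteq> A" if "C \<subseteq> B" for C using that B by auto
    have "cum a m B = (\<Sum>f\<in>PiE B (\<lambda>_. J). cum a (\<lambda>B. m' B f) B)"
    proof (rule step.IH[OF B])
      show "m' C f = m' C (restrict f C)" "m C = (\<Sum>f\<in>PiE C (\<lambda>_. J). m' C f)" if "C \<subseteq> B" for C f
        by (rule step.prems(1)[OF sub[OF that]], rule step.prems(2)[OF sub[OF that]])
    qed
    moreover have "cum a (\<lambda>C. m' C (restrict f B)) B = cum a (\<lambda>B. m' B f) B" for f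
    proof (intro cum_cong fin)
      fix C assume C: "C \<subseteq> B"
      have "restrict (restrict f B) C = restrict f C" using C by (auto simp: fun_eq_iff)
      then show "m' C (restrict f B) = m' C f" using step.prems(1)[OF sub[OF C]] by metis
    qed
    moreover have "m' (A - B) (restrict f (A - B)) = m' (A - B) f" for f
      by (rule step.prems(1)[symmetric]) auto
    ultimately show ?thesis
      using B step.hyps step.prems(2)[of "A - B"] by (simp add: sum_PiE_split less_imp_le)
  qed
  then have "(\<Sum>B | a \<in> B \<and> B \<subset> A. cum a m B * m (A - B))
    = (\<Sum>f\<in>PiE A (\<lambda>_. J). \<Sum>B | a \<in> B \<and> B \<subset> A. cum a (\<lambda>B. m' B f) B * m' (A - B) f)"
    by (subst sum.swap) simp
  then show ?case using step.hyps step.prems(2)[of A] by (simp add: cum_eq[OF step.hyps] sum_subtractf)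
qed

text \<open>In the recursion the moment of order \<open>r\<close> has coefficient 1 and all others
  have smaller order, so moments are recovered one order at a time. Cumulants start in order 1,
  which is why order 0 is a separate hypothesis.\<close>

lemma cum_card_inject:
  fixes u v :: "nat \<Rightarrow> real"
  assumes "u 0 = v 0"
    and eq: "\<And>r::nat. r \<ge> 1 \<Longrightarrow> cum 1 (\<lambda>B. u (card B)) {1..r} = cum 1 (\<lambda>B. v (card B)) {1..r}"
  shows "u r = v r"
proof (induction r rule: less_induct)
  case (less r)
  show ?case
  proof (cases "r = 0")
    case False
    have lt: "card B < r" if "B \<subset> {1..r}" for B
      using psubset_card_mono[OF _ that] by simp
    have "cum 1 (\<lambda>B. u (card B)) B * u (card ({1..r} - B)) = cum 1 (\<lambda>B. v (card B)) B * v (card ({1..r} - B))"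
      if B: "1 \<in> B" "B \<subset> {1..r}" for B
    proof -
      have "finite B" using B finite_subset by blast
      then have "cum 1 (\<lambda>B. u (card B)) B = cum 1 (\<lambda>B. v (card B)) B"
        using B by (intro cum_cong less.IH lt) auto
      moreover have "{1..r} - B \<subset> {1..r}" using B by auto
      ultimately show ?thesis using less.IH[OF lt] by simp
    qed
    then have "(\<Sum>B | 1 \<in> B \<and> B \<subset> {1..r}. cum 1 (\<lambda>B. u (card B)) B * u (card ({1..r} - B)))
      = (\<Sum>B | 1 \<in> B \<and> B \<subset> {1..r}. cum 1 (\<lambda>B. v (card B)) B * v (card ({1..r} - B)))"
      by (intro sum.cong) auto
    then show ?thesis using False eq[of r] by (simp add: cum_eq[of "{Suc 0..r}"])
  qed (use assms in simp)
qed

text \<open>The hypothesis is the derivative of moments under exponential tilting in the direction \<open>b\<close>.\<close>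

lemma has_derivative_cum:
  assumes "finite A" "a \<in> A" "b \<notin> A"
    and "\<And>B. B \<subseteq> A \<Longrightarrow> ((\<lambda>s. m s B) has_real_derivative (m x (insert b B) - m x B * m x {b})) (at x)"
  shows "((\<lambda>s. cum a (m s) A) has_real_derivative cum a (m x) (insert b A)) (at x)"
  using assms
proof (induction A rule: cum_induct)
  case (step A)
  let ?P = "{B. a \<in> B \<and> B \<subset> A}"
  \<comment> \<open>The product rule applied to the recursion. The terms with factor
    \<open>m x {b}\<close> will reassemble into \<open>cum a (m x) A * m x {b}\<close>.\<close>
  define D where "D = (m x (insert b A) - m x A * m x {b}) - (\<Sum>B\<in>?P.
     cum a (m x) (insert b B) * m x (A - B) +
     (m x (insert b (A - B)) - m x (A - B) * m x {b}) * cum a (m x) B)"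
  have "((\<lambda>s. cum a (m s) B) has_real_derivative cum a (m x) (insert b B)) (at x)"
    if "a \<in> B" "B \<subset> A" for B
    using step.IH[OF that] step.prems that by auto
  then have "((\<lambda>s. m s A - (\<Sum>B\<in>?P. cum a (m s) B * m s (A - B))) has_real_derivative D) (at x)"
    unfolding D_def by (intro DERIV_diff DERIV_sum DERIV_mult step.prems(2)) auto
  moreover have "D = cum a (m x) (insert b A)"
  proof -
    have fin: "finite ?P" using step.hyps by (intro finite_subset[of ?P "Pow A"]) auto
    \<comment> \<open>These three kinds of subsets correspond to the three groups of terms of
      \<open>D\<close>.\<close>
    have eq: "{B. a \<in> B \<and> B \<subset> insert b A} = insert A (?P \<union> insert b ` ?P)"
    proof (rule subset_antisym; rule subsetI)
      fix B assume B: "B \<in> {B. a \<in> B \<and> B \<subset> insert b A}"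
      show "B \<in> insert A (?P \<union> insert b ` ?P)"
      proof (cases "b \<in> B")
        case True
        then have "B = insert b (B - {b})" "B - {b} \<in> ?P" using B step.hyps step.prems(1) by auto
        then show ?thesis by blast
      qed (use B in auto)
    next
      fix B assume "B \<in> insert A (?P \<union> insert b ` ?P)"
      then show "B \<in> {B. a \<in> B \<and> B \<subset> insert b A}" using step.hyps step.prems(1) by auto
    qed
    have disj: "A \<notin> ?P \<union> insert b ` ?P" "?P \<inter> insert b ` ?P = {}" using step by auto
    have inj: "inj_on (insert b) ?P"
    proof (rule inj_on_inverseI[of _ "\<lambda>B. B - {b}"])
      show "insert b B - {b} = B" if "B \<in> ?P" for B using that step.prems(1) by auto
    qed
    have d1: "insert b A - insert b B = A - B" "insert b A - B = insert b (A - B)" if "B \<in> ?P" for B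
      using step.prems that by auto
    have dA: "insert b A - A = {b}" using step.prems by auto
    have cA: "cum a (m x) A = m x A - (\<Sum>B\<in>?P. cum a (m x) B * m x (A - B))"
      by (simp add: cum_eq[OF step.hyps])
    have "cum a (m x) (insert b A) = m x (insert b A) - (cum a (m x) A * m x (insert b A - A)
      + ((\<Sum>B\<in>?P. cum a (m x) B * m x (insert b A - B))
      + (\<Sum>B\<in>?P. cum a (m x) (insert b B) * m x (insert b A - insert b B))))"
      using step.hyps fin disj
      by (simp add: cum_eq[of "insert b A"] eq sum.union_disjoint sum.reindex[OF inj])
    also have "(\<Sum>B\<in>?P. cum a (m x) B * m x (insert b A - B))
      = (\<Sum>B\<in>?P. cum a (m x) B * m x (insert b (A - B)))" by (intro sum.cong refl) (simp only: d1)
    also have "(\<Sum>B\<in>?P. cum a (m x) (insert b B) * m x (insert b A - insert b B))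
      = (\<Sum>B\<in>?P. cum a (m x) (insert b B) * m x (A - B))" by (intro sum.cong refl) (simp only: d1)
    finally have c: "cum a (m x) (insert b A) = m x (insert b A) - (cum a (m x) A * m x {b}
      + ((\<Sum>B\<in>?P. cum a (m x) B * m x (insert b (A - B)))
      + (\<Sum>B\<in>?P. cum a (m x) (insert b B) * m x (A - B))))"
      by (simp only: dA)
    have "(\<Sum>B\<in>?P. cum a (m x) (insert b B) * m x (A - B) +
        (m x (insert b (A - B)) - m x (A - B) * m x {b}) * cum a (m x) B)
      = (\<Sum>B\<in>?P. cum a (m x) (insert b B) * m x (A - B))
        + (\<Sum>B\<in>?P. cum a (m x) B * m x (insert b (A - B)))
        - (\<Sum>B\<in>?P. cum a (m x) B * m x (A - B)) * m x {b}"
      unfolding sum_distrib_right sum.distrib[symmetric] sum_subtractf[symmetric]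
      by (intro sum.cong) (simp_all add: algebra_simps)
    then show ?thesis
      unfolding c D_def cA by (simp add: algebra_simps)
  qed
  ultimately show ?case by (simp add: cum_eq[OF step.hyps])
qed

text \<open>The moment-cumulant formula: as \<open>m {} = 1\<close>, the term \<open>B = A\<close>
  is the left-hand side of the recursion.\<close>

lemma cum_sum:
  assumes "finite A" "a \<in> A" "m {} = 1"
  shows "(\<Sum>B | a \<in> B \<and> B \<subseteq> A. cum a m B * m (A - B)) = m A"
proof -
  have "{B. a \<in> B \<and> B \<subseteq> A} = insert A {B. a \<in> B \<and> B \<subset> A}" using assms(2) by auto
  moreover have "finite {B. a \<in> B \<and> B \<subset> A}"
    by (rule finite_subset[of _ "Pow A"]) (use assms(1) in auto)
  ultimately show ?thesis using cum_eq[OF assms(1,2), of m] assms(3) by simp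
qed

text \<open>The variables split into two independent groups, inside and outside \<open>S\<close>. By
  induction only the sets \<open>B\<close> within \<open>S\<close> contribute to the recursion; then
  \<open>m (A - S)\<close> factors out, and the moment-cumulant formula on
  \<open>A \<inter> S\<close> turns the subtracted sum into \<open>m A\<close>.\<close>

lemma cum_indep_eq_0:
  assumes "finite A" "a \<in> A" "a \<in> S" "\<not> A \<subseteq> S" "m {} = 1"
    and "\<And>B. B \<subseteq> A \<Longrightarrow> m B = m (B \<inter> S) * m (B - S)"
  shows "cum a m A = 0"
  using assms(1,2,4,6)
proof (induction A rule: cum_induct)
  case (step A)
  let ?f = "\<lambda>B. cum a m B * m (A - B)"
  have "?f B = 0" if B: "a \<in> B" "B \<subset> A" "\<not> B \<subseteq> S" for B
  proof -
    have "m C = m (C \<inter> S) * m (C - S)" if "C \<subseteq> B" for C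
      using that B by (intro step.prems(2)) auto
    then show ?thesis using step.IH[OF B(1,2,3)] by simp
  qed
  moreover have "finite {B. a \<in> B \<and> B \<subset> A}"
    by (rule finite_subset[of _ "Pow A"]) (use step.hyps in auto)
  ultimately have "(\<Sum>B | a \<in> B \<and> B \<subset> A. ?f B) = (\<Sum>B | a \<in> B \<and> B \<subseteq> A \<inter> S. ?f B)"
    using step.prems(1) by (intro sum.mono_neutral_right) auto
  also have "\<dots> = (\<Sum>B | a \<in> B \<and> B \<subseteq> A \<inter> S. cum a m B * m (A \<inter> S - B) * m (A - S))"
  proof (intro sum.cong refl)
    fix B assume "B \<in> {B. a \<in> B \<and> B \<subseteq> A \<inter> S}"
    then have "(A - B) \<inter> S = A \<inter> S - B" "A - B - S = A - S" by auto
    then show "?f B = cum a m B * m (A \<inter> S - B) * m (A - S)"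
      using step.prems(2)[of "A - B"] by simp
  qed
  also have "\<dots> = m (A \<inter> S) * m (A - S)"
    using cum_sum[of "A \<inter> S" a m] step.hyps assms(3,5) by (simp flip: sum_distrib_right)
  also have "\<dots> = m A" using step.prems(2)[of A] by simp
  finally show ?case using cum_eq[OF step.hyps, of m] by simp
qed

section \<open>Joint cumulants in terms of mixed moments\<close>

text \<open>One term of the exponential series. After rescaling \<open>x\<close>, it trades a power
  for an exponential of arbitrarily small rate.\<close>

lemma power_le_fact_exp:
  fixes x :: real
  assumes "x \<ge> 0"
  shows "x ^ n \<le> fact n * exp x"
proof -
  have "(\<Sum>k\<in>{n}. x ^ k /\<^sub>R fact k) \<le> (\<Sum>k. x ^ k /\<^sub>R fact k)"
    using assms by (intro sum_le_suminf summable_exp_generic) auto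
  then show ?thesis by (simp add: exp_def field_simps)
qed

lemma norm_exp_minus_linear_le:
  fixes w :: "'b::{banach,real_normed_algebra_1}"
  shows "norm (exp w - 1 - w) \<le> (norm w)\<^sup>2 * exp (norm w)"
proof -
  define f where "f n = inverse (fact (n + 2)) *\<^sub>R (w ^ (n + 2))" for n
  have e: "exp w = 1 + w + (\<Sum>n. f n)" unfolding f_def by (rule exp_first_two_terms)
  have s: "(\<lambda>n. (norm w)\<^sup>2 * (norm w ^ n /\<^sub>R fact n)) sums ((norm w)\<^sup>2 * exp (norm w))"
    by (intro sums_mult exp_converges)
  have le: "norm (f n) \<le> (norm w)\<^sup>2 * (norm w ^ n /\<^sub>R fact n)" for n
  proof -
    have "norm (f n) \<le> inverse (fact (n + 2)) * norm w ^ (n + 2)"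
      unfolding f_def by (simp add: norm_power_ineq mult_left_mono del: fact_Suc power_Suc)
    also have "\<dots> \<le> inverse (fact n) * norm w ^ (n + 2)"
      by (intro mult_right_mono le_imp_inverse_le fact_mono) auto
    finally show ?thesis by (simp add: power2_eq_square mult_ac)
  qed
  have "norm (\<Sum>n. f n) \<le> (\<Sum>n. (norm w)\<^sup>2 * (norm w ^ n /\<^sub>R fact n))"
    using le sums_summable[OF s] by (rule norm_suminf_le)
  then show ?thesis using e sums_unique[OF s] by simp
qed

text \<open>Differentiation under the integral sign, over a general normed field so that it covers
  both real exponential tilting and complex Laplace transforms.\<close>

lemma DERIV_integral_exp:
  fixes W :: "'w \<Rightarrow> 'b::{real_normed_field,banach,second_countable_topology}" and Z :: "'w \<Rightarrow> real"
  assumes [measurable]: "W \<in> borel_measurable M" "Z \<in> borel_measurable M"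
    and "\<delta> > 0" and int: "integrable M (\<lambda>\<omega>. norm (W \<omega>) * exp (\<delta> * \<bar>Z \<omega>\<bar>))"
  shows "((\<lambda>z. \<integral>\<omega>. W \<omega> * exp ((z - z0) * of_real (Z \<omega>)) \<partial>M) has_field_derivative
          (\<integral>\<omega>. W \<omega> * of_real (Z \<omega>) \<partial>M)) (at z0)"
proof -
  \<comment> \<open>Half of the rate bounds the exponential of the increment, the other half absorbs
    a power of \<open>Z\<close>.\<close>
  define \<eta> where "\<eta> = \<delta> / 2"
  have \<eta>: "\<eta> > 0" using \<open>\<delta> > 0\<close> by (simp add: \<eta>_def)
  define g where "g \<omega> = norm (W \<omega>) * exp (\<delta> * \<bar>Z \<omega>\<bar>)" for \<omega>
  have g: "integrable M g" using int by (simp add: g_def[abs_def])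
  have sq: "\<bar>Z \<omega>\<bar> ^ n \<le> fact n / \<eta> ^ n * exp (\<eta> * \<bar>Z \<omega>\<bar>)" for n \<omega>
    using power_le_fact_exp[of "\<eta> * \<bar>Z \<omega>\<bar>" n] \<eta> by (simp add: power_mult_distrib field_simps)
  \<comment> \<open>Used with \<open>n = 0\<close> for the integrand, \<open>n = 1\<close> for its
    derivative and \<open>n = 2\<close> for the Taylor remainder.\<close>
  have Wg: "norm (W \<omega>) * (\<bar>Z \<omega>\<bar> ^ n * exp (\<eta> * \<bar>Z \<omega>\<bar>)) \<le> fact n / \<eta> ^ n * g \<omega>" for n \<omega>
  proof -
    have "norm (W \<omega>) * (\<bar>Z \<omega>\<bar> ^ n * exp (\<eta> * \<bar>Z \<omega>\<bar>))
      \<le> norm (W \<omega>) * (fact n / \<eta> ^ n * exp (\<eta> * \<bar>Z \<omega>\<bar>) * exp (\<eta> * \<bar>Z \<omega>\<bar>))"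
      by (intro mult_left_mono mult_right_mono sq) auto
    also have "\<dots> = fact n / \<eta> ^ n * g \<omega>"
      by (simp add: g_def \<eta>_def field_simps flip: exp_add)
    finally show ?thesis .
  qed
  have int0: "integrable M (\<lambda>\<omega>. W \<omega> * exp (h * of_real (Z \<omega>)))" if "norm h \<le> \<eta>" for h
  proof (rule Bochner_Integration.integrable_bound[OF g])
    have "norm (exp (h * of_real (Z \<omega>))) \<le> exp (\<eta> * \<bar>Z \<omega>\<bar>)" for \<omega>
      using that by (intro order_trans[OF norm_exp]) (auto simp: norm_mult intro: mult_right_mono)
    then have "norm (W \<omega> * exp (h * of_real (Z \<omega>))) \<le> norm (W \<omega>) * exp (\<eta> * \<bar>Z \<omega>\<bar>)" for \<omega>
      unfolding norm_mult by (intro mult_left_mono) auto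
    also have "\<dots> \<omega> \<le> g \<omega>" for \<omega> using Wg[of \<omega> 0] by simp
    finally show "AE \<omega> in M. norm (W \<omega> * exp (h * of_real (Z \<omega>))) \<le> norm (g \<omega>)"
      by (auto simp: g_def)
  qed simp
  have int1: "integrable M (\<lambda>\<omega>. W \<omega> * of_real (Z \<omega>))"
  proof (rule Bochner_Integration.integrable_bound)
    show "integrable M (\<lambda>\<omega>. fact 1 / \<eta> ^ 1 * g \<omega>)" using g by (intro integrable_mult_right)
    have "norm (W \<omega> * of_real (Z \<omega>)) \<le> norm (W \<omega>) * (\<bar>Z \<omega>\<bar> ^ 1 * exp (\<eta> * \<bar>Z \<omega>\<bar>))" for \<omega>
      using \<eta> mult_left_mono[of 1 "exp (\<eta> * \<bar>Z \<omega>\<bar>)" "\<bar>Z \<omega>\<bar>"]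
      by (auto simp: norm_mult intro!: mult_left_mono)
    also have "\<dots> \<omega> \<le> fact 1 / \<eta> ^ 1 * g \<omega>" for \<omega> by (rule Wg)
    finally show "AE \<omega> in M. norm (W \<omega> * of_real (Z \<omega>)) \<le> norm (fact 1 / \<eta> ^ 1 * g \<omega>)"
      using \<eta> by (auto simp: g_def)
  qed simp
  define K where "K = fact 2 / \<eta>\<^sup>2 * (\<integral>\<omega>. g \<omega> \<partial>M)"
  define F where "F h = (\<integral>\<omega>. W \<omega> * exp (h * of_real (Z \<omega>)) \<partial>M)" for h
  define D where "D = (\<integral>\<omega>. W \<omega> * of_real (Z \<omega>) \<partial>M)"
  have bd: "norm (F h - F 0 - h * D) \<le> (norm h)\<^sup>2 * K" if h: "norm h \<le> \<eta>" for h
  proof -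
    have i0: "integrable M (\<lambda>\<omega>. W \<omega> * exp (0 * of_real (Z \<omega>)))" using \<eta> by (intro int0) auto
    have i1: "integrable M (\<lambda>\<omega>. h * (W \<omega> * of_real (Z \<omega>)))" by (intro integrable_mult_right int1)
    have eq: "W \<omega> * (exp (h * of_real (Z \<omega>)) - 1 - h * of_real (Z \<omega>))
      = W \<omega> * exp (h * of_real (Z \<omega>)) - W \<omega> * exp (0 * of_real (Z \<omega>)) - h * (W \<omega> * of_real (Z \<omega>))" for \<omega>
      by (simp add: right_diff_distrib mult_ac)
    have int_eq: "integrable M (\<lambda>\<omega>. W \<omega> * (exp (h * of_real (Z \<omega>)) - 1 - h * of_real (Z \<omega>)))"
      unfolding eq using int0[OF h] i0 i1 by (intro Bochner_Integration.integrable_diff)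
    have "F h - F 0 - h * D = (\<integral>\<omega>. W \<omega> * (exp (h * of_real (Z \<omega>)) - 1 - h * of_real (Z \<omega>)) \<partial>M)"
      unfolding eq using int0[OF h] i0 i1
      by (simp only: Bochner_Integration.integral_diff Bochner_Integration.integrable_diff
          integral_mult_right_zero F_def D_def)
    also have "norm \<dots> \<le> (\<integral>\<omega>. (norm h)\<^sup>2 * (fact 2 / \<eta>\<^sup>2 * g \<omega>) \<partial>M)"
    proof (rule order_trans[OF integral_norm_bound integral_mono])
      show "integrable M (\<lambda>\<omega>. (norm h)\<^sup>2 * (fact 2 / \<eta>\<^sup>2 * g \<omega>))" using g by (intro integrable_mult_right)
      show "integrable M (\<lambda>\<omega>. norm (W \<omega> * (exp (h * of_real (Z \<omega>)) - 1 - h * of_real (Z \<omega>))))"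
        by (rule integrable_norm[OF int_eq])
      fix \<omega>
      have "norm (exp (h * of_real (Z \<omega>)) - 1 - h * of_real (Z \<omega>))
        \<le> (norm h * \<bar>Z \<omega>\<bar>)\<^sup>2 * exp (norm h * \<bar>Z \<omega>\<bar>)"
        using norm_exp_minus_linear_le[of "h * of_real (Z \<omega>)"] by (simp add: norm_mult)
      also have "\<dots> \<le> (norm h * \<bar>Z \<omega>\<bar>)\<^sup>2 * exp (\<eta> * \<bar>Z \<omega>\<bar>)"
        using h by (intro mult_left_mono) (auto intro: mult_right_mono)
      finally have "norm (W \<omega> * (exp (h * of_real (Z \<omega>)) - 1 - h * of_real (Z \<omega>)))
        \<le> norm (W \<omega>) * ((norm h * \<bar>Z \<omega>\<bar>)\<^sup>2 * exp (\<eta> * \<bar>Z \<omega>\<bar>))"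
        unfolding norm_mult by (intro mult_left_mono) auto
      also have "\<dots> = (norm h)\<^sup>2 * (norm (W \<omega>) * (\<bar>Z \<omega>\<bar>\<^sup>2 * exp (\<eta> * \<bar>Z \<omega>\<bar>)))"
        by (simp add: power_mult_distrib mult_ac)
      also have "\<dots> \<le> (norm h)\<^sup>2 * (fact 2 / \<eta>\<^sup>2 * g \<omega>)"
        by (intro mult_left_mono Wg) auto
      finally show "norm (W \<omega> * (exp (h * of_real (Z \<omega>)) - 1 - h * of_real (Z \<omega>)))
        \<le> (norm h)\<^sup>2 * (fact 2 / \<eta>\<^sup>2 * g \<omega>)" .
    qed
    also have "\<dots> = (norm h)\<^sup>2 * K" by (simp add: K_def)
    finally show ?thesis .
  qed
  have "((\<lambda>h. (F h - F 0) / h - D) \<longlongrightarrow> 0) (at 0)"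
  proof (rule Lim_null_comparison)
    show "((\<lambda>h::'b. norm h * K) \<longlongrightarrow> 0) (at 0)" by (auto intro!: tendsto_eq_intros)
    have "\<forall>\<^sub>F h::'b in at 0. h \<noteq> 0 \<and> norm h \<le> \<eta>"
      using \<eta> by (auto simp: eventually_at intro!: exI[of _ \<eta>])
    then show "\<forall>\<^sub>F h in at 0. norm ((F h - F 0) / h - D) \<le> norm h * K"
    proof eventually_elim
      case (elim h)
      then have "(F h - F 0) / h - D = (F h - F 0 - h * D) / h" by (simp add: field_simps)
      then show ?case using bd[of h] elim by (simp add: norm_divide field_simps power2_eq_square)
    qed
  qed
  then have "(F has_field_derivative D) (at 0)" unfolding DERIV_def by (simp add: LIM_zero_iff)
  then have "((\<lambda>z. F (z - z0)) has_field_derivative D) (at z0)"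
    using DERIV_shift[of F D z0 "- z0"] by simp
  then show ?thesis by (simp add: F_def D_def)
qed

text \<open>Under the law tilted by \<open>T t\<close>, the derivative of the moment of
  \<open>A\<close> in direction \<open>b\<close> is its covariance with \<open>Z b\<close>. The
  first derivative of the logarithm is \<open>m t {1}\<close>, and \<open>has_derivative_cum\<close>
  then adds one variable per derivative. At the origin the tilting disappears.\<close>

lemma joint_cumulant_eq_cum:
  fixes Z :: "nat \<Rightarrow> 'w \<Rightarrow> real"
  assumes "prob_space M" and meas: "\<And>i. i \<in> {1..r} \<Longrightarrow> Z i \<in> borel_measurable M"
    and "r \<ge> 1" "\<epsilon> > 0" and int: "integrable M (\<lambda>\<omega>. exp (\<epsilon> * (\<Sum>i=1..r. \<bar>Z i \<omega>\<bar>)))"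
  shows "joint_cumulant M r Z = cum 1 (\<lambda>B. \<integral>\<omega>. (\<Prod>i\<in>B. Z i \<omega>) \<partial>M) {1..r}"
proof -
  interpret prob_space M by fact
  define V where "V \<omega> = (\<Sum>i=1..r. \<bar>Z i \<omega>\<bar>)" for \<omega>
  define T where "T t \<omega> = exp (\<Sum>i=1..r. t i * Z i \<omega>)" for t \<omega>
  define P where "P A \<omega> = (\<Prod>i\<in>A. Z i \<omega>)" for A \<omega>
  define L where "L t A = (\<integral>\<omega>. P A \<omega> * T t \<omega> \<partial>M)" for t A
  define N where "N = {t :: nat \<Rightarrow> real. \<forall>i\<in>{1..r}. \<bar>t i\<bar> < \<epsilon>}"
  note [measurable] = meas
  have meas_T [measurable]: "T t \<in> borel_measurable M" for t unfolding T_def by measurable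
  have meas_P [measurable]: "P A \<in> borel_measurable M" if "A \<subseteq> {1..r}" for A
    using that unfolding P_def by (intro borel_measurable_prod meas) auto
  have meas_V [measurable]: "V \<in> borel_measurable M" unfolding V_def by measurable
  have V0: "0 \<le> V \<omega>" for \<omega> unfolding V_def by (simp add: sum_nonneg)
  have ZV: "\<bar>Z i \<omega>\<bar> \<le> V \<omega>" if "i \<in> {1..r}" for i \<omega>
    unfolding V_def using that by (intro member_le_sum) auto
  have P_le: "\<bar>P A \<omega>\<bar> \<le> V \<omega> ^ card A" if "A \<subseteq> {1..r}" for A \<omega>
  proof -
    have "\<bar>P A \<omega>\<bar> = (\<Prod>i\<in>A. \<bar>Z i \<omega>\<bar>)" by (simp add: P_def abs_prod)
    also have "\<dots> \<le> (\<Prod>i\<in>A. V \<omega>)" using that ZV by (intro prod_mono) auto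
    finally show ?thesis by simp
  qed
  have integ: "\<exists>\<delta>>0. integrable M (\<lambda>\<omega>. norm (P A \<omega> * T t \<omega>) * exp (\<delta> * V \<omega>))"
    if t: "t \<in> N" and A: "A \<subseteq> {1..r}" for t A
  proof -
    define c where "c = Max ((\<lambda>i. \<bar>t i\<bar>) ` {1..r})"
    have c: "c < \<epsilon>" "\<And>i. i \<in> {1..r} \<Longrightarrow> \<bar>t i\<bar> \<le> c"
      using t \<open>r \<ge> 1\<close> by (auto simp: c_def N_def)
    \<comment> \<open>The room between the largest coordinate \<open>c\<close> and
      \<open>\<epsilon>\<close> is halved: one half pays for the monomial \<open>P A\<close>, the
      other for the extra factor in the claim.\<close>
    define \<delta> where "\<delta> = (\<epsilon> - c) / 2"
    have \<delta>: "\<delta> > 0" using c by (simp add: \<delta>_def)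
    define K where "K = fact (card A) / \<delta> ^ card A"
    have K0: "K \<ge> 0" using \<delta> by (simp add: K_def)
    have V: "V \<omega> ^ card A \<le> K * exp (\<delta> * V \<omega>)" for \<omega>
      using power_le_fact_exp[of "\<delta> * V \<omega>" "card A"] V0[of \<omega>] \<delta>
      by (simp add: K_def power_mult_distrib field_simps)
    have tV: "(\<Sum>i=1..r. t i * Z i \<omega>) \<le> c * V \<omega>" for \<omega>
    proof -
      have "(\<Sum>i=1..r. t i * Z i \<omega>) \<le> (\<Sum>i=1..r. \<bar>t i\<bar> * \<bar>Z i \<omega>\<bar>)"
        by (intro sum_mono) (metis abs_ge_self abs_mult)
      also have "\<dots> \<le> (\<Sum>i=1..r. c * \<bar>Z i \<omega>\<bar>)" by (intro sum_mono mult_right_mono c) auto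
      finally show ?thesis by (simp add: V_def sum_distrib_left)
    qed
    have "integrable M (\<lambda>\<omega>. norm (P A \<omega> * T t \<omega>) * exp (\<delta> * V \<omega>))"
    proof (rule Bochner_Integration.integrable_bound)
      show "integrable M (\<lambda>\<omega>. K * exp (\<epsilon> * V \<omega>))"
        using int by (intro integrable_mult_right) (simp add: V_def)
      have "norm (P A \<omega> * T t \<omega>) * exp (\<delta> * V \<omega>) \<le> K * exp (\<delta> * V \<omega>) * exp (c * V \<omega>) * exp (\<delta> * V \<omega>)" for \<omega>
      proof (intro mult_right_mono)
        have "norm (P A \<omega> * T t \<omega>) = \<bar>P A \<omega>\<bar> * T t \<omega>" by (simp add: abs_mult T_def)
        also have "\<dots> \<le> K * exp (\<delta> * V \<omega>) * exp (c * V \<omega>)"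
          using P_le[OF A, of \<omega>] V[of \<omega>] tV[of \<omega>] K0 by (intro mult_mono) (auto simp: T_def)
        finally show "norm (P A \<omega> * T t \<omega>) \<le> K * exp (\<delta> * V \<omega>) * exp (c * V \<omega>)" .
      qed simp
      also have "K * exp (\<delta> * V \<omega>) * exp (c * V \<omega>) * exp (\<delta> * V \<omega>) = K * exp (\<epsilon> * V \<omega>)" for \<omega>
        by (simp add: \<delta>_def field_simps flip: exp_add)
      finally show "AE \<omega> in M. norm (norm (P A \<omega> * T t \<omega>) * exp (\<delta> * V \<omega>)) \<le> norm (K * exp (\<epsilon> * V \<omega>))"
        using K0 by auto
    qed (use A in measurable)
    then show ?thesis using \<delta> by blast
  qed
  have deriv_L: "((\<lambda>s. L (t(b := s)) A) has_real_derivative L t (insert b A)) (at (t b))"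
    if t: "t \<in> N" and A: "A \<subseteq> {1..r}" and b: "b \<in> {1..r}" "b \<notin> A" for t A b
  proof -
    obtain \<delta> where \<delta>: "\<delta> > 0" "integrable M (\<lambda>\<omega>. norm (P A \<omega> * T t \<omega>) * exp (\<delta> * V \<omega>))"
      using integ[OF t A] by blast
    have [measurable]: "Z b \<in> borel_measurable M" "P A \<in> borel_measurable M"
      using meas_P[OF A] meas[OF b(1)] by auto
    have "integrable M (\<lambda>\<omega>. norm (P A \<omega> * T t \<omega>) * exp (\<delta> * \<bar>Z b \<omega>\<bar>))"
      using ZV[OF b(1)] \<delta>(1)
      by (intro Bochner_Integration.integrable_bound[OF \<delta>(2)])
         (auto simp: abs_mult intro!: mult_left_mono)
    then have "((\<lambda>z. \<integral>\<omega>. P A \<omega> * T t \<omega> * exp ((z - t b) * of_real (Z b \<omega>)) \<partial>M) has_real_derivative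
          (\<integral>\<omega>. P A \<omega> * T t \<omega> * of_real (Z b \<omega>) \<partial>M)) (at (t b))"
      by (intro DERIV_integral_exp[where \<delta> = \<delta>]) (use \<delta> in auto)
    moreover have T_eq: "T t \<omega> * exp ((z - t b) * Z b \<omega>) = T (t(b := z)) \<omega>" for z \<omega>
    proof -
      have "(\<Sum>i=1..r. (t(b := z)) i * Z i \<omega>) = z * Z b \<omega> + (\<Sum>i\<in>{1..r} - {b}. (t(b := z)) i * Z i \<omega>)"
        using b by (subst sum.remove[of _ b]) auto
      moreover have "(\<Sum>i\<in>{1..r} - {b}. (t(b := z)) i * Z i \<omega>) = (\<Sum>i\<in>{1..r} - {b}. t i * Z i \<omega>)"
        by (intro sum.cong) auto
      moreover have "(\<Sum>i=1..r. t i * Z i \<omega>) = t b * Z b \<omega> + (\<Sum>i\<in>{1..r} - {b}. t i * Z i \<omega>)"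
        using b by (subst sum.remove[of _ b]) auto
      ultimately show ?thesis by (simp add: T_def left_diff_distrib flip: exp_add)
    qed
    moreover have "(\<lambda>z. \<integral>\<omega>. P A \<omega> * T t \<omega> * exp ((z - t b) * of_real (Z b \<omega>)) \<partial>M) = (\<lambda>s. L (t(b := s)) A)"
      by (simp add: L_def mult.assoc T_eq)
    moreover have "(\<lambda>\<omega>. P A \<omega> * T t \<omega> * of_real (Z b \<omega>)) = (\<lambda>\<omega>. P (insert b A) \<omega> * T t \<omega>)"
      using b finite_subset[OF A] by (auto simp: P_def fun_eq_iff)
    ultimately show ?thesis by (simp only: L_def)
  qed
  have L_pos: "L t {} > 0" if tN: "t \<in> N" for t
  proof -
    obtain \<delta> where \<delta>: "\<delta> > 0" "integrable M (\<lambda>\<omega>. norm (P {} \<omega> * T t \<omega>) * exp (\<delta> * V \<omega>))"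
      using integ[OF tN, of "{}"] by blast
    have "integrable M (T t)"
      using V0 \<delta>(1)
      by (intro Bochner_Integration.integrable_bound[OF \<delta>(2)]) (auto simp: P_def T_def)
    moreover have "0 < T t \<omega>" for \<omega> by (simp add: T_def)
    ultimately have "0 < (\<integral>\<omega>. T t \<omega> \<partial>M)"
      using integral_less_AE_space[of "\<lambda>_. 0" "T t"] by (simp add: emeasure_space_1)
    then show ?thesis by (simp add: L_def P_def)
  qed
  define m where "m t A = L t A / L t {}" for t A
  have deriv_m: "((\<lambda>s. m (t(b := s)) A) has_real_derivative (m t (insert b A) - m t A * m t {b})) (at (t b))"
    if t: "t \<in> N" and A: "A \<subseteq> {1..r}" and b: "b \<in> {1..r}" "b \<notin> A" for t A b
  proof -
    have "((\<lambda>s. L (t(b := s)) A / L (t(b := s)) {}) has_real_derivative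
      (L t (insert b A) * L (t(b := t b)) {} - L (t(b := t b)) A * L t {b}) /
        (L (t(b := t b)) {} * L (t(b := t b)) {})) (at (t b))"
      using L_pos[OF t] by (intro DERIV_divide deriv_L[OF t A b] deriv_L[OF t _ b(1)]) auto
    then show ?thesis using L_pos[OF t] by (simp add: m_def diff_divide_distrib)
  qed
  have mixed: "mixed_deriv k (\<lambda>t. ln (L t {})) t = cum 1 (m t) {1..k}" if "1 \<le> k" "k \<le> r" "t \<in> N" for k t
    using that
  proof (induction k arbitrary: t rule: dec_induct)
    case base
    have "((\<lambda>s. ln (L (t(1 := s)) {})) has_real_derivative 1 / L (t(1 := t 1)) {} * L t {1}) (at (t 1))"
      using L_pos[OF base(2)] base deriv_L[of t "{}" 1]
      by (intro DERIV_chain2[OF DERIV_ln_divide]) auto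
    then show ?case by (simp add: DERIV_imp_deriv cum_singleton m_def)
  next
    case (step k)
    have t: "t \<in> N" by fact
    have b: "\<bar>t (Suc k)\<bar> < \<epsilon>" using step.prems by (auto simp: N_def)
    have "((\<lambda>s. cum 1 (m (t(Suc k := s))) {1..k}) has_real_derivative
        cum 1 (m (t(Suc k := t (Suc k)))) (insert (Suc k) {1..k})) (at (t (Suc k)))"
    proof (rule has_derivative_cum[where m = "\<lambda>s. m (t(Suc k := s))"])
      fix B assume "B \<subseteq> {1..k}"
      then have "B \<subseteq> {1..r}" "Suc k \<notin> B" "Suc k \<in> {1..r}" using step.prems by auto
      then show "((\<lambda>s. m (t(Suc k := s)) B) has_real_derivative
          m (t(Suc k := t (Suc k))) (insert (Suc k) B) -
          m (t(Suc k := t (Suc k))) B * m (t(Suc k := t (Suc k))) {Suc k}) (at (t (Suc k)))"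
        using deriv_m[OF t, of B "Suc k"] by simp
    qed (use step in auto)
    then have d: "((\<lambda>s. cum 1 (m (t(Suc k := s))) {1..k}) has_real_derivative
        cum 1 (m t) (insert (Suc k) {1..k})) (at (t (Suc k)))" by simp
    \<comment> \<open>The induction hypothesis requires the modified point to stay in
      \<open>N\<close>, so the two functions are known to agree only on an open interval around
      \<open>t (Suc k)\<close>.\<close>
    have eq: "cum 1 (m (t(Suc k := s))) {1..k} = mixed_deriv k (\<lambda>t. ln (L t {})) (t(Suc k := s))"
      if "s \<in> {-\<epsilon><..<\<epsilon>}" for s
      using t that step.prems by (intro step.IH[symmetric]) (auto simp: N_def)
    have "((\<lambda>s. mixed_deriv k (\<lambda>t. ln (L t {})) (t(Suc k := s))) has_real_derivative
        cum 1 (m t) (insert (Suc k) {1..k})) (at (t (Suc k)))"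
      using eq b by (intro has_field_derivative_transform_within_open[OF d, where S = "{-\<epsilon><..<\<epsilon>}"]) auto
    moreover have "insert (Suc k) {1..k} = {1..Suc k}" by auto
    ultimately show ?case by (simp add: DERIV_imp_deriv)
  qed
  have "joint_cumulant M r Z = mixed_deriv r (\<lambda>t. ln (L t {})) (\<lambda>_. 0)"
    unfolding joint_cumulant_def by (simp add: L_def P_def T_def)
  also have "\<dots> = cum 1 (m (\<lambda>_. 0)) {1..r}"
    using \<open>\<epsilon> > 0\<close> \<open>r \<ge> 1\<close> by (intro mixed) (auto simp: N_def)
  also have "m (\<lambda>_. 0) = (\<lambda>B. \<integral>\<omega>. (\<Prod>i\<in>B. Z i \<omega>) \<partial>M)"
    by (auto simp: m_def L_def P_def T_def prob_space)
  finally show ?thesis .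
qed

lemma joint_cumulant_bounded:
  fixes Z :: "nat \<Rightarrow> 'w \<Rightarrow> real"
  assumes "prob_space M" and meas: "\<And>i. i \<in> {1..r} \<Longrightarrow> Z i \<in> borel_measurable M"
    and "r \<ge> 1" and bd: "\<And>i \<omega>. i \<in> {1..r} \<Longrightarrow> \<bar>Z i \<omega>\<bar> \<le> C"
  shows "joint_cumulant M r Z = cum 1 (\<lambda>B. \<integral>\<omega>. (\<Prod>i\<in>B. Z i \<omega>) \<partial>M) {1..r}"
proof -
  interpret prob_space M by fact
  note [measurable] = meas
  have "integrable M (\<lambda>\<omega>. exp (1 * (\<Sum>i=1..r. \<bar>Z i \<omega>\<bar>)))"
  proof (rule integrable_const_bound[where B = "exp (\<Sum>i=1..r. C)"])
    show "AE \<omega> in M. norm (exp (1 * (\<Sum>i=1..r. \<bar>Z i \<omega>\<bar>))) \<le> exp (\<Sum>i=1..r. C)"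
      using bd by (auto intro!: sum_mono AE_I2 simp del: sum_constant)
  qed measurable
  then show ?thesis using assms by (intro joint_cumulant_eq_cum[where \<epsilon> = 1]) auto
qed

section \<open>The method of moments\<close>

lemma integrable_power_exp:
  fixes L :: "real measure"
  assumes [measurable_cong]: "sets L = sets borel" and "\<epsilon> > 0" and int: "integrable L (\<lambda>y. exp (\<epsilon> * \<bar>y\<bar>))"
    and "c < \<epsilon>"
  shows "integrable L (\<lambda>y. \<bar>y\<bar> ^ k * exp (c * \<bar>y\<bar>))"
proof (rule Bochner_Integration.integrable_bound)
  define \<delta> where "\<delta> = \<epsilon> - c"
  have \<delta>: "\<delta> > 0" using assms by (simp add: \<delta>_def)
  show "integrable L (\<lambda>y. fact k / \<delta> ^ k * exp (\<epsilon> * \<bar>y\<bar>))" by (intro integrable_mult_right int)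
  have "\<bar>y\<bar> ^ k * exp (c * \<bar>y\<bar>) \<le> (fact k / \<delta> ^ k * exp (\<delta> * \<bar>y\<bar>)) * exp (c * \<bar>y\<bar>)" for y
    using power_le_fact_exp[of "\<delta> * \<bar>y\<bar>" k] \<delta>
    by (intro mult_right_mono) (auto simp: power_mult_distrib field_simps)
  also have "\<dots> y = fact k / \<delta> ^ k * exp (\<epsilon> * \<bar>y\<bar>)" for y
    by (simp add: \<delta>_def left_diff_distrib flip: exp_add)
  finally show "AE y in L. norm (\<bar>y\<bar> ^ k * exp (c * \<bar>y\<bar>)) \<le> norm (fact k / \<delta> ^ k * exp (\<epsilon> * \<bar>y\<bar>))"
    using \<delta> by auto
  show "(\<lambda>y. \<bar>y\<bar> ^ k * exp (c * \<bar>y\<bar>)) \<in> borel_measurable L" by measurable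
qed

lemma integrable_power_of_exp:
  fixes L :: "real measure"
  assumes "sets L = sets borel" and "\<epsilon> > 0" and "integrable L (\<lambda>y. exp (\<epsilon> * \<bar>y\<bar>))"
  shows "integrable L (\<lambda>y. y ^ k)"
proof (rule Bochner_Integration.integrable_bound)
  show "integrable L (\<lambda>y. \<bar>y\<bar> ^ k * exp (0 * \<bar>y\<bar>))"
    using assms by (intro integrable_power_exp) auto
  show "(\<lambda>y. y ^ k) \<in> borel_measurable L" using assms(1) by (simp cong: measurable_cong_sets)
qed (auto simp: power_abs)

lemma exponential_momentsE:
  assumes "real_distribution L" "exponential_moments L"
  obtains \<epsilon> where "\<epsilon> > 0" "integrable L (\<lambda>y. exp (\<epsilon> * \<bar>y\<bar>))"
proof -
  interpret real_distribution L by fact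
  obtain \<epsilon> where \<epsilon>: "\<epsilon> > 0" "\<And>t. \<bar>t\<bar> < \<epsilon> \<Longrightarrow> integrable L (\<lambda>x. exp (t * x))"
    using assms(2) by (auto simp: exponential_moments_def)
  \<comment> \<open>The admissible rates form an open interval, hence the half of
    \<open>\<epsilon>\<close>; the two signs together dominate the exponential of the absolute
    value.\<close>
  have "integrable L (\<lambda>x. exp (\<epsilon> / 2 * x) + exp (- (\<epsilon> / 2) * x))"
    using \<epsilon>(1) by (intro Bochner_Integration.integrable_add \<epsilon>(2)) auto
  moreover have "exp (\<epsilon> / 2 * \<bar>y\<bar>) \<le> \<bar>exp (\<epsilon> / 2 * y) + exp (- (\<epsilon> / 2) * y)\<bar>" for y
    by (cases "y \<ge> 0") (auto intro: order_trans[OF _ abs_ge_self])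
  ultimately have "integrable L (\<lambda>y. exp (\<epsilon> / 2 * \<bar>y\<bar>))"
    by (rule_tac Bochner_Integration.integrable_bound) auto
  then show thesis using \<epsilon>(1) by (intro that[of "\<epsilon> / 2"]) auto
qed

lemma exponential_momentsI:
  assumes "real_distribution L" "\<epsilon> > 0" "integrable L (\<lambda>y. exp (\<epsilon> * \<bar>y\<bar>))"
  shows "exponential_moments L"
  unfolding exponential_moments_def
proof (intro exI[of _ \<epsilon>] conjI allI impI)
  interpret real_distribution L by fact
  fix t :: real assume "\<bar>t\<bar> < \<epsilon>"
  have "t * y \<le> \<epsilon> * \<bar>y\<bar>" for y
  proof -
    have "t * y \<le> \<bar>t\<bar> * \<bar>y\<bar>" by (simp flip: abs_mult)
    also have "\<dots> \<le> \<epsilon> * \<bar>y\<bar>" using \<open>\<bar>t\<bar> < \<epsilon>\<close> by (intro mult_right_mono) auto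
    finally show ?thesis .
  qed
  then show "integrable L (\<lambda>x. exp (t * x))"
    by (intro Bochner_Integration.integrable_bound[OF assms(3)]) auto
qed fact

text \<open>The series of \<open>cosh\<close> has even powers only, so its terms are nonnegative and
  the bounds on moments control the integrals of their absolute values.\<close>

lemma moments_imp_exponential:
  assumes "real_distribution L" and int: "\<And>k. integrable L (\<lambda>y. y ^ k)"
    and bd: "\<And>k. \<bar>\<integral>y. y ^ k \<partial>L\<bar> \<le> K * C ^ k * fact k"
  obtains \<epsilon> where "\<epsilon> > 0" "integrable L (\<lambda>y. exp (\<epsilon> * \<bar>y\<bar>))"
proof -
  interpret real_distribution L by fact
  \<comment> \<open>The sign of \<open>C\<close> is not prescribed; \<open>D\<close> is a positive
    bound for its absolute value.\<close>
  define D where "D = \<bar>C\<bar> + 1"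
  have D: "D > 0" by (simp add: D_def)
  have K: "K \<ge> 0" using order_trans[OF abs_ge_zero bd[of 0]] by simp
  have bdD: "\<bar>\<integral>y. y ^ k \<partial>L\<bar> \<le> K * D ^ k * fact k" for k
  proof -
    have "C ^ k \<le> \<bar>C\<bar> ^ k" by (metis abs_ge_self power_abs)
    also have "\<dots> \<le> D ^ k" by (intro power_mono) (auto simp: D_def)
    finally show ?thesis using K by (intro order_trans[OF bd] mult_right_mono mult_left_mono) auto
  qed
  \<comment> \<open>With \<open>\<epsilon> * D = 1 / 2\<close> the factorials cancel and the
    integrated series is dominated by a geometric one.\<close>
  define \<epsilon> where "\<epsilon> = 1 / (2 * D)"
  have \<epsilon>: "\<epsilon> > 0" using D by (simp add: \<epsilon>_def)
  define f where "f n y = (if even n then (\<epsilon> * y) ^ n /\<^sub>R fact n else 0)" for n and y :: real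
  have f0: "f n y \<ge> 0" for n y by (auto simp: f_def zero_le_even_power)
  have intf: "integrable L (f n)" for n
    unfolding f_def using int[of n]
    by (cases "even n") (auto simp: power_mult_distrib intro!: integrable_mult_right integrable_scaleR_right)
  have sumf: "(\<lambda>n. f n y) sums cosh (\<epsilon> * y)" for y unfolding f_def by (rule cosh_converges)
  have bdf: "(\<integral>y. f n y \<partial>L) \<le> K * (1 / 2) ^ n" for n
  proof (cases "even n")
    case True
    have "(\<integral>y. f n y \<partial>L) = \<epsilon> ^ n / fact n * (\<integral>y. y ^ n \<partial>L)"
      using True by (simp add: f_def power_mult_distrib divide_inverse mult_ac)
    also have "\<dots> \<le> \<epsilon> ^ n / fact n * (K * D ^ n * fact n)"
      using bdD[of n] \<epsilon> by (intro mult_left_mono) auto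
    also have "\<dots> = K * (\<epsilon> * D) ^ n" by (simp add: power_mult_distrib)
    also have "\<epsilon> * D = 1 / 2" using D by (simp add: \<epsilon>_def)
    finally show ?thesis .
  qed (use K in \<open>simp add: f_def\<close>)
  have "integrable L (\<lambda>y. \<Sum>n. f n y)"
  proof (rule integrable_suminf[OF intf])
    show "AE y in L. summable (\<lambda>n. norm (f n y))" using f0 sums_summable[OF sumf] by simp
    have "summable (\<lambda>n. K * (1 / 2) ^ n)" by (intro summable_mult summable_geometric) auto
    moreover have "(\<integral>y. norm (f n y) \<partial>L) \<le> K * (1 / 2) ^ n" for n using bdf[of n] f0 by simp
    ultimately show "summable (\<lambda>n. \<integral>y. norm (f n y) \<partial>L)"
      by (rule_tac summable_comparison_test'[where g = "\<lambda>n. K * (1 / 2) ^ n" and N = 0]) (auto simp: f0 integral_nonneg_AE)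
  qed
  moreover have "(\<Sum>n. f n y) = cosh (\<epsilon> * y)" for y using sumf by (rule sums_unique[symmetric])
  ultimately have i: "integrable L (\<lambda>y. 2 * cosh (\<epsilon> * y))" by simp
  have "exp (\<epsilon> * \<bar>y\<bar>) \<le> 2 * cosh (\<epsilon> * y)" for y
    by (cases "y \<ge> 0") (auto simp: cosh_def)
  then have "integrable L (\<lambda>y. exp (\<epsilon> * \<bar>y\<bar>))"
    by (intro Bochner_Integration.integrable_bound[OF i]) auto
  then show thesis using \<epsilon> that by blast
qed

lemma DERIV_complex_mgf:
  fixes L :: "real measure" and z :: complex
  assumes [measurable_cong]: "sets L = sets borel" and "\<epsilon> > 0" and int: "integrable L (\<lambda>y. exp (\<epsilon> * \<bar>y\<bar>))"
    and z: "\<bar>Re z\<bar> < \<epsilon>"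
  shows "((\<lambda>z. \<integral>y. of_real (y ^ k) * exp (z * of_real y) \<partial>L) has_field_derivative
    (\<integral>y. of_real (y ^ Suc k) * exp (z * of_real y) \<partial>L)) (at z)"
proof -
  \<comment> \<open>Half the distance from \<open>z\<close> to the boundary of the strip, so that
    \<open>\<bar>Re z\<bar> + \<delta> < \<epsilon>\<close>.\<close>
  define \<delta> where "\<delta> = (\<epsilon> - \<bar>Re z\<bar>) / 2"
  define W where "W y = of_real (y ^ k) * exp (z * of_real y)" for y :: real
  have "((\<lambda>w. \<integral>y. W y * exp ((w - z) * of_real y) \<partial>L) has_field_derivative
    (\<integral>y. W y * of_real y \<partial>L)) (at z)"
  proof (rule DERIV_integral_exp[where \<delta> = \<delta>])
    show "W \<in> borel_measurable L" unfolding W_def by measurable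
    show "(\<lambda>y. y) \<in> borel_measurable L" by measurable
    show "\<delta> > 0" using z by (simp add: \<delta>_def)
    have "integrable L (\<lambda>y. \<bar>y\<bar> ^ k * exp ((\<bar>Re z\<bar> + \<delta>) * \<bar>y\<bar>))"
      using z \<open>\<epsilon> > 0\<close> int by (intro integrable_power_exp[where \<epsilon> = \<epsilon>]) (auto simp: \<delta>_def assms(1) field_simps)
    then show "integrable L (\<lambda>y. norm (W y) * exp (\<delta> * \<bar>y\<bar>))"
    proof (rule Bochner_Integration.integrable_bound)
      have "norm (W y) * exp (\<delta> * \<bar>y\<bar>) \<le> \<bar>y\<bar> ^ k * exp ((\<bar>Re z\<bar> + \<delta>) * \<bar>y\<bar>)" for y
      proof -
        have "Re z * y \<le> \<bar>Re z\<bar> * \<bar>y\<bar>" by (simp flip: abs_mult)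
        then have "\<bar>y\<bar> ^ k * exp (Re z * y + \<delta> * \<bar>y\<bar>) \<le> \<bar>y\<bar> ^ k * exp ((\<bar>Re z\<bar> + \<delta>) * \<bar>y\<bar>)"
          by (intro mult_left_mono) (auto simp: distrib_right)
        then show ?thesis by (simp add: W_def norm_mult norm_power exp_add power_abs)
      qed
      then show "AE y in L. norm (norm (W y) * exp (\<delta> * \<bar>y\<bar>)) \<le> norm (\<bar>y\<bar> ^ k * exp ((\<bar>Re z\<bar> + \<delta>) * \<bar>y\<bar>))"
        by (auto simp: abs_mult)
      show "(\<lambda>y. norm (W y) * exp (\<delta> * \<bar>y\<bar>)) \<in> borel_measurable L" unfolding W_def by measurable
    qed
  qed
  moreover have "W y * exp ((w - z) * of_real y) = of_real (y ^ k) * exp (w * of_real y)" for w y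
    by (simp add: W_def left_diff_distrib mult.assoc flip: exp_add)
  moreover have "W y * of_real y = of_real (y ^ Suc k) * exp (z * of_real y)" for y
    by (simp add: W_def)
  ultimately show ?thesis by (simp only:)
qed

text \<open>The moments are the derivatives at 0 of Laplace transforms that are holomorphic on a
  strip. The identity theorem propagates their equality from 0 to the whole strip, in particular to
  the imaginary axis, where they are the characteristic functions.\<close>

theorem moments_determine:
  assumes L: "real_distribution L" and N: "real_distribution N"
    and "\<epsilon> > 0" and intL: "integrable L (\<lambda>y. exp (\<epsilon> * \<bar>y\<bar>))" and intN: "integrable N (\<lambda>y. exp (\<epsilon> * \<bar>y\<bar>))"
    and eq: "\<And>k. (\<integral>y. y ^ k \<partial>N) = (\<integral>y. y ^ k \<partial>L)"
  shows "N = L"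
proof -
  interpret L: real_distribution L by fact
  interpret N: real_distribution N by fact
  \<comment> \<open>the difference of the \<open>k\<close>-th derivatives of the complex Laplace transforms on the strip \<open>S\<close>\<close>
  define F where "F k z = (\<integral>y. of_real (y ^ k) * exp (z * of_real y) \<partial>L) - (\<integral>y. of_real (y ^ k) * exp (z * of_real y) \<partial>N)"
    for k and z :: complex
  define S where "S = {z::complex. Re z < \<epsilon>} \<inter> {z. Re z > - \<epsilon>}"
  have S: "open S" "connected S"
    unfolding S_def
    by (auto intro!: open_Int open_halfspace_Re_lt open_halfspace_Re_gt convex_connected convex_Int
        convex_halfspace_Re_lt convex_halfspace_Re_gt)
  have der: "(F k has_field_derivative F (Suc k) z) (at z)" if "z \<in> S" for k z
    unfolding F_def using that assms
    by (intro DERIV_diff DERIV_complex_mgf[where \<epsilon> = \<epsilon>]) (auto simp: S_def)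
  have higher: "(deriv ^^ n) (F 0) z = F n z" if "z \<in> S" for n z
    using that
  proof (induction n arbitrary: z)
    case (Suc n)
    have "((deriv ^^ n) (F 0) has_field_derivative F (Suc n) z) (at z)"
      by (rule has_field_derivative_transform_within_open[OF der S(1)]) (use Suc in auto)
    then show ?case by (simp add: DERIV_imp_deriv)
  qed simp
  have "(deriv ^^ n) (F 0) 0 = 0" for n
  proof -
    have "F n 0 = of_real (\<integral>y. y ^ n \<partial>L) - of_real (\<integral>y. y ^ n \<partial>N)" by (simp add: F_def flip: integral_complex_of_real of_real_power)
    then show ?thesis using higher[of 0 n] eq[of n] \<open>\<epsilon> > 0\<close> by (simp add: S_def)
  qed
  moreover have "F 0 holomorphic_on S"
    using der S(1) by (auto simp: holomorphic_on_open)
  ultimately have F0: "F 0 z = 0" if "z \<in> S" for z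
    using holomorphic_fun_eq_0_on_connected[of "F 0" S 0 z] S that \<open>\<epsilon> > 0\<close> by (auto simp: S_def)
  have "char N t = char L t" for t
    using F0[of "\<i> * of_real t"] \<open>\<epsilon> > 0\<close> by (simp add: F_def char_def S_def mult_ac)
  then show ?thesis using Levy_uniqueness[OF N L] by auto
qed

text \<open>The bound is asked of \<open>L\<close> alone, since equality of moments transfers it to
  \<open>N\<close>.\<close>

lemma moments_bounded_determine:
  assumes L: "real_distribution L" and N: "real_distribution N"
    and int: "\<And>k. integrable L (\<lambda>y. y ^ k)" "\<And>k. integrable N (\<lambda>y. y ^ k)"
    and bd: "\<And>k. \<bar>\<integral>y. y ^ k \<partial>L\<bar> \<le> K * C ^ k * fact k"
    and eq: "\<And>k. (\<integral>y. y ^ k \<partial>N) = (\<integral>y. y ^ k \<partial>L)"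
  shows "N = L"
proof -
  obtain \<epsilon> where \<epsilon>: "\<epsilon> > 0" "integrable L (\<lambda>y. exp (\<epsilon> * \<bar>y\<bar>))"
    using moments_imp_exponential[OF L int(1) bd] by blast
  obtain \<delta> where \<delta>: "\<delta> > 0" "integrable N (\<lambda>y. exp (\<delta> * \<bar>y\<bar>))"
    using moments_imp_exponential[OF N int(2)] bd eq by metis
  interpret L: real_distribution L by fact
  interpret N: real_distribution N by fact
  define \<eta> where "\<eta> = min \<epsilon> \<delta>"
  have "integrable L (\<lambda>y. exp (\<eta> * \<bar>y\<bar>))"
    by (rule Bochner_Integration.integrable_bound[OF \<epsilon>(2)]) (auto simp: \<eta>_def intro!: AE_I2 mult_right_mono)
  moreover have "integrable N (\<lambda>y. exp (\<eta> * \<bar>y\<bar>))"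
    by (rule Bochner_Integration.integrable_bound[OF \<delta>(2)]) (auto simp: \<eta>_def intro!: AE_I2 mult_right_mono)
  ultimately show ?thesis using \<epsilon>(1) \<delta>(1) eq by (intro moments_determine[OF L N, of \<eta>]) (auto simp: \<eta>_def)
qed

text \<open>Weak convergence controls bounded continuous functions, so powers are truncated.
  Truncated even powers increase to the full ones and monotone convergence shows that
  \<open>L\<close> has all moments. For a general power, a higher even moment controls the
  truncation error uniformly in \<open>n\<close>.\<close>

lemma weak_conv_moments:
  assumes \<mu>: "\<And>n. real_distribution (\<mu> n)" and L: "real_distribution L" and conv: "weak_conv_m \<mu> L"
    and int: "\<And>n k. integrable (\<mu> n) (\<lambda>y. y ^ k)"
    and lim: "\<And>k. (\<lambda>n. \<integral>y. y ^ k \<partial>\<mu> n) \<longlonglongrightarrow> m k"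
  shows "integrable L (\<lambda>y. y ^ k)" "(\<integral>y. y ^ k \<partial>L) = m k"
proof -
  interpret L: real_distribution L by fact
  interpret \<mu>: real_distribution "\<mu> n" for n by fact
  have weak: "(\<lambda>n. \<integral>y. f y \<partial>\<mu> n) \<longlonglongrightarrow> (\<integral>y. f y \<partial>L)"
    if "\<And>x. isCont f x" "\<And>x. norm (f x) \<le> B" for f :: "real \<Rightarrow> real" and B
    by (rule weak_conv_imp_integral_bdd_continuous_conv[OF \<mu> L conv that])
  have even_int: "integrable L (\<lambda>y. y ^ (2 * k)) \<and> (\<integral>y. y ^ (2 * k) \<partial>L) \<le> m (2 * k)" for k
  proof -
    define f where "f j y = min (y ^ (2 * k)) (real j)" for j and y :: real
    have f0: "0 \<le> f j y" "f j y \<le> y ^ (2 * k)" "f j y \<le> real j" for j y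
      by (auto simp: f_def zero_le_even_power)
    have cont: "isCont (f j) x" for j x unfolding f_def by (intro continuous_intros)
    have [measurable]: "f j \<in> borel_measurable borel" for j unfolding f_def by measurable
    have intf: "integrable L (f j)" "integrable (\<mu> n) (f j)" for j n
      using f0 by (auto intro!: L.integrable_const_bound[where B = "real j"] \<mu>.integrable_const_bound[where B = "real j"])
    have le: "(\<integral>y. f j y \<partial>L) \<le> m (2 * k)" for j
    proof (rule LIMSEQ_le[OF weak lim])
      show "isCont (f j) x" for x by (rule cont)
      show "norm (f j x) \<le> real j" for x using f0 by simp
      show "\<exists>N. \<forall>n\<ge>N. (\<integral>y. f j y \<partial>\<mu> n) \<le> (\<integral>y. y ^ (2 * k) \<partial>\<mu> n)"
        using f0 intf int by (auto intro!: integral_mono)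
    qed
    have inc: "incseq (\<lambda>j. \<integral>y. f j y \<partial>L)"
      by (auto simp: incseq_def intro!: integral_mono intf) (auto simp: f_def)
    obtain l where l: "(\<lambda>j. \<integral>y. f j y \<partial>L) \<longlonglongrightarrow> l" "\<And>j. (\<integral>y. f j y \<partial>L) \<le> l"
      using incseq_convergent[OF inc, of "m (2 * k)"] le by blast
    have mc: "AE x in L. mono (\<lambda>j. f j x)" "(\<lambda>y. y ^ (2 * k)) \<in> borel_measurable L"
      by (auto simp: mono_def f_def)
    have lim: "AE x in L. (\<lambda>j. f j x) \<longlonglongrightarrow> x ^ (2 * k)"
    proof (rule AE_I2)
      fix x :: real
      obtain N where "x ^ (2 * k) \<le> real N" using real_arch_simple by blast
      then have "f j x = x ^ (2 * k)" if "N \<le> j" for j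
        using order_trans[of "x ^ (2 * k)" "real N" "real j"] that by (simp add: f_def)
      then have "\<forall>\<^sub>F j in sequentially. f j x = x ^ (2 * k)"
        by (rule eventually_sequentiallyI)
      then show "(\<lambda>j. f j x) \<longlonglongrightarrow> x ^ (2 * k)" by (rule tendsto_eventually)
    qed
    have "integrable L (\<lambda>y. y ^ (2 * k))" "(\<integral>y. y ^ (2 * k) \<partial>L) = l"
      using integral_monotone_convergence_nonneg[OF intf(1) mc(1) _ lim l(1) mc(2)] f0 by auto
    moreover have "l \<le> m (2 * k)" using l(1) le by (intro LIMSEQ_le_const2) auto
    ultimately show ?thesis by simp
  qed
  have int_L: "integrable L (\<lambda>y. y ^ k)" for k
  proof (rule Bochner_Integration.integrable_bound)
    show "integrable L (\<lambda>y. 1 + y ^ (2 * k))" using even_int[of k] by auto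
    have "\<bar>y\<bar> ^ k \<le> 1 + y ^ (2 * k)" for y :: real
    proof -
      have "0 \<le> (\<bar>y\<bar> ^ k - 1)\<^sup>2 + (\<bar>y\<bar> ^ k)\<^sup>2 + 1" by simp
      moreover have "(\<bar>y\<bar> ^ k)\<^sup>2 = y ^ (2 * k)" by (simp add: power_mult mult.commute[of 2] flip: power_abs)
      ultimately show ?thesis by (simp add: power2_diff algebra_simps)
    qed
    then show "AE y in L. norm (y ^ k) \<le> norm (1 + y ^ (2 * k))"
      by (auto simp: power_abs intro: order_trans[OF _ abs_ge_self])
  qed simp
  show "integrable L (\<lambda>y. y ^ k)" by (rule int_L)
  define B where "B = m (2 * (k + 1))"
  define h where "h R y = (max (- R) (min R y)) ^ k" for R y :: real
  \<comment> \<open>Where the truncation acts,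
    \<open>R \<le> \<bar>y\<bar> \<le> \<bar>y\<bar> ^ (k + 2)\<close> because
    \<open>R \<ge> 1\<close>; a further factor \<open>\<bar>y\<bar> ^ k\<close> produces the even
    power.\<close>
  have diff: "\<bar>y ^ k - h R y\<bar> \<le> 2 * y ^ (2 * (k + 1)) / R" if "R \<ge> 1" for R y
  proof (cases "\<bar>y\<bar> \<le> R")
    case True
    then have "max (- R) (min R y) = y" by auto
    moreover have "0 \<le> y ^ (2 * (k + 1))" by (intro zero_le_even_power) simp
    ultimately show ?thesis using that by (simp add: h_def)
  next
    case False
    then have y: "\<bar>y\<bar> > R" by simp
    have "\<bar>max (- R) (min R y)\<bar> \<le> \<bar>y\<bar>" using y that by auto
    then have "\<bar>h R y\<bar> \<le> \<bar>y\<bar> ^ k" unfolding h_def power_abs by (intro power_mono) auto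
    then have "\<bar>y ^ k - h R y\<bar> \<le> 2 * \<bar>y\<bar> ^ k" using abs_triangle_ineq4[of "y ^ k" "h R y"] by (simp add: power_abs)
    moreover have "R * \<bar>y\<bar> ^ k \<le> y ^ (2 * (k + 1))"
    proof -
      have "R * \<bar>y\<bar> ^ k \<le> \<bar>y\<bar> ^ (k + 2) * \<bar>y\<bar> ^ k"
      proof (intro mult_right_mono)
        have "R \<le> \<bar>y\<bar> ^ 1" using y by simp
        also have "\<dots> \<le> \<bar>y\<bar> ^ (k + 2)" using y that by (intro power_increasing) auto
        finally show "R \<le> \<bar>y\<bar> ^ (k + 2)" .
      qed simp
      also have "\<dots> = \<bar>y\<bar> ^ (2 * (k + 1))" by (simp flip: power_add add: mult_2)
      finally show ?thesis by (simp add: power_even_abs)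
    qed
    ultimately have "R * \<bar>y ^ k - h R y\<bar> \<le> 2 * y ^ (2 * (k + 1))"
      using order_trans[OF mult_left_mono[of "\<bar>y ^ k - h R y\<bar>" "2 * \<bar>y\<bar> ^ k" R]] that by auto
    then show ?thesis using that by (simp add: pos_le_divide_eq mult.commute)
  qed
  have h_bd: "norm (h R y) \<le> R ^ k" if "R \<ge> 1" for R y
    unfolding h_def norm_power using that by (intro power_mono) auto
  have h_cont: "isCont (h R) x" for R x unfolding h_def by (intro continuous_intros)
  have [measurable]: "h R \<in> borel_measurable borel" for R unfolding h_def by measurable
  have h_int: "integrable L (h R)" "integrable (\<mu> n) (h R)" if "R \<ge> 1" for R n
    using h_bd[OF that] by (auto intro!: L.integrable_const_bound[where B = "R ^ k"] \<mu>.integrable_const_bound[where B = "R ^ k"])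
  have bound: "\<bar>(\<integral>y. y ^ k \<partial>Q) - (\<integral>y. h R y \<partial>Q)\<bar> \<le> 2 * (\<integral>y. y ^ (2 * (k + 1)) \<partial>Q) / R"
    if "R \<ge> 1" "integrable Q (\<lambda>y. y ^ k)" "integrable Q (h R)" "integrable Q (\<lambda>y. y ^ (2 * (k + 1)))"
    for Q R
  proof -
    have "(\<integral>y. y ^ k \<partial>Q) - (\<integral>y. h R y \<partial>Q) = (\<integral>y. y ^ k - h R y \<partial>Q)" using that by simp
    also have "\<bar>\<dots>\<bar> \<le> (\<integral>y. \<bar>y ^ k - h R y\<bar> \<partial>Q)" by (rule integral_abs_bound)
    also have "\<dots> \<le> (\<integral>y. 2 * y ^ (2 * (k + 1)) / R \<partial>Q)"
      using that diff[OF that(1)] by (intro integral_mono integrable_abs) auto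
    finally show ?thesis by simp
  qed
  \<comment> \<open>There are two truncation errors, one along the sequence and one under
    \<open>L\<close>, each at most \<open>2 * B / R\<close>.\<close>
  have main: "\<bar>m k - (\<integral>y. y ^ k \<partial>L)\<bar> \<le> (4 * B) / R" if R: "R \<ge> 1" for R
  proof -
    have "(\<lambda>n. \<bar>(\<integral>y. y ^ k \<partial>\<mu> n) - (\<integral>y. h R y \<partial>\<mu> n)\<bar>) \<longlonglongrightarrow> \<bar>m k - (\<integral>y. h R y \<partial>L)\<bar>"
      by (intro tendsto_intros lim weak[OF h_cont h_bd[OF R]])
    moreover have "(\<lambda>n. 2 * (\<integral>y. y ^ (2 * (k + 1)) \<partial>\<mu> n) / R) \<longlonglongrightarrow> 2 * B / R"
      unfolding B_def using R by (intro tendsto_intros lim) auto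
    ultimately have "\<bar>m k - (\<integral>y. h R y \<partial>L)\<bar> \<le> 2 * B / R"
      by (rule LIMSEQ_le) (use bound[OF R int h_int(2)[OF R] int] in auto)
    moreover have "\<bar>(\<integral>y. y ^ k \<partial>L) - (\<integral>y. h R y \<partial>L)\<bar> \<le> 2 * (\<integral>y. y ^ (2 * (k + 1)) \<partial>L) / R"
      by (rule bound[OF R int_L h_int(1)[OF R] int_L])
    moreover have "2 * (\<integral>y. y ^ (2 * (k + 1)) \<partial>L) / R \<le> 2 * B / R"
      using even_int[of "k + 1"] R unfolding B_def by (intro divide_right_mono) auto
    moreover have "(4 * B) / R = 2 * B / R + 2 * B / R" by simp
    ultimately show ?thesis by linarith
  qed
  have "\<bar>m k - (\<integral>y. y ^ k \<partial>L)\<bar> \<le> 0"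
  proof (rule LIMSEQ_le_const)
    show "(\<lambda>n. (4 * B) / real (Suc n)) \<longlonglongrightarrow> 0"
      using LIMSEQ_Suc[OF lim_const_over_n[of "4 * B"]] by simp
    show "\<exists>N. \<forall>n\<ge>N. \<bar>m k - (\<integral>y. y ^ k \<partial>L)\<bar> \<le> (4 * B) / real (Suc n)" using main by auto
  qed
  then show "(\<integral>y. y ^ k \<partial>L) = m k" by simp
qed

text \<open>Bounded second moments give tightness. Every subsequential limit has the moments
  \<open>m\<close>, whose growth determines the law, so all subsequential limits coincide.\<close>

theorem method_of_moments:
  assumes \<mu>: "\<And>n. real_distribution (\<mu> n)" and int: "\<And>n k. integrable (\<mu> n) (\<lambda>y. y ^ k)"
    and lim: "\<And>k. (\<lambda>n. \<integral>y. y ^ k \<partial>\<mu> n) \<longlonglongrightarrow> m k"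
    and bd: "\<And>k. \<bar>m k\<bar> \<le> K * C ^ k * fact k"
  obtains L where "real_distribution L" "weak_conv_m \<mu> L"
    "\<And>k. integrable L (\<lambda>y. y ^ k)" "\<And>k. (\<integral>y. y ^ k \<partial>L) = m k"
proof -
  interpret \<mu>: real_distribution "\<mu> n" for n by fact
  have tight: "tight \<mu>"
    unfolding tight_def
  proof (intro conjI allI impI \<mu>)
    fix \<epsilon> :: real assume "\<epsilon> > 0"
    obtain B where B: "B > 0" "\<And>n. norm (\<integral>y. y ^ 2 \<partial>\<mu> n) \<le> B"
      using convergent_imp_Bseq[OF convergentI[OF lim[of 2]]] by (auto simp: Bseq_def)
    \<comment> \<open>Makes the Markov bound \<open>B / R\<^sup>2\<close> equal to
      \<open>\<epsilon> / 2\<close>.\<close>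
    define R where "R = sqrt (2 * B / \<epsilon>)"
    have R: "R > 0" "R\<^sup>2 = 2 * B / \<epsilon>" using B \<open>\<epsilon> > 0\<close> by (auto simp: R_def)
    have "measure (\<mu> n) {-R<..R} > 1 - \<epsilon>" for n
    proof -
      have "\<P>(y in \<mu> n. R\<^sup>2 \<le> y\<^sup>2) \<le> (\<integral>y. y\<^sup>2 \<partial>\<mu> n) / R\<^sup>2"
        using int[of n 2] R B(1) \<open>\<epsilon> > 0\<close> by (intro integral_Markov_inequality_measure[where A = "{}"]) auto
      also have "\<dots> \<le> B / R\<^sup>2" using B(2)[of n] by (intro divide_right_mono) auto
      also have "\<dots> < \<epsilon>" using R B \<open>\<epsilon> > 0\<close> by (simp add: field_simps)
      finally have "\<P>(y in \<mu> n. R\<^sup>2 \<le> y\<^sup>2) < \<epsilon>" .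
      moreover have "1 - \<mu>.prob n {-R<..R} = \<mu>.prob n (space (\<mu> n) - {-R<..R})"
        by (subst \<mu>.prob_compl) auto
      moreover have "\<mu>.prob n (space (\<mu> n) - {-R<..R}) \<le> \<P>(y in \<mu> n. R\<^sup>2 \<le> y\<^sup>2)"
      proof (intro \<mu>.finite_measure_mono)
        have "R\<^sup>2 \<le> x\<^sup>2" if "x \<notin> {-R<..R}" for x
          using that R(1) by (auto simp flip: abs_le_square_iff)
        then show "space (\<mu> n) - {-R<..R} \<subseteq> {y \<in> space (\<mu> n). R\<^sup>2 \<le> y\<^sup>2}" by blast
      qed simp
      ultimately show ?thesis by simp
    qed
    then show "\<exists>a b. a < b \<and> (\<forall>n. 1 - \<epsilon> < measure (\<mu> n) {a<..b})"
      using R(1) by (intro exI[of _ "- R"] exI[of _ R]) auto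
  qed
  have sub: "(\<forall>k. integrable \<nu> (\<lambda>y. y ^ k)) \<and> (\<forall>k. (\<integral>y. y ^ k \<partial>\<nu>) = m k)"
    if "strict_mono s" "real_distribution \<nu>" "weak_conv_m (\<mu> \<circ> s) \<nu>" for s \<nu>
  proof -
    have "(\<lambda>n. \<integral>y. y ^ k \<partial>(\<mu> \<circ> s) n) \<longlonglongrightarrow> m k" for k
      using LIMSEQ_subseq_LIMSEQ[OF lim that(1), of k] by (simp add: comp_def)
    then show ?thesis
      using weak_conv_moments[of "\<mu> \<circ> s" \<nu> m] that \<mu> int by auto
  qed
  obtain r L where L: "strict_mono r" "real_distribution L" "weak_conv_m (\<mu> \<circ> id \<circ> r) L"
    using tight_imp_convergent_subsubsequence[OF tight strict_mono_id] by blast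
  have mL: "integrable L (\<lambda>y. y ^ k)" "(\<integral>y. y ^ k \<partial>L) = m k" for k
    using sub[OF L(1,2)] L(3) by auto
  have "weak_conv_m \<mu> L"
  proof (rule tight_subseq_weak_converge[OF \<mu> L(2) tight])
    fix s \<nu> assume s: "strict_mono s" "real_distribution \<nu>" "weak_conv_m (\<mu> \<circ> s) \<nu>"
    have "\<nu> = L"
      by (rule moments_bounded_determine[OF L(2) s(2), where K = K and C = C])
         (use sub[OF s] mL bd in auto)
    then show "weak_conv_m (\<mu> \<circ> s) L" using s by simp
  qed
  then show thesis using that L(2) mL by blast
qed

lemma law_cumulant_eq_cum:
  assumes N: "real_distribution N" "exponential_moments N" and "r \<ge> 1"
  shows "law_cumulant r N = cum 1 (\<lambda>B. \<integral>y. y ^ card B \<partial>N) {1..r}"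
proof -
  interpret N: real_distribution N by fact
  obtain \<epsilon> where \<epsilon>: "\<epsilon> > 0" "integrable N (\<lambda>y. exp (\<epsilon> * \<bar>y\<bar>))" using exponential_momentsE[OF N] .
  have "law_cumulant r N = cum 1 (\<lambda>B. \<integral>y. (\<Prod>i\<in>B. y) \<partial>N) {1..r}"
    unfolding law_cumulant_def
  \<comment> \<open>All \<open>r\<close> variables are the identity, so the sum of their absolute
    values is \<open>r * \<bar>y\<bar>\<close>; the rate is divided by \<open>r\<close> to
    compensate.\<close>
  proof (rule joint_cumulant_eq_cum[where \<epsilon> = "\<epsilon> / real r"])
    show "integrable N (\<lambda>y. exp (\<epsilon> / real r * (\<Sum>i = 1..r. \<bar>y\<bar>)))" using \<epsilon>(2) \<open>r \<ge> 1\<close> by simp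
  qed (use \<epsilon>(1) \<open>r \<ge> 1\<close> N.prob_space_axioms in auto)
  then show ?thesis by simp
qed

section \<open>Set partitions and sums over multi-indices\<close>

definition falling_poly :: "nat \<Rightarrow> real poly" where
  "falling_poly k = (\<Prod>i<k. [:- real i, 1:])"

lemma degree_falling_poly: "degree (falling_poly k) = k"
  unfolding falling_poly_def by (subst degree_prod_eq_sum_degree) auto

lemma coeff_falling_poly: "coeff (falling_poly k) k = 1"
proof -
  have "lead_coeff (falling_poly k) = 1" unfolding falling_poly_def by (simp add: lead_coeff_prod)
  then show ?thesis by (simp add: degree_falling_poly)
qed

text \<open>The subtraction on the right is truncated: for \<open>k > n\<close> both products
  contain the factor with \<open>i = n\<close>, which is 0.\<close>

lemma poly_falling_poly: "poly (falling_poly k) (real n) = real (\<Prod>i<k. n - i)"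
proof -
  have eq: "poly (falling_poly k) (real n) = (\<Prod>i<k. real n - real i)"
    by (simp add: falling_poly_def poly_prod)
  show ?thesis
  proof (cases "k \<le> n")
    case True
    then show ?thesis unfolding eq by (auto simp: of_nat_diff intro!: prod.cong)
  next
    case False
    then have "(\<Prod>i<k. real n - real i) = 0" "(\<Prod>i<k. n - i) = 0" by (auto simp: prod_zero_iff)
    then show ?thesis by (simp only: eq of_nat_0)
  qed
qed

definition kernel_partition :: "'i set \<Rightarrow> ('i \<Rightarrow> 'b) \<Rightarrow> 'i set set" where
  "kernel_partition A f = (\<lambda>a. {b \<in> A. f a = f b}) ` A"

lemma partition_on_kernel_partition: "partition_on A (kernel_partition A f)"
  by (rule partition_onI) (auto simp: kernel_partition_def disjnt_def)

lemma kernel_partition_iff: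
  assumes "partition_on A \<pi>"
  shows "kernel_partition A f = \<pi> \<longleftrightarrow>
    (\<forall>B\<in>\<pi>. \<forall>a\<in>B. \<forall>b\<in>A. f a = f b \<longleftrightarrow> b \<in> B)" (is "?l \<longleftrightarrow> ?r")
proof
  assume l: ?l
  show ?r
  proof (intro ballI)
    fix B a b assume "B \<in> \<pi>" "a \<in> B" "b \<in> A"
    moreover from this l obtain c where "c \<in> A" "B = {b \<in> A. f c = f b}" by (auto simp: kernel_partition_def)
    ultimately show "f a = f b \<longleftrightarrow> b \<in> B" by auto
  qed
next
  assume r: ?r
  have A: "A = \<Union>\<pi>" using assms by (rule partition_onD1)
  have eq: "{b \<in> A. f a = f b} = B" if "B \<in> \<pi>" "a \<in> B" for a B
    using r that A by blast
  show ?l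
  proof (rule subset_antisym; rule subsetI)
    fix B assume "B \<in> kernel_partition A f"
    then obtain a where "a \<in> A" "B = {b \<in> A. f a = f b}" by (auto simp: kernel_partition_def)
    then show "B \<in> \<pi>" using eq A by auto
  next
    fix B assume B: "B \<in> \<pi>"
    then obtain a where a: "a \<in> B" using partition_onD3[OF assms] by (metis ex_in_conv)
    then have "a \<in> A" using A B by auto
    then show "B \<in> kernel_partition A f" using eq[OF B a] by (auto simp: kernel_partition_def)
  qed
qed

text \<open>A function with kernel \<open>\<pi>\<close> amounts to an injection of the set of parts
  into \<open>C\<close>, and injections are counted by a falling factorial.\<close>

lemma card_kernel_partition:
  assumes "finite A" "finite C" "partition_on A \<pi>"
  shows "card {f \<in> PiE A (\<lambda>_. C). kernel_partition A f = \<pi>} = (\<Prod>i<card \<pi>. card C - i)"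
proof -
  let ?F = "{f \<in> PiE A (\<lambda>_. C). kernel_partition A f = \<pi>}" and ?G = "{g \<in> PiE \<pi> (\<lambda>_. C). inj_on g \<pi>}"
  define blk where "blk a = (THE B. B \<in> \<pi> \<and> a \<in> B)" for a
  have A: "A = \<Union>\<pi>" using assms(3) by (rule partition_onD1)
  have disj: "B = B'" if "B \<in> \<pi>" "B' \<in> \<pi>" "a \<in> B" "a \<in> B'" for B B' a
    using partition_onD2[OF assms(3)] that by (auto simp: disjoint_def)
  have blk: "blk a = B" if "B \<in> \<pi>" "a \<in> B" for a B
    unfolding blk_def using that disj by (intro the_equality) auto
  have ne: "\<exists>a. a \<in> B" if "B \<in> \<pi>" for B
    using partition_onD3[OF assms(3)] that by (metis ex_in_conv)
  have sub: "a \<in> A" if "B \<in> \<pi>" "a \<in> B" for a B using A that by blast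
  have kerD: "f a = f b \<longleftrightarrow> b \<in> B" if "kernel_partition A f = \<pi>" "B \<in> \<pi>" "a \<in> B" "b \<in> A" for f :: "'a \<Rightarrow> 'b" and B a b
    using that kernel_partition_iff[OF assms(3), of f] by blast
  \<comment> \<open>Any representative serves, as the functions in \<open>?F\<close> are constant on
    each part.\<close>
  define rep where "rep B = (SOME a. a \<in> B)" for B :: "'a set"
  have rep: "rep B \<in> B" if "B \<in> \<pi>" for B
    unfolding rep_def using ne[OF that] by (rule someI_ex)
  let ?up = "\<lambda>g :: 'a set \<Rightarrow> 'b. \<lambda>a\<in>A. g (blk a)" and ?down = "\<lambda>f :: 'a \<Rightarrow> 'b. \<lambda>B\<in>\<pi>. f (rep B)"
  have "bij_betw ?up ?G ?F"
  proof (rule bij_betw_byWitness[where f' = ?down])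
    show "\<forall>g\<in>?G. (\<lambda>B\<in>\<pi>. (?up g) (rep B)) = g"
      using rep blk A by (auto simp: fun_eq_iff PiE_def extensional_def)
    show "\<forall>f\<in>?F. (\<lambda>a\<in>A. (?down f) (blk a)) = f"
    proof
      fix f assume "f \<in> ?F"
      then have f: "f \<in> PiE A (\<lambda>_. C)" "\<And>B a b. B \<in> \<pi> \<Longrightarrow> a \<in> B \<Longrightarrow> b \<in> B \<Longrightarrow> f a = f b"
        using kerD sub by (blast, blast)
      show "(\<lambda>a\<in>A. (?down f) (blk a)) = f"
      proof
        fix a show "(\<lambda>a\<in>A. (?down f) (blk a)) a = f a"
        proof (cases "a \<in> A")
          case True
          then obtain B where "B \<in> \<pi>" "a \<in> B" using A by auto
          then show ?thesis using True blk f(2)[of B "rep B" a] rep by simp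
        qed (use f(1) in \<open>auto simp: PiE_def extensional_def\<close>)
      qed
    qed
    show "(\<lambda>g. ?up g) ` ?G
      \<subseteq> ?F"
    proof (rule image_subsetI)
      fix g assume g: "g \<in> ?G"
      have "(?up g) \<in> PiE A (\<lambda>_. C)" using g A blk by (auto simp: PiE_def Pi_def)
      moreover have "kernel_partition A (?up g) = \<pi>"
        unfolding kernel_partition_iff[OF assms(3)]
      proof (intro ballI)
        fix B a b assume *: "B \<in> \<pi>" "a \<in> B" "b \<in> A"
        then obtain B' where B': "B' \<in> \<pi>" "b \<in> B'" using A by auto
        have "a \<in> A" using * A by auto
        then show "((?up g) a = (?up g) b) = (b \<in> B)"
          using * B' blk g disj by (auto simp: inj_on_eq_iff)
      qed
      ultimately show "(?up g) \<in> ?F" by simp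
    qed
    show "(\<lambda>f. ?down f) ` ?F
      \<subseteq> ?G"
    proof (rule image_subsetI)
      fix f assume "f \<in> ?F"
      then have f: "f \<in> PiE A (\<lambda>_. C)" "\<And>B a b. B \<in> \<pi> \<Longrightarrow> a \<in> B \<Longrightarrow> b \<in> A \<Longrightarrow> f a = f b \<longleftrightarrow> b \<in> B"
        using kerD by (blast, blast)
      have repA: "rep B \<in> A" if "B \<in> \<pi>" for B by (rule sub[OF that rep[OF that]])
      then have "(?down f) \<in> PiE \<pi> (\<lambda>_. C)" using f(1) by auto
      moreover have "inj_on (?down f) \<pi>"
      proof (rule inj_onI)
        fix B B' assume *: "B \<in> \<pi>" "B' \<in> \<pi>" "(?down f) B = (?down f) B'"
        then have "rep B' \<in> B" using f(2)[OF *(1) rep[OF *(1)] repA[OF *(2)]] by simp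
        then show "B = B'" using disj * rep by blast
      qed
      ultimately show "(?down f) \<in> ?G" by simp
    qed
  qed
  then have "card ?F = card ?G"
    by (rule bij_betw_same_card[symmetric])
  also have "\<dots> = (\<Prod>i<card \<pi>. card C - i)"
    using assms finite_elements[OF assms(1,3)]
    by (subst card_inj_on_subset_funcset) (auto simp: atLeast0LessThan)
  finally show ?thesis .
qed

text \<open>Writing \<open>k - 1 + 1\<close> includes \<open>k = 0\<close>, where the subtraction is
  truncated; for \<open>k \<ge> 1\<close> the value is \<open>I k l\<close>.\<close>

lemma flat_index_eq:
  assumes "l \<in> {1..p}"
  shows "flat_index p I ((k - 1) * p + l) = I (k - 1 + 1) l"
proof -
  have "l - 1 < p" using assms by auto
  moreover have "(k - 1) * p + l - 1 = (l - 1) + (k - 1) * p" using assms by auto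
  ultimately have "((k - 1) * p + l - 1) div p = k - 1" "((k - 1) * p + l - 1) mod p = l - 1"
    by simp_all
  then show ?thesis using assms unfolding flat_index_def by simp
qed

lemma flat_coords:
  fixes j p r :: nat
  assumes "j \<in> {1..p * r}"
  shows "(j - 1) div p + 1 \<in> {1..r}" "(j - 1) mod p + 1 \<in> {1..p}"
    "((j - 1) div p + 1 - 1) * p + ((j - 1) mod p + 1) = j"
proof -
  have p: "p > 0" using assms by (cases p) auto
  have "j - 1 < r * p" using assms by (auto simp: mult.commute)
  then have "(j - 1) div p < r" using p by (simp add: div_less_iff_less_mult)
  then show "(j - 1) div p + 1 \<in> {1..r}" by simp
  show "(j - 1) mod p + 1 \<in> {1..p}" using p by (simp add: Suc_leI)
  have "(j - 1) div p * p + (j - 1) mod p = j - 1" by (rule div_mult_mod_eq)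
  then show "((j - 1) div p + 1 - 1) * p + ((j - 1) mod p + 1) = j" using assms by simp
qed

lemma flat_range:
  fixes k l p r :: nat
  assumes "k \<in> {1..r}" "l \<in> {1..p}"
  shows "(k - 1) * p + l \<in> {1..p * r}"
proof -
  have "(k - 1) * p + l \<le> (k - 1) * p + p" using assms by simp
  also have "\<dots> = k * p" using assms by (cases k) auto
  also have "\<dots> \<le> p * r" using assms by (simp add: mult.commute)
  finally show ?thesis using assms by auto
qed

lemma bij_betw_flat:
  "bij_betw (\<lambda>I. \<lambda>j\<in>{1..p * r}. flat_index p I j) (multi_indices n p r) (PiE {1..p * r} (\<lambda>_. {1..n}))"
proof (rule bij_betw_byWitness[where f' = "\<lambda>x. \<lambda>k\<in>{1..r}. \<lambda>l\<in>{1..p}. x ((k - 1) * p + l)"])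
  show "\<forall>I\<in>multi_indices n p r. (\<lambda>k\<in>{1..r}. \<lambda>l\<in>{1..p}. (\<lambda>j\<in>{1..p * r}. flat_index p I j) ((k - 1) * p + l)) = I"
  proof (intro ballI ext)
    fix I k l assume I: "I \<in> multi_indices n p r"
    show "(\<lambda>k\<in>{1..r}. \<lambda>l\<in>{1..p}. (\<lambda>j\<in>{1..p * r}. flat_index p I j) ((k - 1) * p + l)) k l = I k l"
    proof (cases "k \<in> {1..r}")
      case k: True
      then have Ik: "I k \<in> PiE {1..p} (\<lambda>_. {1..n})" using I by (auto simp: multi_indices_def)
      show ?thesis
      proof (cases "l \<in> {1..p}")
        case True
        then show ?thesis using k flat_index_eq[OF True, of I k] flat_range[OF k True] by simp
      next
        case False
        then show ?thesis using k PiE_arb[OF Ik False] by (simp del: atLeastAtMost_iff)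
      qed
    next
      case False
      then show ?thesis using PiE_arb[OF I[unfolded multi_indices_def] False] by (simp del: atLeastAtMost_iff)
    qed
  qed
  show "\<forall>x\<in>PiE {1..p * r} (\<lambda>_. {1..n}). (\<lambda>j\<in>{1..p * r}. flat_index p (\<lambda>k\<in>{1..r}. \<lambda>l\<in>{1..p}. x ((k - 1) * p + l)) j) = x"
  proof (intro ballI ext)
    fix x j assume x: "x \<in> PiE {1..p * r} (\<lambda>_. {1..n})"
    show "(\<lambda>j\<in>{1..p * r}. flat_index p (\<lambda>k\<in>{1..r}. \<lambda>l\<in>{1..p}. x ((k - 1) * p + l)) j) j = x j"
    proof (cases "j \<in> {1..p * r}")
      case True
      show ?thesis unfolding flat_index_def using flat_coords[OF True] True by (simp only: restrict_apply if_True)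
    next
      case False
      then show ?thesis using PiE_arb[OF x False] by (simp del: atLeastAtMost_iff)
    qed
  qed
  show "(\<lambda>I. \<lambda>j\<in>{1..p * r}. flat_index p I j) ` multi_indices n p r \<subseteq> PiE {1..p * r} (\<lambda>_. {1..n})"
  proof (rule image_subsetI)
    fix I assume "I \<in> multi_indices n p r"
    then have "flat_index p I j \<in> {1..n}" if "j \<in> {1..p * r}" for j
      using flat_coords[OF that] unfolding multi_indices_def flat_index_def by (blast dest: PiE_mem)
    then show "(\<lambda>j\<in>{1..p * r}. flat_index p I j) \<in> PiE {1..p * r} (\<lambda>_. {1..n})" by auto
  qed
  show "(\<lambda>x. \<lambda>k\<in>{1..r}. \<lambda>l\<in>{1..p}. x ((k - 1) * p + l)) ` PiE {1..p * r} (\<lambda>_. {1..n}) \<subseteq> multi_indices n p r"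
  proof (rule image_subsetI)
    fix x assume x: "x \<in> PiE {1..p * r} (\<lambda>_. {1..n})"
    have "x ((k - 1) * p + l) \<in> {1..n}" if "k \<in> {1..r}" "l \<in> {1..p}" for k l
      using x flat_range[OF that] by (blast dest: PiE_mem)
    then show "(\<lambda>k\<in>{1..r}. \<lambda>l\<in>{1..p}. x ((k - 1) * p + l)) \<in> multi_indices n p r"
      unfolding multi_indices_def by auto
  qed
qed

lemma Sp_eq_kernel_partition: "Sp p r I = kernel_partition {1..p * r} (\<lambda>j\<in>{1..p * r}. flat_index p I j)"
  unfolding Sp_def kernel_partition_def by (intro image_cong refl) auto

lemma Sp_in_set_partitions: "Sp p r I \<in> set_partitions (p * r)"
  unfolding Sp_eq_kernel_partition set_partitions_def using partition_on_kernel_partition by blast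

lemma finite_multi_indices: "finite (multi_indices n p r)"
  unfolding multi_indices_def by (intro finite_PiE) auto

lemma finite_set_partitions: "finite (set_partitions m)"
  unfolding set_partitions_def by (rule finitely_many_partition_on) simp

lemma card_Sp:
  assumes "\<pi> \<in> set_partitions (p * r)"
  shows "card {I \<in> multi_indices n p r. Sp p r I = \<pi>} = (\<Prod>i<card \<pi>. n - i)"
proof -
  have "bij_betw (\<lambda>I. \<lambda>j\<in>{1..p * r}. flat_index p I j) {I \<in> multi_indices n p r. Sp p r I = \<pi>}
    {f \<in> PiE {1..p * r} (\<lambda>_. {1..n}). kernel_partition {1..p * r} f = \<pi>}"
    by (rule bij_betw_Collect[OF bij_betw_flat]) (simp add: Sp_eq_kernel_partition)
  then have "card {I \<in> multi_indices n p r. Sp p r I = \<pi>}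
    = card {f \<in> PiE {1..p * r} (\<lambda>_. {1..n}). kernel_partition {1..p * r} f = \<pi>}"
    by (rule bij_betw_same_card)
  then show ?thesis using assms card_kernel_partition[of "{1..p * r}" "{1..n}" \<pi>] by (simp add: set_partitions_def)
qed

lemma ex_Sp:
  assumes "\<pi> \<in> set_partitions (p * r)"
  obtains n I where "I \<in> multi_indices n p r" "Sp p r I = \<pi>"
proof -
  \<comment> \<open>With exactly \<open>card \<pi>\<close> values available the count is a
    factorial, hence nonzero.\<close>
  have "card {I \<in> multi_indices (card \<pi>) p r. Sp p r I = \<pi>} \<noteq> 0"
    unfolding card_Sp[OF assms] by (simp add: prod_zero_iff)
  then have "{I \<in> multi_indices (card \<pi>) p r. Sp p r I = \<pi>} \<noteq> {}"
    by (rule contrapos_nn) (simp only: card.empty)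
  then obtain I where "I \<in> multi_indices (card \<pi>) p r" "Sp p r I = \<pi>" by blast
  then show thesis by (rule that)
qed

text \<open>Grouping by partition replaces an index set that grows with \<open>n\<close> by a fixed
  one, and the dependence on \<open>n\<close> becomes polynomial.\<close>

lemma sum_multi_indices:
  assumes "\<And>I. I \<in> multi_indices n p r \<Longrightarrow> v I = u (Sp p r I)"
  shows "(\<Sum>I\<in>multi_indices n p r. v I) = (\<Sum>\<pi>\<in>set_partitions (p * r). u \<pi> * poly (falling_poly (card \<pi>)) (real n))"
proof -
  have "(\<Sum>I\<in>multi_indices n p r. v I) = (\<Sum>I\<in>multi_indices n p r. u (Sp p r I))" using assms by simp
  also have "\<dots> = (\<Sum>\<pi>\<in>set_partitions (p * r). \<Sum>I | I \<in> multi_indices n p r \<and> Sp p r I = \<pi>. u (Sp p r I))"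
    by (rule sum.group[symmetric]) (auto simp: finite_multi_indices finite_set_partitions Sp_in_set_partitions)
  also have "\<dots> = (\<Sum>\<pi>\<in>set_partitions (p * r). u \<pi> * poly (falling_poly (card \<pi>)) (real n))"
    by (intro sum.cong refl) (simp add: card_Sp poly_falling_poly mult.commute)
  finally show ?thesis .
qed

lemma sum_card_blocks:
  fixes p r :: nat
  shows "(\<Sum>k\<in>{1..r}. card {j \<in> {(k - 1) * p + 1..k * p}. Q j}) = card {j \<in> {1..p * r}. Q j}"
proof (induction r)
  case (Suc r)
  have "{j \<in> {1..p * Suc r}. Q j} = {j \<in> {1..p * r}. Q j} \<union> {j \<in> {r * p + 1..Suc r * p}. Q j}"
    by (auto simp: mult.commute)
  moreover have "{j \<in> {1..p * r}. Q j} \<inter> {j \<in> {r * p + 1..Suc r * p}. Q j} = {}"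
    by (auto simp: mult.commute)
  ultimately have "card {j \<in> {1..p * Suc r}. Q j} = card {j \<in> {1..p * r}. Q j} + card {j \<in> {r * p + 1..Suc r * p}. Q j}"
    by (simp only:) (subst card_Un_disjoint, auto)
  then show ?case using Suc by simp
qed simp

section \<open>Partitions that are not homogeneously vanishing, and the extremal ones among
  them\<close>

abbreviation block_singles :: "nat \<Rightarrow> nat set set \<Rightarrow> nat \<Rightarrow> nat set" where
  "block_singles p \<pi> k \<equiv> {j \<in> {(k - 1) * p + 1..k * p}. {j} \<in> \<pi>}"

definition pair_blocks :: "nat set set \<Rightarrow> nat set set" where
  "pair_blocks \<pi> = {B \<in> \<pi>. card B = 2}"

text \<open>Inverse to \<open>pair_blocks\<close> on leading partitions: the parts of size two
  determine the rest.\<close>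

definition singletons_complete :: "nat \<Rightarrow> nat set set \<Rightarrow> nat set set" where
  "singletons_complete m T = T \<union> (\<lambda>j. {j}) ` ({1..m} - \<Union>T)"

text \<open>The index set of the sum in \<open>a_coeff\<close>.\<close>

definition leading_partitions :: "nat \<Rightarrow> nat \<Rightarrow> nat set set set" where
  "leading_partitions p r = {\<pi>. \<pi> \<in> set_partitions (p * r) \<and> card \<pi> = (p - 1) * r \<and>
     \<not> homogeneously_vanishing p r \<pi>}"

lemma set_partitionsD:
  assumes "\<pi> \<in> set_partitions m"
  shows "finite \<pi>" "\<Union>\<pi> = {1..m}" "\<And>B. B \<in> \<pi> \<Longrightarrow> finite B \<and> B \<noteq> {} \<and> B \<subseteq> {1..m}"
    "\<And>B B' a. B \<in> \<pi> \<Longrightarrow> B' \<in> \<pi> \<Longrightarrow> a \<in> B \<Longrightarrow> a \<in> B' \<Longrightarrow> B = B'"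
    "(\<Sum>B\<in>\<pi>. card B) = m"
proof -
  have P: "partition_on {1..m} \<pi>" using assms by (simp add: set_partitions_def)
  show f: "finite \<pi>" using finite_elements[OF _ P] by simp
  show U: "\<Union>\<pi> = {1..m}" using partition_onD1[OF P] by simp
  show B: "finite B \<and> B \<noteq> {} \<and> B \<subseteq> {1..m}" if "B \<in> \<pi>" for B
  proof -
    have "B \<subseteq> {1..m}" using U that by blast
    moreover have "B \<noteq> {}" using partition_onD3[OF P] that by auto
    ultimately show ?thesis using finite_subset by blast
  qed
  show "B = B'" if "B \<in> \<pi>" "B' \<in> \<pi>" "a \<in> B" "a \<in> B'" for B B' a
    using partition_onD2[OF P] that by (auto simp: disjoint_def)
  have "card (\<Union>\<pi>) = (\<Sum>B\<in>\<pi>. card B)"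
    using B partition_onD2[OF P] by (intro card_Union_disjoint) auto
  then show "(\<Sum>B\<in>\<pi>. card B) = m" using U by simp
qed

lemma card_single_blocks:
  assumes "\<pi> \<in> set_partitions m"
  shows "card {B \<in> \<pi>. card B = 1} = card {j \<in> {1..m}. {j} \<in> \<pi>}"
proof -
  have "{B \<in> \<pi>. card B = 1} = (\<lambda>j. {j}) ` {j \<in> {1..m}. {j} \<in> \<pi>}"
  proof (rule subset_antisym; rule subsetI)
    fix B assume B: "B \<in> {B \<in> \<pi>. card B = 1}"
    then obtain j where "B = {j}" by (auto simp: card_1_singleton_iff)
    then show "B \<in> (\<lambda>j. {j}) ` {j \<in> {1..m}. {j} \<in> \<pi>}" using B set_partitionsD(3)[OF assms, of B] by auto
  qed auto
  then show ?thesis by (simp add: card_image)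
qed

context
  fixes p r :: nat and \<pi> :: "nat set set"
  assumes part: "\<pi> \<in> set_partitions (p * r)" and nv: "\<not> homogeneously_vanishing p r \<pi>" and r: "r \<ge> 1"
begin

text \<open>For \<open>p \<le> 1\<close> the threshold \<open>p - 1\<close> is 0 and every partition
  is homogeneously vanishing.\<close>

lemma nonvanishing_p: "p \<ge> 2"
  using nv r unfolding homogeneously_vanishing_def by (force intro: bexI[of _ 1])

lemma nonvanishing_singles:
  assumes "k \<in> {1..r}"
  shows "card (block_singles p \<pi> k) \<le> p - 2"
proof -
  have "card (block_singles p \<pi> k) < p - 1"
    using nv assms unfolding homogeneously_vanishing_def by (auto simp: not_le)
  then show ?thesis by simp
qed

text \<open>
  The bound on the number of parts is a count of weights: a part weighs its size, plus one for a singleton,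
  hence at least \<open>2\<close>.
\<close>

lemma nonvanishing_weight:
  defines "w \<equiv> \<lambda>B. card B + (if card B = 1 then 1 else 0)"
  shows "(\<Sum>B\<in>\<pi>. w B) = p * r + (\<Sum>k\<in>{1..r}. card (block_singles p \<pi> k))"
    and "\<And>B. B \<in> \<pi> \<Longrightarrow> 2 \<le> w B"
proof -
  note D = set_partitionsD[OF part]
  have "(\<Sum>B\<in>\<pi>. w B) = p * r + card {B \<in> \<pi>. card B = 1}"
  proof -
    have "(\<Sum>B\<in>\<pi>. if card B = 1 then 1 else 0) = card {B \<in> \<pi>. card B = 1}"
      using D(1) by (simp add: sum.If_cases Int_def del: One_nat_def)
    then show ?thesis unfolding w_def sum.distrib D(5) by simp
  qed
  then show "(\<Sum>B\<in>\<pi>. w B) = p * r + (\<Sum>k\<in>{1..r}. card (block_singles p \<pi> k))"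
    unfolding sum_card_blocks card_single_blocks[OF part] .
  fix B assume "B \<in> \<pi>"
  then have "card B \<noteq> 0" using D(3) by auto
  then show "2 \<le> w B" by (auto simp: w_def)
qed

text \<open>Call row \<open>k\<close> the \<open>k\<close>-th interval of \<open>p\<close>
  consecutive entries. Each row has at most \<open>p - 2\<close> singletons, and
  \<open>p + (p - 2) = 2 * (p - 1)\<close>.\<close>

lemma nonvanishing_sum_le:
  "p * r + (\<Sum>k\<in>{1..r}. card (block_singles p \<pi> k)) \<le> 2 * ((p - 1) * r)"
proof -
  have "(\<Sum>k\<in>{1..r}. card (block_singles p \<pi> k)) \<le> (\<Sum>k\<in>{1..r}. p - 2)"
    using nonvanishing_singles by (intro sum_mono) auto
  moreover obtain q where "p = q + 2" using nonvanishing_p by (metis add.commute le_Suc_ex)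
  ultimately show ?thesis by (simp add: algebra_simps)
qed

lemma nonvanishing_card_le: "card \<pi> \<le> (p - 1) * r"
proof -
  have "2 * card \<pi> = (\<Sum>B\<in>\<pi>. 2)" by simp
  also have "\<dots> \<le> (\<Sum>B\<in>\<pi>. card B + (if card B = 1 then 1 else 0))"
    by (intro sum_mono nonvanishing_weight(2))
  finally show ?thesis using nonvanishing_weight(1) nonvanishing_sum_le by simp
qed

context
  assumes card: "card \<pi> = (p - 1) * r"
begin

text \<open>With the maximal number of parts the count of weights is an equality, so every part has
  weight exactly 2.\<close>

lemma leading_card_block:
  assumes "B \<in> \<pi>"
  shows "card B = 1 \<or> card B = 2"
proof -
  have "(\<Sum>B\<in>\<pi>. 2) = (\<Sum>B\<in>\<pi>. card B + (if card B = 1 then 1 else 0))"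
  proof (rule antisym)
    show "(\<Sum>B\<in>\<pi>. 2) \<le> (\<Sum>B\<in>\<pi>. card B + (if card B = 1 then 1 else 0))"
      by (intro sum_mono nonvanishing_weight(2))
    show "(\<Sum>B\<in>\<pi>. card B + (if card B = 1 then 1 else 0)) \<le> (\<Sum>B\<in>\<pi>. 2)"
      using nonvanishing_weight(1) nonvanishing_sum_le card by simp
  qed
  from sum_mono_inv[OF this nonvanishing_weight(2) assms set_partitionsD(1)[OF part]]
  have "2 = card B + (if card B = 1 then 1 else 0)" by blast
  then show ?thesis by (auto split: if_splits)
qed

text \<open>The bound on singletons summed over the rows is an equality as well, hence an equality
  in every row.\<close>

lemma leading_singles:
  assumes "k \<in> {1..r}"
  shows "card (block_singles p \<pi> k) = p - 2"
proof -
  have "(\<Sum>k\<in>{1..r}. card (block_singles p \<pi> k)) = (\<Sum>k\<in>{1..r}. p - 2)"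
  proof (rule antisym)
    show "(\<Sum>k\<in>{1..r}. card (block_singles p \<pi> k)) \<le> (\<Sum>k\<in>{1..r}. p - 2)"
      using nonvanishing_singles by (intro sum_mono) auto
    have "2 * card \<pi> = (\<Sum>B\<in>\<pi>. 2)" by simp
    also have "\<dots> \<le> (\<Sum>B\<in>\<pi>. card B + (if card B = 1 then 1 else 0))"
      by (intro sum_mono nonvanishing_weight(2))
    finally have "2 * ((p - 1) * r) \<le> p * r + (\<Sum>k\<in>{1..r}. card (block_singles p \<pi> k))"
      using nonvanishing_weight(1) card by simp
    moreover obtain q where "p = q + 2" using nonvanishing_p by (metis add.commute le_Suc_ex)
    ultimately show "(\<Sum>k\<in>{1..r}. p - 2) \<le> (\<Sum>k\<in>{1..r}. card (block_singles p \<pi> k))"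
      by (simp add: algebra_simps)
  qed
  from sum_mono_inv[OF this nonvanishing_singles assms] show ?thesis by simp
qed

lemma single_iff_not_pair:
  assumes "j \<in> {1..p * r}"
  shows "{j} \<in> \<pi> \<longleftrightarrow> j \<notin> \<Union>(pair_blocks \<pi>)"
proof
  assume j: "{j} \<in> \<pi>"
  show "j \<notin> \<Union>(pair_blocks \<pi>)"
  proof
    assume "j \<in> \<Union>(pair_blocks \<pi>)"
    then obtain B where B: "B \<in> \<pi>" "card B = 2" "j \<in> B" by (auto simp: pair_blocks_def)
    then have "B = {j}" using set_partitionsD(4)[OF part B(1) j B(3)] by simp
    then show False using B by simp
  qed
next
  assume j: "j \<notin> \<Union>(pair_blocks \<pi>)"
  obtain B where B: "B \<in> \<pi>" "j \<in> B" using assms set_partitionsD(2)[OF part] by blast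
  then have "card B = 1" using j leading_card_block[OF B(1)] by (auto simp: pair_blocks_def)
  then have "B = {j}" using B(2) by (auto simp: card_1_singleton_iff)
  then show "{j} \<in> \<pi>" using B by simp
qed

text \<open>This makes \<open>pair_blocks\<close> injective on leading partitions and reduces their
  count to that of sets of pairs.\<close>

lemma leading_eq_complete: "\<pi> = singletons_complete (p * r) (pair_blocks \<pi>)"
proof (rule subset_antisym; rule subsetI)
  fix B assume B: "B \<in> \<pi>"
  show "B \<in> singletons_complete (p * r) (pair_blocks \<pi>)"
  proof (cases "card B = 2")
    case False
    then obtain j where j: "B = {j}" using leading_card_block[OF B] by (auto simp: card_1_singleton_iff)
    moreover have "j \<in> {1..p * r}" using set_partitionsD(3)[OF part B] j by simp
    ultimately show ?thesis using B single_iff_not_pair[of j] by (auto simp: singletons_complete_def)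
  qed (use B in \<open>simp add: singletons_complete_def pair_blocks_def\<close>)
next
  fix B assume "B \<in> singletons_complete (p * r) (pair_blocks \<pi>)"
  then show "B \<in> \<pi>"
    using single_iff_not_pair by (auto simp: singletons_complete_def pair_blocks_def)
qed

text \<open>Of the \<open>(p - 1) * r\<close> parts, \<open>(p - 2) * r\<close> are
  singletons.\<close>

lemma card_pair_blocks: "card (pair_blocks \<pi>) = r"
proof -
  have "\<pi> = pair_blocks \<pi> \<union> {B \<in> \<pi>. card B = 1}"
    using leading_card_block by (auto simp: pair_blocks_def)
  moreover have "card (pair_blocks \<pi> \<union> {B \<in> \<pi>. card B = 1}) = card (pair_blocks \<pi>) + card {B \<in> \<pi>. card B = 1}"
    using set_partitionsD(1)[OF part] by (intro card_Un_disjoint) (auto simp: pair_blocks_def)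
  ultimately have "(p - 1) * r = card (pair_blocks \<pi>) + card {B \<in> \<pi>. card B = 1}" using card by simp
  also have "card {B \<in> \<pi>. card B = 1} = (\<Sum>k\<in>{1..r}. p - 2)"
    unfolding card_single_blocks[OF part] sum_card_blocks[symmetric] by (intro sum.cong refl leading_singles)
  finally have "(p - 1) * r = card (pair_blocks \<pi>) + (\<Sum>k\<in>{1..r}. p - 2)" .
  moreover obtain q where "p = q + 2" using nonvanishing_p by (metis add.commute le_Suc_ex)
  ultimately show ?thesis by (simp add: algebra_simps)
qed

lemma card_paired_in_block:
  assumes k: "k \<in> {1..r}"
  shows "card ({(k - 1) * p + 1..k * p} \<inter> \<Union>(pair_blocks \<pi>)) = 2"
proof -
  let ?b = "{(k - 1) * p + 1..k * p}"
  have "k * p = (k - 1) * p + p" using k by (cases k) auto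
  moreover have "k * p \<le> p * r" using k by (simp add: mult.commute)
  ultimately have b: "card ?b = p" "?b \<subseteq> {1..p * r}" by auto
  have s: "{j} \<in> \<pi> \<longleftrightarrow> j \<notin> \<Union>(pair_blocks \<pi>)" if "j \<in> ?b" for j
    using that b(2) by (intro single_iff_not_pair) blast
  then have "?b = {j \<in> ?b. {j} \<in> \<pi>} \<union> (?b \<inter> \<Union>(pair_blocks \<pi>))" by blast
  moreover have "card ({j \<in> ?b. {j} \<in> \<pi>} \<union> (?b \<inter> \<Union>(pair_blocks \<pi>)))
    = card {j \<in> ?b. {j} \<in> \<pi>} + card (?b \<inter> \<Union>(pair_blocks \<pi>))"
  proof (rule card_Un_disjoint)
    show "{j \<in> ?b. {j} \<in> \<pi>} \<inter> (?b \<inter> \<Union>(pair_blocks \<pi>)) = {}" using s by blast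
  qed auto
  ultimately have "p = (p - 2) + card (?b \<inter> \<Union>(pair_blocks \<pi>))" using b(1) leading_singles[OF k] by simp
  then show ?thesis using nonvanishing_p by simp
qed

end

end

text \<open>A leading partition is a choice of \<open>r\<close> pairs among at most
  \<open>(p * r)\<^sup>2\<close>, so there are at most \<open>(p * r) ^ (2 * r) / r!\<close>. As
  \<open>r ^ r\<close> is at most \<open>r! * e ^ r\<close>, a single factorial survives.\<close>

lemma card_leading_partitions_le:
  "real (card (leading_partitions p r)) \<le> ((real p * exp 1)\<^sup>2) ^ r * fact r"
proof (cases "r \<ge> 1")
  case True
  define E where "E = {B. B \<subseteq> {1..p * r} \<and> card B = 2}"
  have finE: "finite E" unfolding E_def by simp
  have cE: "card E = (p * r) choose 2" using n_subsets[of "{1..p * r}" 2] by (simp add: E_def)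
  have "inj_on pair_blocks (leading_partitions p r)"
    by (rule inj_on_inverseI[of _ "singletons_complete (p * r)"])
       (use True in \<open>auto simp: leading_partitions_def leading_eq_complete[symmetric]\<close>)
  moreover have "pair_blocks ` leading_partitions p r \<subseteq> {T. T \<subseteq> E \<and> card T = r}"
    using True set_partitionsD(3)
    by (auto simp: leading_partitions_def card_pair_blocks) (auto simp: pair_blocks_def E_def)
  ultimately have "card (leading_partitions p r) \<le> card {T. T \<subseteq> E \<and> card T = r}"
    using finE by (intro card_inj_on_le) auto
  also have "\<dots> = (card E choose r)" using finE by (rule n_subsets)
  \<comment> \<open>The factor \<open>fact r\<close> stays on the left until it cancels one of the
    two factorials that bound \<open>(real r ^ r)\<^sup>2\<close>.\<close>
  finally have "card (leading_partitions p r) * fact r \<le> (card E choose r) * fact r" by simp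
  also have "\<dots> \<le> card E ^ r" by (rule binomial_fact_pow)
  also have "\<dots> \<le> ((p * r)\<^sup>2) ^ r"
  proof (rule power_mono)
    have "card E * fact 2 \<le> (p * r)\<^sup>2" unfolding cE by (rule binomial_fact_pow)
    then show "card E \<le> (p * r)\<^sup>2" by simp
  qed simp
  finally have "real (card (leading_partitions p r) * fact r) \<le> real (((p * r)\<^sup>2) ^ r)"
    by (simp only: of_nat_le_iff)
  also have "real (card (leading_partitions p r) * fact r) = real (card (leading_partitions p r)) * fact r"
    by simp
  also have "real (((p * r)\<^sup>2) ^ r) = (real p ^ r * real r ^ r)\<^sup>2"
    by (simp add: power_mult_distrib power2_eq_square)
  also have "\<dots> \<le> (real p ^ r * (fact r * exp 1 ^ r))\<^sup>2"
  proof (intro power_mono mult_left_mono)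
    have "real r ^ r \<le> fact r * exp (real r)" by (rule power_le_fact_exp) simp
    then show "real r ^ r \<le> fact r * exp 1 ^ r" by (simp flip: exp_of_nat_mult)
  qed auto
  also have "\<dots> = (((real p * exp 1)\<^sup>2) ^ r * fact r) * fact r"
    by (simp add: power_mult_distrib power2_eq_square mult_ac)
  finally show ?thesis by simp
next
  case False
  then have "leading_partitions p r \<subseteq> {{}}"
    by (auto simp: leading_partitions_def set_partitions_def partition_on_empty)
  then have "card (leading_partitions p r) \<le> card {{} :: nat set set}" by (intro card_mono) auto
  then show ?thesis using False by (cases r) auto
qed

lemma singletons_complete_partition:
  assumes "\<And>B. B \<in> T \<Longrightarrow> B \<subseteq> {1..m} \<and> card B = 2" "disjoint T"
  shows "singletons_complete m T \<in> set_partitions m"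
    "card (singletons_complete m T) + card T = m"
    "\<And>j. {j} \<in> singletons_complete m T \<longleftrightarrow> j \<in> {1..m} - \<Union>T"
    "pair_blocks (singletons_complete m T) = T"
proof -
  let ?S = "{1..m} - \<Union>T"
  have U: "\<Union>T \<subseteq> {1..m}" using assms(1) by blast
  have finT: "finite T" by (rule finite_subset[of _ "Pow {1..m}"]) (use assms(1) in auto)
  have ne: "{} \<notin> T" "{j} \<notin> T" for j using assms(1)[of "{}"] assms(1)[of "{j}"] by auto
  show "singletons_complete m T \<in> set_partitions m"
    unfolding set_partitions_def mem_Collect_eq
  proof (rule partition_onI)
    show "\<Union>(singletons_complete m T) = {1..m}" using U by (auto simp: singletons_complete_def)
    show "disjnt B B'" if "B \<in> singletons_complete m T" "B' \<in> singletons_complete m T" "B \<noteq> B'" for B B'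
      using that assms(2) by (auto simp: singletons_complete_def disjoint_def disjnt_def)
  qed (use ne in \<open>auto simp: singletons_complete_def\<close>)
  have "card (\<Union>T) = (\<Sum>B\<in>T. card B)"
    using assms by (intro card_Union_disjoint) (auto intro: finite_subset)
  also have "\<dots> = 2 * card T" using assms(1) by simp
  finally have cU: "card (\<Union>T) = 2 * card T" .
  have "card (singletons_complete m T) = card T + card ((\<lambda>j. {j}) ` ?S)"
    unfolding singletons_complete_def using finT ne by (intro card_Un_disjoint) auto
  also have "card ((\<lambda>j. {j}) ` ?S) = card ?S" by (intro card_image) auto
  also have "card ?S = m - 2 * card T" using U cU finite_subset[OF U] by (simp add: card_Diff_subset)
  finally show "card (singletons_complete m T) + card T = m"
    using card_mono[OF _ U] cU by simp
  show "{j} \<in> singletons_complete m T \<longleftrightarrow> j \<in> ?S" for j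
    using ne by (auto simp: singletons_complete_def)
  show "pair_blocks (singletons_complete m T) = T"
    using assms(1) by (auto simp: pair_blocks_def singletons_complete_def)
qed

text \<open>The origin of the coefficient \<open>p choose 2\<close> in
  \<open>limit_cumulant\<close>: in order 1 a leading partition is given by its only pair.\<close>

lemma card_leading_partitions_1: "card (leading_partitions p 1) = p choose 2"
proof -
  define E where "E = {B. B \<subseteq> {1..p} \<and> card B = 2}"
  have C: "singletons_complete p {B} \<in> set_partitions p"
      "card (singletons_complete p {B}) + 1 = p"
      "\<And>j. {j} \<in> singletons_complete p {B} \<longleftrightarrow> j \<in> {1..p} - B"
      "pair_blocks (singletons_complete p {B}) = {B}" if "B \<in> E" for B
    using singletons_complete_partition[of "{B}" p] that by (auto simp: E_def)
  have "leading_partitions p 1 = (\<lambda>B. singletons_complete p {B}) ` E"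
  proof (rule subset_antisym; rule subsetI)
    fix \<pi> assume "\<pi> \<in> leading_partitions p 1"
    then have \<pi>: "\<pi> \<in> set_partitions (p * 1)" "\<not> homogeneously_vanishing p 1 \<pi>" "card \<pi> = (p - 1) * 1"
      by (auto simp: leading_partitions_def)
    obtain B where B: "pair_blocks \<pi> = {B}"
      using card_pair_blocks[OF \<pi>(1,2) _ \<pi>(3)] by (auto simp: card_1_singleton_iff)
    have "B \<in> pair_blocks \<pi>" using B by simp
    then have "B \<in> E" using set_partitionsD(3)[OF \<pi>(1), of B] by (auto simp: pair_blocks_def E_def)
    moreover have "\<pi> = singletons_complete p {B}"
      using leading_eq_complete[OF \<pi>(1,2) _ \<pi>(3)] B by simp
    ultimately show "\<pi> \<in> (\<lambda>B. singletons_complete p {B}) ` E" by blast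
  next
    fix \<pi> assume "\<pi> \<in> (\<lambda>B. singletons_complete p {B}) ` E"
    then obtain B where B: "B \<in> E" "\<pi> = singletons_complete p {B}" by blast
    have "{j} \<in> \<pi> \<longleftrightarrow> j \<in> {1..p} - B" for j unfolding B(2) by (rule C(3)[OF B(1)])
    then have "{j \<in> {1..p}. {j} \<in> \<pi>} = {1..p} - B" by blast
    moreover have "card ({1..p} - B) = p - 2" "2 \<le> p"
      using B(1) card_mono[of "{1..p}" B] finite_subset[of B "{1..p}"]
      by (auto simp: E_def card_Diff_subset)
    ultimately have "\<not> homogeneously_vanishing p 1 \<pi>"
      by (auto simp: homogeneously_vanishing_def)
    then show "\<pi> \<in> leading_partitions p 1"
      using C(1,2)[OF B(1)] B(2) by (auto simp: leading_partitions_def)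
  qed
  moreover have "inj_on (\<lambda>B. singletons_complete p {B}) E"
    by (rule inj_on_inverseI[of _ "\<lambda>\<pi>. the_elem (pair_blocks \<pi>)"]) (simp add: C(4))
  moreover have "card E = p choose 2" unfolding E_def using n_subsets[of "{1..p}" 2] by simp
  ultimately show ?thesis by (simp add: card_image)
qed

section \<open>Leading partitions of order 2 and the variance formula\<close>

lemma pair_partition_eq_complete:
  "pair_partition p k1 l1 k2 l2 = singletons_complete (2 * p) {{k1, l1 + p}, {k2, l2 + p}}"
  unfolding pair_partition_def singletons_complete_def by (simp add: insert_commute)

text \<open>Exchanging \<open>(k1, l1)\<close> with \<open>(k2, l2)\<close> gives the same
  partition; the condition \<open>k1 < k2\<close> keeps one of the two.\<close>

definition cross_indices :: "nat \<Rightarrow> (nat \<times> nat \<times> nat \<times> nat) set" where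
  "cross_indices p = {(k1, l1, k2, l2). {k1, l1, k2, l2} \<subseteq> {1..p} \<and> k1 < k2 \<and> l1 \<noteq> l2}"

lemma pair_partition_props:
  assumes "(k1, l1, k2, l2) \<in> cross_indices p"
  shows "pair_partition p k1 l1 k2 l2 \<in> leading_partitions p 2"
    "pair_blocks (pair_partition p k1 l1 k2 l2) = {{k1, l1 + p}, {k2, l2 + p}}"
    "{k1, l1 + p} \<in> pair_partition p k1 l1 k2 l2"
proof -
  let ?T = "{{k1, l1 + p}, {k2, l2 + p}}"
  let ?\<pi> = "pair_partition p k1 l1 k2 l2"
  have i: "k1 \<in> {1..p}" "l1 \<in> {1..p}" "k2 \<in> {1..p}" "l2 \<in> {1..p}" "k1 < k2" "l1 \<noteq> l2"
    using assms by (auto simp: cross_indices_def)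
  have B: "B \<subseteq> {1..2 * p} \<and> card B = 2" if "B \<in> ?T" for B
    using that i by (auto simp: card_insert_if)
  have disj: "disjoint ?T" using i by (auto simp: disjoint_def)
  note C = singletons_complete_partition[OF B disj, folded pair_partition_eq_complete]
  have s: "{j} \<in> ?\<pi> \<longleftrightarrow> j \<in> {1..2 * p} \<and> j \<notin> {k1, l1 + p, k2, l2 + p}" for j
    using C(3)[of j] by auto
  have ne: "{k1, l1 + p} \<noteq> {k2, l2 + p}" using i by (auto simp: doubleton_eq_iff)
  then have "card ?T = 2" by simp
  then have card: "card ?\<pi> = (p - 1) * 2" using C(2) by simp
  have "\<not> homogeneously_vanishing p 2 ?\<pi>"
  proof
    assume "homogeneously_vanishing p 2 ?\<pi>"
    then obtain k where k: "k \<in> {1..2}" "card {j \<in> {(k - 1) * p + 1..k * p}. {j} \<in> ?\<pi>} \<ge> p - 1"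
      by (auto simp: homogeneously_vanishing_def)
    have p2: "p \<ge> 2" using i by auto
    consider "k = 1" | "k = 2" using k(1) by fastforce
    then show False
    proof cases
      case 1
      then have "{j \<in> {(k - 1) * p + 1..k * p}. {j} \<in> ?\<pi>} = {1..p} - {k1, k2}"
        unfolding s using i by auto
      moreover have "card ({1..p} - {k1, k2}) = p - 2" using i by (subst card_Diff_subset) auto
      ultimately show False using k(2) p2 by simp
    next
      case 2
      then have "{j \<in> {(k - 1) * p + 1..k * p}. {j} \<in> ?\<pi>} = {p + 1..2 * p} - {l1 + p, l2 + p}"
        unfolding s using i by auto
      moreover have "card ({p + 1..2 * p} - {l1 + p, l2 + p}) = p - 2" using i by (subst card_Diff_subset) auto
      ultimately show False using k(2) p2 by simp
    qed
  qed
  then show "?\<pi> \<in> leading_partitions p 2" using C(1) card by (simp add: leading_partitions_def mult.commute)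
  show "pair_blocks ?\<pi> = ?T" by (rule C(4))
  show "{k1, l1 + p} \<in> ?\<pi>" by (simp add: pair_partition_def)
qed

text \<open>There are two pairs, and each of the two rows has exactly two paired entries. A pair
  that joins the rows takes one entry from each, so the other pair joins them too.\<close>

lemma leading_2_cross:
  assumes \<pi>: "\<pi> \<in> leading_partitions p 2" and cross: "B \<in> \<pi>" "\<not> B \<subseteq> {1..p}" "\<not> B \<subseteq> {p + 1..2 * p}"
  shows "\<exists>(k1, l1, k2, l2)\<in>cross_indices p. \<pi> = pair_partition p k1 l1 k2 l2"
proof -
  have \<pi>': "\<pi> \<in> set_partitions (p * 2)" "\<not> homogeneously_vanishing p 2 \<pi>" "card \<pi> = (p - 1) * 2"
    using \<pi> by (auto simp: leading_partitions_def)
  note S = set_partitionsD[OF \<pi>'(1)]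
  have B12: "B \<subseteq> {1..p} \<union> {p + 1..2 * p}" using S(3)[OF cross(1)] by auto
  have "card B = 2"
    using leading_card_block[OF \<pi>'(1,2) _ \<pi>'(3) cross(1)] B12 cross by (auto simp: card_1_singleton_iff)
  obtain a b where ab: "a \<in> B" "b \<in> B" "a \<in> {1..p}" "b \<in> {p + 1..2 * p}" using B12 cross by blast
  then have B: "B = {a, b}" using \<open>card B = 2\<close> by (auto simp: card_2_iff)
  have BT: "B \<in> pair_blocks \<pi>" using cross \<open>card B = 2\<close> by (simp add: pair_blocks_def)
  have "card (pair_blocks \<pi> - {B}) = 1"
    using card_pair_blocks[OF \<pi>'(1,2) _ \<pi>'(3)] BT by (simp add: card_Diff_singleton)
  then obtain B' where "pair_blocks \<pi> - {B} = {B'}" by (auto simp: card_1_singleton_iff)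
  then have B': "pair_blocks \<pi> = {B, B'}" "B' \<noteq> B" using BT by auto
  have "B' \<in> pair_blocks \<pi>" using B' by simp
  then have cB': "card B' = 2" "B' \<in> \<pi>" by (auto simp: pair_blocks_def)
  have disj: "B \<inter> B' = {}" using S(4)[OF cross(1) cB'(2)] B'(2) by blast
  have U: "\<Union>(pair_blocks \<pi>) = {a, b} \<union> B'" using B'(1) B by simp
  have "card ({1..p} \<inter> ({a, b} \<union> B')) = 2"
    using card_paired_in_block[OF \<pi>'(1,2) _ \<pi>'(3), of 1] U by simp
  moreover have "{1..p} \<inter> ({a, b} \<union> B') = {a} \<union> ({1..p} \<inter> B')" using ab by auto
  ultimately have ca: "card ({a} \<union> ({1..p} \<inter> B')) = 2" by (simp only:)
  have "{1..p} \<inter> B' \<noteq> {}"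
  proof
    assume "{1..p} \<inter> B' = {}"
    with ca have "card {a} = 2" by (simp only: Un_empty_right)
    then show False by simp
  qed
  then obtain a' where a': "a' \<in> B'" "a' \<in> {1..p}" by blast
  have "card ({p + 1..2 * p} \<inter> ({a, b} \<union> B')) = 2"
    using card_paired_in_block[OF \<pi>'(1,2) _ \<pi>'(3), of 2] U by simp
  moreover have "{p + 1..2 * p} \<inter> ({a, b} \<union> B') = {b} \<union> ({p + 1..2 * p} \<inter> B')" using ab by auto
  ultimately have cb: "card ({b} \<union> ({p + 1..2 * p} \<inter> B')) = 2" by (simp only:)
  have "{p + 1..2 * p} \<inter> B' \<noteq> {}"
  proof
    assume "{p + 1..2 * p} \<inter> B' = {}"
    with cb have "card {b} = 2" by (simp only: Un_empty_right)
    then show False by simp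
  qed
  then obtain b' where b': "b' \<in> B'" "b' \<in> {p + 1..2 * p}" by blast
  have B'_eq: "B' = {a', b'}" using a' b' cB'(1) by (auto simp: card_2_iff)
  have ne: "a \<noteq> a'" "b \<noteq> b'" using disj B B'_eq by auto
  have \<pi>_eq: "\<pi> = singletons_complete (2 * p) {{a, b}, {a', b'}}"
    using leading_eq_complete[OF \<pi>'(1,2) _ \<pi>'(3)] B'(1) B B'_eq by (simp add: mult.commute)
  have bb: "b - p + p = b" "b' - p + p = b'" using ab b' by auto
  show ?thesis
  \<comment> \<open>The given part need not be the one with the smaller entry in the first row; the
    two cases supply the order that \<open>cross_indices\<close> demands.\<close>
  proof (cases "a < a'")
    case True
    have "(a, b - p, a', b' - p) \<in> cross_indices p" using True ab a' b' ne by (auto simp: cross_indices_def)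
    moreover have "\<pi> = pair_partition p a (b - p) a' (b' - p)"
      unfolding pair_partition_eq_complete bb by (rule \<pi>_eq)
    ultimately show ?thesis by blast
  next
    case False
    have "(a', b' - p, a, b - p) \<in> cross_indices p" using False ab a' b' ne by (auto simp: cross_indices_def)
    moreover have "\<pi> = pair_partition p a' (b' - p) a (b - p)"
      unfolding pair_partition_eq_complete bb using \<pi>_eq by (simp add: insert_commute)
    ultimately show ?thesis by blast
  qed
qed

text \<open>The remaining leading partitions have no part meeting both rows. The hypothesis on
  \<open>u\<close> discards them; for covariances it expresses the independence of the two
  rows.\<close>

lemma sum_leading_2:
  assumes "\<And>\<pi>. \<pi> \<in> leading_partitions p 2 \<Longrightarrow> (\<And>B. B \<in> \<pi> \<Longrightarrow> B \<subseteq> {1..p} \<or> B \<subseteq> {p + 1..2 * p}) \<Longrightarrow> u \<pi> = 0"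
  shows "(\<Sum>\<pi>\<in>leading_partitions p 2. u \<pi>) = (\<Sum>(k1, l1, k2, l2)\<in>cross_indices p. u (pair_partition p k1 l1 k2 l2))"
proof -
  define f where "f = (\<lambda>(k1, l1, k2, l2). pair_partition p k1 l1 k2 l2)"
  have fin: "finite (leading_partitions p 2)"
    by (rule finite_subset[OF _ finite_set_partitions[of "p * 2"]]) (auto simp: leading_partitions_def)
  have inj: "inj_on f (cross_indices p)"
  proof (rule inj_onI)
    fix x y assume x: "x \<in> cross_indices p" and y: "y \<in> cross_indices p" and eq: "f x = f y"
    obtain k1 l1 k2 l2 where x': "x = (k1, l1, k2, l2)" by (cases x)
    obtain k1' l1' k2' l2' where y': "y = (k1', l1', k2', l2')" by (cases y)
    have "pair_blocks (f x) = {{k1, l1 + p}, {k2, l2 + p}}" "pair_blocks (f y) = {{k1', l1' + p}, {k2', l2' + p}}"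
      using pair_partition_props(2) x y unfolding x' y' f_def by auto
    then have "{{k1, l1 + p}, {k2, l2 + p}} = {{k1', l1' + p}, {k2', l2' + p}}" using eq by simp
    then show "x = y" using x y unfolding x' y' by (auto simp: cross_indices_def doubleton_eq_iff)
  qed
  have "(\<Sum>\<pi>\<in>leading_partitions p 2. u \<pi>) = (\<Sum>\<pi>\<in>f ` cross_indices p. u \<pi>)"
  proof (rule sum.mono_neutral_right[OF fin])
    show "f ` cross_indices p \<subseteq> leading_partitions p 2" using pair_partition_props(1) by (auto simp: f_def)
    show "\<forall>\<pi>\<in>leading_partitions p 2 - f ` cross_indices p. u \<pi> = 0"
    proof
      fix \<pi> assume \<pi>: "\<pi> \<in> leading_partitions p 2 - f ` cross_indices p"
      show "u \<pi> = 0"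
      proof (rule assms)
        fix B assume "B \<in> \<pi>"
        show "B \<subseteq> {1..p} \<or> B \<subseteq> {p + 1..2 * p}"
        proof (rule ccontr)
          assume "\<not> (B \<subseteq> {1..p} \<or> B \<subseteq> {p + 1..2 * p})"
          then have "\<pi> \<in> f ` cross_indices p"
            using leading_2_cross[of \<pi> p B] \<pi> \<open>B \<in> \<pi>\<close> unfolding f_def by fastforce
          then show False using \<pi> by simp
        qed
      qed (use \<pi> in simp)
    qed
  qed
  also have "\<dots> = (\<Sum>x\<in>cross_indices p. u (f x))" by (rule sum.reindex[OF inj, unfolded comp_def])
  finally show ?thesis by (simp add: f_def case_prod_unfold)
qed

section \<open>Expansion of sums over multi-indices in powers of 1/n\<close>

lemma poly_eq_power_times_poly_inverse:
  fixes Q :: "real poly"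
  assumes "degree Q \<le> d"
  shows "\<exists>R. coeff R 0 = coeff Q d \<and> (\<forall>x. x \<noteq> 0 \<longrightarrow> poly Q x = x ^ d * poly R (1 / x))"
proof (intro exI conjI allI impI)
  \<comment> \<open>The coefficients of \<open>Q\<close> in reverse order, relative to
    \<open>d\<close>, which may exceed the degree of \<open>Q\<close>.\<close>
  define R where "R = (\<Sum>i\<le>d. monom (coeff Q i) (d - i))"
  have "coeff R 0 = (\<Sum>i\<le>d. if i = d then coeff Q i else 0)"
    unfolding R_def coeff_sum by (intro sum.cong) auto
  then show "coeff R 0 = coeff Q d" by simp
  fix x :: real assume x: "x \<noteq> 0"
  have "poly Q x = poly (\<Sum>i\<le>d. monom (coeff Q i) i) x"
    using poly_as_sum_of_monoms'[OF assms] by simp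
  also have "\<dots> = (\<Sum>i\<le>d. coeff Q i * x ^ i)" by (simp add: poly_sum poly_monom)
  also have "\<dots> = (\<Sum>i\<le>d. x ^ d * (coeff Q i * (1 / x) ^ (d - i)))"
    using x by (intro sum.cong) (auto simp: power_diff power_divide)
  also have "\<dots> = x ^ d * poly R (1 / x)" by (simp add: R_def poly_sum poly_monom sum_distrib_left)
  finally show "poly Q x = x ^ d * poly R (1 / x)" .
qed

text \<open>The partitions that contribute have at most \<open>(p - 1) * r\<close> parts, and only
  the leading ones reach this degree, each with a monic falling factorial. Both the moments and the
  cumulants of the statistic are obtained from it, by the choice of \<open>u\<close>.\<close>

lemma sum_multi_indices_expansion:
  fixes u :: "nat set set \<Rightarrow> real"
  assumes "r \<ge> 1" and vu: "\<And>n I. I \<in> multi_indices n p r \<Longrightarrow> v I = u (Sp p r I)"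
    and hv: "\<And>\<pi>. \<pi> \<in> set_partitions (p * r) \<Longrightarrow> homogeneously_vanishing p r \<pi> \<Longrightarrow> u \<pi> = 0"
  shows "\<exists>R. coeff R 0 = (\<Sum>\<pi>\<in>leading_partitions p r. u \<pi>) \<and>
    (\<forall>n\<ge>1. (\<Sum>I\<in>multi_indices n p r. v I) = real n ^ ((p - 1) * r) * poly R (1 / real n))"
proof -
  define d where "d = (p - 1) * r"
  define A where "A = {\<pi> \<in> set_partitions (p * r). \<not> homogeneously_vanishing p r \<pi>}"
  define Q where "Q = (\<Sum>\<pi>\<in>A. smult (u \<pi>) (falling_poly (card \<pi>)))"
  have finA: "finite A" unfolding A_def using finite_set_partitions by simp
  have cA: "card \<pi> \<le> d" if "\<pi> \<in> A" for \<pi>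
    using nonvanishing_card_le[of \<pi> p r] that \<open>r \<ge> 1\<close> by (simp add: A_def d_def)
  have deg: "degree Q \<le> d"
    unfolding Q_def using finA cA
    by (intro degree_sum_le order_trans[OF degree_smult_le]) (auto simp: degree_falling_poly)
  have "coeff Q d = (\<Sum>\<pi>\<in>A. u \<pi> * coeff (falling_poly (card \<pi>)) d)"
    by (simp add: Q_def coeff_sum)
  also have "\<dots> = (\<Sum>\<pi>\<in>A. if card \<pi> = d then u \<pi> else 0)"
  proof (intro sum.cong refl)
    fix \<pi> assume "\<pi> \<in> A"
    show "u \<pi> * coeff (falling_poly (card \<pi>)) d = (if card \<pi> = d then u \<pi> else 0)"
    proof (cases "card \<pi> = d")
      case False
      then have "degree (falling_poly (card \<pi>)) < d" using cA[OF \<open>\<pi> \<in> A\<close>] by (simp add: degree_falling_poly)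
      then show ?thesis using False by (simp add: coeff_eq_0)
    qed (use coeff_falling_poly in auto)
  qed
  also have "\<dots> = (\<Sum>\<pi>\<in>{\<pi> \<in> A. card \<pi> = d}. u \<pi>)" using finA by (simp add: sum.inter_filter)
  also have "{\<pi> \<in> A. card \<pi> = d} = leading_partitions p r" by (auto simp: A_def d_def leading_partitions_def)
  finally have cQ: "coeff Q d = (\<Sum>\<pi>\<in>leading_partitions p r. u \<pi>)" .
  have sumQ: "(\<Sum>I\<in>multi_indices n p r. v I) = poly Q (real n)" for n
  proof -
    have "(\<Sum>I\<in>multi_indices n p r. v I)
      = (\<Sum>\<pi>\<in>set_partitions (p * r). u \<pi> * poly (falling_poly (card \<pi>)) (real n))"
      by (rule sum_multi_indices) (rule vu)
    also have "\<dots> = (\<Sum>\<pi>\<in>A. u \<pi> * poly (falling_poly (card \<pi>)) (real n))"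
      by (rule sum.mono_neutral_right[OF finite_set_partitions]) (auto simp: A_def hv)
    finally show ?thesis by (simp add: Q_def poly_sum)
  qed
  obtain R where R: "coeff R 0 = coeff Q d" "\<And>x. x \<noteq> 0 \<Longrightarrow> poly Q x = x ^ d * poly R (1 / x)"
    using poly_eq_power_times_poly_inverse[OF deg] by blast
  show ?thesis
  proof (intro exI[of _ R] conjI allI impI)
    show "coeff R 0 = (\<Sum>\<pi>\<in>leading_partitions p r. u \<pi>)" using R(1) cQ by simp
    show "(\<Sum>I\<in>multi_indices n p r. v I) = real n ^ ((p - 1) * r) * poly R (1 / real n)" if "n \<ge> 1" for n
      unfolding sumQ using R(2)[of "real n"] that by (simp add: d_def)
  qed
qed

lemma poly_inverse_tendsto: "(\<lambda>n. poly R (1 / real n)) \<longlonglongrightarrow> coeff R 0"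
proof -
  have "(\<lambda>n. poly R (1 / real n)) \<longlonglongrightarrow> poly R 0"
    by (rule tendsto_poly[OF lim_const_over_n])
  then show ?thesis by (simp only: poly_0_coeff_0)
qed

section \<open>Compact homogeneous spaces\<close>

text \<open>The two consequences of homogeneity on which the proof relies. Boundedness comes from
  the continuous image of a compact group. Left translations, transported through \<open>f\<close>,
  give isometries that move any point to any other, and they preserve the measure because the Haar
  measure is left invariant.\<close>

lemma compact_homogeneous_spaceE:
  fixes \<mu> :: "'a::polish_space measure"
  assumes "compact_homogeneous_space TYPE('g) \<mu>"
  obtains D where "\<And>x y :: 'a. dist x y \<le> D"
    and "\<And>x y :: 'a. \<exists>\<tau>. \<tau> x = y \<and> (\<forall>u v. dist (\<tau> u) (\<tau> v) = dist u v) \<and> distr \<mu> borel \<tau> = \<mu>"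
proof -
  from assms obtain G :: "'g monoid" and T K d \<nu> and f :: "'g set \<Rightarrow> 'a" where
    G: "compact_topological_group G T" and K: "subgroup K G" and inv: "invariant_distance G T K d"
    and haar: "haar_probability G T \<nu>" and f: "bij_betw f (quotient_space G K) UNIV"
    and iso: "\<And>A B. A \<in> quotient_space G K \<Longrightarrow> B \<in> quotient_space G K \<Longrightarrow> dist (f A) (f B) = d A B"
    and \<mu>: "distr (quotient_measure G K d \<nu>) borel f = \<mu>"
    unfolding compact_homogeneous_space_def by blast
  let ?Q = "quotient_space G K"
  let ?c = "\<lambda>g. l_coset G g K"
  interpret group G using G by (simp add: compact_topological_group_def)
  interpret MS: Metric_space ?Q d using inv by (simp add: invariant_distance_def)
  have quot: "quotient_map T MS.mtopology ?c"
    and d_inv: "\<And>g A B. g \<in> carrier G \<Longrightarrow> A \<in> ?Q \<Longrightarrow> B \<in> ?Q \<Longrightarrow> d (l_coset G g A) (l_coset G g B) = d A B"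
    using inv by (auto simp: invariant_distance_def)
  have T: "topspace T = carrier G" "compact_space T" using G by (auto simp: compact_topological_group_def)
  have cont_c: "continuous_map T MS.mtopology ?c" using quot by (rule quotient_imp_continuous_map)
  have "compactin MS.mtopology (?c ` carrier G)"
    using image_compactin[OF _ cont_c] T by (simp add: compact_space_def)
  then have "MS.mbounded ?Q" by (intro MS.compactin_imp_mbounded) (simp add: quotient_space_def)
  then obtain D where D: "\<And>A B. A \<in> ?Q \<Longrightarrow> B \<in> ?Q \<Longrightarrow> d A B \<le> D" by (auto simp: MS.mbounded_alt)
  have f_surj: "\<exists>A\<in>?Q. f A = x" for x using f by (metis UNIV_I bij_betw_imp_surj_on imageE)
  have bd: "dist x y \<le> D" for x y :: 'a
    using f_surj[of x] f_surj[of y] iso D by metis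
  have K_sub: "K \<subseteq> carrier G" using K by (rule subgroup.subset)
  have assoc: "l_coset G g (?c h) = ?c (g \<otimes>\<^bsub>G\<^esub> h)" if "g \<in> carrier G" "h \<in> carrier G" for g h
    using lcos_m_assoc[OF K_sub that] .
  have c_Q: "?c g \<in> ?Q" if "g \<in> carrier G" for g using that by (auto simp: quotient_space_def)
  have sp: "space \<nu> = carrier G" and sets_\<nu>: "sets \<nu> = sigma_sets (carrier G) {U. openin T U}"
    and left: "\<And>g A. g \<in> carrier G \<Longrightarrow> A \<in> sets \<nu> \<Longrightarrow> emeasure \<nu> (l_coset G g A) = emeasure \<nu> A"
    using haar by (auto simp: haar_probability_def)
  define S where "S = sigma ?Q {U. openin MS.mtopology U}"
  have O: "{U. openin MS.mtopology U} \<subseteq> Pow ?Q" using openin_subset by fastforce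
  have meas_c: "?c \<in> measurable \<nu> S"
    unfolding S_def
  proof (rule measurable_sigma_sets[OF _ O])
    show "sets (sigma ?Q {U. openin MS.mtopology U}) = sigma_sets ?Q {U. openin MS.mtopology U}"
      using O by (rule sets_measure_of)
    show "?c \<in> space \<nu> \<rightarrow> ?Q" using c_Q sp by auto
    fix U assume "U \<in> {U. openin MS.mtopology U}"
    then have "openin T {x \<in> topspace T. ?c x \<in> U}" using cont_c by (simp add: continuous_map_def)
    moreover have "?c -` U \<inter> space \<nu> = {x \<in> topspace T. ?c x \<in> U}" using sp T by auto
    ultimately show "?c -` U \<inter> space \<nu> \<in> sets \<nu>" unfolding sets_\<nu> by (auto intro: sigma_sets.Basic)
  qed
  have space_S: "space S = ?Q" unfolding S_def using O by (rule space_measure_of)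
  have sets_S: "sets S = sigma_sets ?Q {U. openin MS.mtopology U}" unfolding S_def using O by (rule sets_measure_of)
  have meas_f: "f \<in> measurable S borel"
  proof (rule borel_measurableI)
    fix U :: "'a set" assume U: "open U"
    have "openin MS.mtopology (f -` U \<inter> ?Q)"
      unfolding MS.openin_mtopology
    proof (intro conjI allI impI)
      fix A assume A: "A \<in> f -` U \<inter> ?Q"
      then obtain e where e: "e > 0" "\<And>y. dist y (f A) < e \<Longrightarrow> y \<in> U" using U by (auto simp: open_dist)
      have "MS.mball A e \<subseteq> f -` U \<inter> ?Q"
        using A e(2) iso by (auto simp: MS.mball_def) (metis dist_commute)
      then show "\<exists>r>0. MS.mball A r \<subseteq> f -` U \<inter> ?Q" using e(1) by blast
    qed simp
    then show "f -` U \<inter> space S \<in> sets S" unfolding space_S sets_S by (auto intro: sigma_sets.Basic)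
  qed
  define q where "q g = f (?c g)" for g
  have meas_q: "q \<in> measurable \<nu> borel"
    using measurable_comp[OF meas_c meas_f] by (simp add: q_def[abs_def] comp_def)
  have \<mu>_q: "\<mu> = distr \<nu> borel q"
    using \<mu> distr_distr[OF meas_f meas_c] by (simp add: quotient_measure_def S_def q_def[abs_def] comp_def)
  have "\<exists>\<tau>. \<tau> x = y \<and> (\<forall>u v. dist (\<tau> u) (\<tau> v) = dist u v) \<and> distr \<mu> borel \<tau> = \<mu>" for x y :: 'a
  proof -
    obtain h1 h2 where h: "h1 \<in> carrier G" "q h1 = x" "h2 \<in> carrier G" "q h2 = y"
      using f_surj[of x] f_surj[of y] by (auto simp: quotient_space_def q_def)
    \<comment> \<open>Left translation by this element carries the coset of \<open>h1\<close> to
      that of \<open>h2\<close>.\<close>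
    define g where "g = h2 \<otimes>\<^bsub>G\<^esub> inv\<^bsub>G\<^esub> h1"
    have g: "g \<in> carrier G" using h by (simp add: g_def)
    define \<tau> where "\<tau> u = f (l_coset G g (inv_into ?Q f u))" for u
    have inv_f: "inv_into ?Q f (f A) = A" if "A \<in> ?Q" for A
      using f that by (intro inv_into_f_f) (auto simp: bij_betw_def)
    have \<tau>_f: "\<tau> (f A) = f (l_coset G g A)" if "A \<in> ?Q" for A by (simp add: \<tau>_def inv_f[OF that])
    have g_Q: "l_coset G g A \<in> ?Q" if "A \<in> ?Q" for A
      using that g assoc c_Q by (auto simp: quotient_space_def)
    have \<tau>_q: "\<tau> (q k) = q (g \<otimes>\<^bsub>G\<^esub> k)" if "k \<in> carrier G" for k
      using \<tau>_f[OF c_Q[OF that]] assoc[OF g that] by (simp add: q_def)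
    have "g \<otimes>\<^bsub>G\<^esub> h1 = h2" using h by (simp add: g_def m_assoc)
    then have "\<tau> x = y" using \<tau>_q[OF h(1)] h by simp
    moreover have \<tau>_iso: "dist (\<tau> u) (\<tau> v) = dist u v" for u v
    proof -
      obtain A B where "A \<in> ?Q" "f A = u" "B \<in> ?Q" "f B = v" using f_surj by metis
      then show ?thesis using \<tau>_f iso g_Q d_inv[OF g] by metis
    qed
    moreover have "distr \<mu> borel \<tau> = \<mu>"
    proof -
      have "continuous_on UNIV \<tau>" using \<tau>_iso by (intro continuous_onI) auto
      then have \<tau>_meas: "\<tau> \<in> measurable borel borel" by (rule borel_measurable_continuous_onI)
      have "distr \<mu> borel \<tau> = distr \<nu> borel (\<tau> \<circ> q)"
        unfolding \<mu>_q by (rule distr_distr[OF \<tau>_meas meas_q])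
      also have "\<dots> = distr \<nu> borel q"
      proof (rule measure_eqI)
        fix E :: "'a set" assume "E \<in> sets (distr \<nu> borel (\<tau> \<circ> q))"
        then have E: "E \<in> sets borel" by simp
        let ?A = "q -` E \<inter> space \<nu>"
        have A: "?A \<in> sets \<nu>" using meas_q E by (rule measurable_sets)
        \<comment> \<open>The new preimage is a left translate of the preimage under
          \<open>q\<close>, so left invariance applies.\<close>
        have "(\<tau> \<circ> q) -` E \<inter> space \<nu> = l_coset G (inv\<^bsub>G\<^esub> g) ?A"
        proof (rule subset_antisym; rule subsetI)
          fix k assume k: "k \<in> (\<tau> \<circ> q) -` E \<inter> space \<nu>"
          then have "g \<otimes>\<^bsub>G\<^esub> k \<in> ?A" using \<tau>_q g sp by auto
          moreover have "k = inv\<^bsub>G\<^esub> g \<otimes>\<^bsub>G\<^esub> (g \<otimes>\<^bsub>G\<^esub> k)" using k g sp by (simp add: m_assoc[symmetric])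
          ultimately show "k \<in> l_coset G (inv\<^bsub>G\<^esub> g) ?A" unfolding l_coset_def by blast
        next
          fix k assume "k \<in> l_coset G (inv\<^bsub>G\<^esub> g) ?A"
          then obtain a where a: "a \<in> ?A" "k = inv\<^bsub>G\<^esub> g \<otimes>\<^bsub>G\<^esub> a" by (auto simp: l_coset_def)
          then have "k \<in> carrier G" "g \<otimes>\<^bsub>G\<^esub> k = a" using g sp by (auto simp: m_assoc[symmetric])
          then show "k \<in> (\<tau> \<circ> q) -` E \<inter> space \<nu>" using a \<tau>_q sp by auto
        qed
        then show "emeasure (distr \<nu> borel (\<tau> \<circ> q)) E = emeasure (distr \<nu> borel q) E"
          using left[OF inv_closed[OF g] A] E meas_q measurable_comp[OF meas_q \<tau>_meas]
          by (simp add: emeasure_distr)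
      qed simp
      finally show ?thesis by (simp add: \<mu>_q)
    qed
    ultimately show ?thesis by blast
  qed
  then show thesis by (rule that[OF bd])
qed

text \<open>\<open>\<phi>\<close> is continuous on the space of functions restricted to
  \<open>pairs p\<close>. Composed with the restriction it is continuous on all functions from the
  countable type of index pairs, and measurability into that space can be checked coordinate by
  coordinate.\<close>

lemma dist_vector_measurable:
  fixes \<phi> :: "(nat \<times> nat \<Rightarrow> real) \<Rightarrow> real"
  assumes \<phi>: "continuous_map (powertop_real (pairs p)) euclideanreal \<phi>"
  shows "(\<lambda>x. \<phi> (dist_vector p x)) \<in> borel_measurable (PiM {1..p} (\<lambda>_. borel :: 'a::polish_space measure))"
proof -
  define R :: "(nat \<times> nat \<Rightarrow> real) \<Rightarrow> (nat \<times> nat \<Rightarrow> real)" where "R u = restrict u (pairs p)" for u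
  define U :: "(nat \<Rightarrow> 'a) \<Rightarrow> nat \<times> nat \<Rightarrow> real"
    where "U x i = (if i \<in> pairs p then dist (x (fst i)) (x (snd i)) else 0)" for x i
  have "continuous_map euclidean (powertop_real (pairs p)) R"
    unfolding continuous_map_componentwise
    by (auto simp: R_def continuous_on_product_coordinates)
  then have "continuous_map euclidean euclideanreal (\<phi> \<circ> R)" using \<phi> by (rule continuous_map_compose)
  then have "continuous_on UNIV (\<phi> \<circ> R)" by simp
  then have \<phi>R: "\<phi> \<circ> R \<in> borel_measurable borel" by (rule borel_measurable_continuous_onI)
  have U: "U \<in> borel_measurable (PiM {1..p} (\<lambda>_. borel))"
  proof (rule measurable_coordinatewise_then_product)
    fix i :: "nat \<times> nat"
    show "(\<lambda>x. U x i) \<in> borel_measurable (PiM {1..p} (\<lambda>_. borel))"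
    proof (cases "i \<in> pairs p")
      case True
      then have "fst i \<in> {1..p}" "snd i \<in> {1..p}" by (auto simp: pairs_def)
      then show ?thesis using True by (simp add: U_def)
    qed (simp add: U_def)
  qed
  have "dist_vector p x = R (U x)" for x :: "nat \<Rightarrow> 'a"
    by (auto simp: dist_vector_def R_def U_def fun_eq_iff)
  then have "(\<lambda>x :: nat \<Rightarrow> 'a. \<phi> (dist_vector p x)) = (\<phi> \<circ> R) \<circ> U" by (simp add: comp_def)
  then show ?thesis using measurable_comp[OF U \<phi>R] by simp
qed

text \<open>In a bounded space all distance vectors lie in a product of compact intervals.\<close>

lemma dist_vector_bounded:
  fixes \<phi> :: "(nat \<times> nat \<Rightarrow> real) \<Rightarrow> real"
  assumes \<phi>: "continuous_map (powertop_real (pairs p)) euclideanreal \<phi>"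
    and D: "\<And>x y :: 'a::metric_space. dist x y \<le> D"
  obtains C where "\<And>x :: nat \<Rightarrow> 'a. \<bar>\<phi> (dist_vector p x)\<bar> \<le> C"
proof -
  have "compactin (powertop_real (pairs p)) (PiE (pairs p) (\<lambda>_. {0..D}))"
    by (simp add: compactin_PiE)
  then have "compact (\<phi> ` PiE (pairs p) (\<lambda>_. {0..D}))"
    using image_compactin[OF _ \<phi>] by auto
  then have "bounded (\<phi> ` PiE (pairs p) (\<lambda>_. {0..D}))" by (rule compact_imp_bounded)
  then obtain C where C: "\<And>y. y \<in> \<phi> ` PiE (pairs p) (\<lambda>_. {0..D}) \<Longrightarrow> \<bar>y\<bar> \<le> C"
    unfolding bounded_real by blast
  have "dist_vector p x \<in> PiE (pairs p) (\<lambda>_. {0..D})" for x :: "nat \<Rightarrow> 'a"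
    using D by (auto simp: dist_vector_def)
  then show thesis by (intro that[of C] C imageI)
qed

lemma dist_vector_cong: "(\<And>a. a \<in> {1..p} \<Longrightarrow> x a = y a) \<Longrightarrow> dist_vector p x = dist_vector p y"
  by (auto simp: dist_vector_def pairs_def fun_eq_iff)

text \<open>Applying a measure-preserving isometry to all points changes neither distances nor laws,
  so the integral with coordinate \<open>l\<close> fixed at \<open>x\<close> does not depend on
  \<open>x\<close>. By Fubini this constant is the full integral.\<close>

lemma homogeneous_degenerate:
  fixes \<mu> :: "'a::polish_space measure"
  assumes "prob_space \<mu>" and sets_\<mu>: "sets \<mu> = sets borel"
    and trans: "\<And>x y :: 'a. \<exists>\<tau>. \<tau> x = y \<and> (\<forall>u v. dist (\<tau> u) (\<tau> v) = dist u v) \<and> distr \<mu> borel \<tau> = \<mu>"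
    and \<phi>: "continuous_map (powertop_real (pairs p)) euclideanreal \<phi>"
    and bd: "\<And>x :: nat \<Rightarrow> 'a. \<bar>\<phi> (dist_vector p x)\<bar> \<le> C"
    and l: "l \<in> {1..p}"
  shows "(\<integral>z. \<phi> (dist_vector p (z(l := x))) \<partial>PiM ({1..p} - {l}) (\<lambda>_. \<mu>)) = Phi p \<phi> \<mu>"
proof -
  interpret \<mu>: prob_space \<mu> by fact
  interpret PP: product_sigma_finite "\<lambda>_::nat. \<mu>" by standard
  let ?J = "{1..p} - {l}"
  define \<psi> where "\<psi> x = (\<integral>z. \<phi> (dist_vector p (z(l := x))) \<partial>PiM ?J (\<lambda>_. \<mu>))" for x
  have meas: "(\<lambda>x. \<phi> (dist_vector p x)) \<in> borel_measurable (PiM {1..p} (\<lambda>_. \<mu>))"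
    using dist_vector_measurable[OF \<phi>] sets_PiM_cong[of "{1..p}" "{1..p}" "\<lambda>_. \<mu>" "\<lambda>_. borel"] sets_\<mu>
    by (simp cong: measurable_cong_sets)
  have ins: "insert l ?J = {1..p}" using l by auto
  have \<psi>_const: "\<psi> x = \<psi> y" for x y
  proof -
    obtain \<tau> where \<tau>: "\<tau> x = y" "\<And>u v. dist (\<tau> u) (\<tau> v) = dist u v" "distr \<mu> borel \<tau> = \<mu>"
      using trans by metis
    have "continuous_on UNIV \<tau>" using \<tau>(2) by (intro continuous_onI) auto
    then have \<tau>_borel: "\<tau> \<in> measurable borel borel" by (rule borel_measurable_continuous_onI)
    then have \<tau>_meas: "\<tau> \<in> measurable \<mu> \<mu>" using sets_\<mu> by (simp cong: measurable_cong_sets)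
    have "distr \<mu> \<mu> \<tau> = distr \<mu> borel \<tau>" using sets_\<mu> by (intro distr_cong) auto
    then have \<tau>_distr: "distr \<mu> \<mu> \<tau> = \<mu>" using \<tau>(3) by simp
    have "PiM ?J (\<lambda>_. \<mu>) = PiM ?J (\<lambda>_. distr \<mu> \<mu> \<tau>)" by (simp add: \<tau>_distr)
    also have "\<dots> = distr (PiM ?J (\<lambda>_. \<mu>)) (PiM ?J (\<lambda>_. \<mu>)) (compose ?J \<tau>)"
      using \<tau>_meas by (intro distr_PiM_finite_prob_space'[symmetric]) (auto intro: \<mu>.prob_space_axioms)
    finally have D: "PiM ?J (\<lambda>_. \<mu>) = distr (PiM ?J (\<lambda>_. \<mu>)) (PiM ?J (\<lambda>_. \<mu>)) (compose ?J \<tau>)" .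
    have mJ: "compose ?J \<tau> \<in> measurable (PiM ?J (\<lambda>_. \<mu>)) (PiM ?J (\<lambda>_. \<mu>))"
      unfolding compose_def using \<tau>_meas by measurable
    have mfu: "(\<lambda>z. \<phi> (dist_vector p (z(l := y)))) \<in> borel_measurable (PiM ?J (\<lambda>_. \<mu>))"
    proof -
      have "(\<lambda>z. z(l := y)) \<in> measurable (PiM ?J (\<lambda>_. \<mu>)) (PiM {1..p} (\<lambda>_. \<mu>))"
        using sets_eq_imp_space_eq[OF sets_\<mu>] l by (intro measurable_fun_upd[where J = ?J]) auto
      then show ?thesis using measurable_comp[OF _ meas] unfolding comp_def by blast
    qed
    have "\<psi> y = (\<integral>z. \<phi> (dist_vector p ((compose ?J \<tau> z)(l := y))) \<partial>PiM ?J (\<lambda>_. \<mu>))"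
      unfolding \<psi>_def by (subst D, rule integral_distr[OF mJ mfu])
    also have "\<dots> = \<psi> x"
      unfolding \<psi>_def
    proof (intro Bochner_Integration.integral_cong refl arg_cong[where f = \<phi>])
      fix z :: "nat \<Rightarrow> 'a"
      \<comment> \<open>\<open>compose\<close> is \<open>undefined\<close> outside its domain, but
        \<open>dist_vector p\<close> reads only the coordinates from 1 to \<open>p\<close>.\<close>
      have "(compose ?J \<tau> z)(l := y) = (\<lambda>a. if a \<in> {1..p} then \<tau> ((z(l := x)) a) else undefined)"
        using l \<tau>(1) by (auto simp: compose_def fun_eq_iff)
      then show "dist_vector p ((compose ?J \<tau> z)(l := y)) = dist_vector p (z(l := x))"
        using \<tau>(2) by (auto simp: dist_vector_def pairs_def fun_eq_iff)
    qed
    finally show ?thesis ..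
  qed
  have int: "integrable (PiM {1..p} (\<lambda>_. \<mu>)) (\<lambda>x. \<phi> (dist_vector p x))"
  proof -
    interpret P: prob_space "PiM {1..p} (\<lambda>_. \<mu>)" by (rule prob_space_PiM) (rule \<mu>.prob_space_axioms)
    show ?thesis using meas bd by (intro P.integrable_const_bound[where B = C]) auto
  qed
  have "Phi p \<phi> \<mu> = (\<integral>z. (\<integral>y. \<phi> (dist_vector p (z(l := y))) \<partial>\<mu>) \<partial>PiM ?J (\<lambda>_. \<mu>))"
    unfolding Phi_def
    by (rule PP.product_integral_insert[of ?J l "\<lambda>x. \<phi> (dist_vector p x)", unfolded ins]) (use int in auto)
  also have "\<dots> = (\<integral>y. \<psi> y \<partial>\<mu>)"
  proof -
    interpret J: prob_space "PiM ?J (\<lambda>_. \<mu>)" by (rule prob_space_PiM) (rule \<mu>.prob_space_axioms)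
    interpret pair_prob_space "PiM ?J (\<lambda>_. \<mu>)" \<mu> by standard
    have "(\<lambda>(z, y). z(l := y)) \<in> measurable (PiM ?J (\<lambda>_. \<mu>) \<Otimes>\<^sub>M \<mu>) (PiM (insert l ?J) (\<lambda>_. \<mu>))"
      by measurable
    then have "(\<lambda>w. \<phi> (dist_vector p (case w of (z, y) \<Rightarrow> z(l := y)))) \<in> borel_measurable (PiM ?J (\<lambda>_. \<mu>) \<Otimes>\<^sub>M \<mu>)"
      using measurable_comp[OF _ meas] unfolding ins comp_def by blast
    then have "integrable (PiM ?J (\<lambda>_. \<mu>) \<Otimes>\<^sub>M \<mu>) (\<lambda>(z, y). \<phi> (dist_vector p (z(l := y))))"
      using bd by (intro P.integrable_const_bound[where B = C]) (auto simp: case_prod_unfold)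
    then show ?thesis unfolding \<psi>_def by (rule Fubini_integral[symmetric])
  qed
  also have "\<dots> = (\<integral>y. \<psi> x \<partial>\<mu>)" by (intro Bochner_Integration.integral_cong refl \<psi>_const)
  also have "\<dots> = \<psi> x" by (simp add: \<mu>.prob_space)
  finally show ?thesis by (simp add: \<psi>_def)
qed

section \<open>Statistics of independent samples\<close>

text \<open>Nothing is assumed about \<open>X 0\<close>, hence the conditions below that indices be
  at least 1.\<close>

locale iid_sample = prob_space M for M :: "'w measure" +
  fixes \<mu> :: "'a::polish_space measure" and X :: "nat \<Rightarrow> 'w \<Rightarrow> 'a"
  assumes indep: "indep_vars (\<lambda>_. borel) X {1..}"
    and distr_X: "\<And>i. i \<ge> 1 \<Longrightarrow> distr M borel (X i) = \<mu>"
begin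

lemma X_measurable: "i \<ge> 1 \<Longrightarrow> X i \<in> borel_measurable M"
  using indep by (auto simp: indep_vars_def2)

lemma sets_\<mu>: "sets \<mu> = sets borel"
  using distr_X[of 1] by auto

lemma prob_space_\<mu>: "prob_space \<mu>"
  using prob_space_distr[OF X_measurable[of 1]] distr_X[of 1] by simp

lemma prob_space_PiM_\<mu>: "prob_space (PiM J (\<lambda>_. \<mu>))"
  by (rule prob_space_PiM) (rule prob_space_\<mu>)

lemma measurable_PiM_\<mu>: "measurable (PiM J (\<lambda>_. \<mu>)) N = measurable (PiM J (\<lambda>_. borel)) N"
  by (intro measurable_cong_sets sets_PiM_cong refl) (simp add: sets_\<mu>)

text \<open>The type of \<open>J\<close> is arbitrary because \<open>J\<close> will also be the set
  of parts of a partition, with one independent point for each part.\<close>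

lemma distr_reindex:
  fixes \<sigma> :: "'i \<Rightarrow> nat"
  assumes "finite J" "J \<noteq> {}" "inj_on \<sigma> J" "\<And>j. j \<in> J \<Longrightarrow> \<sigma> j \<ge> 1"
  shows "distr M (PiM J (\<lambda>_. borel)) (\<lambda>\<omega>. \<lambda>j\<in>J. X (\<sigma> j) \<omega>) = PiM J (\<lambda>_. \<mu>)"
proof -
  let ?S = "\<sigma> ` J"
  have S: "?S \<subseteq> {1..}" "?S \<noteq> {}" using assms by auto
  have X[measurable]: "X i \<in> borel_measurable M" if "i \<in> ?S" for i
    using S that by (intro X_measurable) auto
  have "indep_vars (\<lambda>_. borel) X ?S" using indep S(1) by (rule indep_vars_subset)
  then have "distr M (PiM ?S (\<lambda>_. borel)) (\<lambda>\<omega>. \<lambda>i\<in>?S. X i \<omega>) = PiM ?S (\<lambda>i. distr M borel (X i))"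
    using indep_vars_iff_distr_eq_PiM'[OF S(2), where M' = "\<lambda>_. borel" and X = X] X by auto
  also have "\<dots> = PiM ?S (\<lambda>_. \<mu>)" using assms(4) by (intro PiM_cong refl distr_X) auto
  finally have S_eq: "distr M (PiM ?S (\<lambda>_. borel)) (\<lambda>\<omega>. \<lambda>i\<in>?S. X i \<omega>) = PiM ?S (\<lambda>_. \<mu>)" .
  have mS: "(\<lambda>\<omega>. \<lambda>i\<in>?S. X i \<omega>) \<in> measurable M (PiM ?S (\<lambda>_. borel))"
    by (intro measurable_restrict X)
  have mJ: "(\<lambda>w. \<lambda>j\<in>J. w (\<sigma> j)) \<in> measurable (PiM ?S (\<lambda>_. borel)) (PiM J (\<lambda>_. borel :: 'a measure))"
    by (intro measurable_restrict measurable_component_singleton) auto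
  have "PiM J (\<lambda>_. \<mu>) = distr (PiM ?S (\<lambda>_. \<mu>)) (PiM J (\<lambda>_. \<mu>)) (\<lambda>w. \<lambda>j\<in>J. w (\<sigma> j))"
    using assms prob_space_\<mu> by (intro distr_PiM_reindex[symmetric]) auto
  also have "\<dots> = distr (PiM ?S (\<lambda>_. \<mu>)) (PiM J (\<lambda>_. borel)) (\<lambda>w. \<lambda>j\<in>J. w (\<sigma> j))"
    by (intro distr_cong sets_PiM_cong refl sets_\<mu>)
  also have "\<dots> = distr M (PiM J (\<lambda>_. borel)) ((\<lambda>w. \<lambda>j\<in>J. w (\<sigma> j)) \<circ> (\<lambda>\<omega>. \<lambda>i\<in>?S. X i \<omega>))"
    unfolding S_eq[symmetric] by (rule distr_distr[OF mJ mS])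
  also have "(\<lambda>w. \<lambda>j\<in>J. w (\<sigma> j)) \<circ> (\<lambda>\<omega>. \<lambda>i\<in>?S. X i \<omega>) = (\<lambda>\<omega>. \<lambda>j\<in>J. X (\<sigma> j) \<omega>)"
    by (auto simp: fun_eq_iff)
  finally show ?thesis ..
qed

lemma expectation_reindex:
  fixes \<sigma> :: "'i \<Rightarrow> nat" and F :: "('i \<Rightarrow> 'a) \<Rightarrow> real"
  assumes "finite J" "J \<noteq> {}" "inj_on \<sigma> J" "\<And>j. j \<in> J \<Longrightarrow> \<sigma> j \<ge> 1"
    and F: "F \<in> borel_measurable (PiM J (\<lambda>_. borel))"
  shows "(\<integral>\<omega>. F (\<lambda>j\<in>J. X (\<sigma> j) \<omega>) \<partial>M) = (\<integral>z. F z \<partial>PiM J (\<lambda>_. \<mu>))"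
proof -
  have m: "(\<lambda>\<omega>. \<lambda>j\<in>J. X (\<sigma> j) \<omega>) \<in> measurable M (PiM J (\<lambda>_. borel))"
    using assms(4) by (intro measurable_restrict X_measurable)
  show ?thesis using integral_distr[OF m F] by (simp only: distr_reindex[OF assms(1-4)])
qed

end

text \<open>\<open>g\<close> is a total function, and \<open>g_restrict\<close> says that it reads
  only its arguments 1 to \<open>p\<close>. An abstract kernel separates the combinatorics of
  moments from distances and homogeneity.\<close>

locale kernel_sample = iid_sample M \<mu> X for M :: "'w measure" and \<mu> :: "'a::polish_space measure" and X +
  fixes p :: nat and g :: "(nat \<Rightarrow> 'a) \<Rightarrow> real" and C :: real
  assumes g_measurable: "g \<in> borel_measurable (PiM {1..p} (\<lambda>_. borel))"
    and g_restrict: "\<And>x. g (restrict x {1..p}) = g x"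
    and g_bounded: "\<And>x. \<bar>g x\<bar> \<le> C"
    and p: "p \<ge> 1"
begin

definition val :: "(nat \<Rightarrow> nat) \<Rightarrow> 'w \<Rightarrow> real" where
  "val i \<omega> = g (\<lambda>a. X (i a) \<omega>)"

definition mom :: "(nat \<Rightarrow> nat \<Rightarrow> nat) \<Rightarrow> nat set \<Rightarrow> real" where
  "mom I B = (\<integral>\<omega>. (\<Prod>k\<in>B. val (I k) \<omega>) \<partial>M)"

lemma C_nonneg: "C \<ge> 0"
  using g_bounded[of undefined] by linarith

lemma val_measurable:
  assumes "\<And>a. a \<in> {1..p} \<Longrightarrow> i a \<ge> 1"
  shows "val i \<in> borel_measurable M"
proof -
  have "(\<lambda>\<omega>. \<lambda>a\<in>{1..p}. X (i a) \<omega>) \<in> measurable M (PiM {1..p} (\<lambda>_. borel))"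
    using assms by (intro measurable_restrict X_measurable)
  from measurable_comp[OF this g_measurable] show ?thesis
    by (simp only: val_def[abs_def] comp_def g_restrict)
qed

lemma val_bounded: "\<bar>val i \<omega>\<bar> \<le> C"
  by (simp add: val_def g_bounded)

lemma prod_val_bounded: "\<bar>\<Prod>k\<in>B. val (I k) \<omega>\<bar> \<le> C ^ card B"
  using val_bounded unfolding abs_prod by (metis (mono_tags, lifting) abs_ge_zero prod_constant prod_mono)

lemma multi_indicesD:
  assumes "I \<in> multi_indices n p r" "k \<in> {1..r}" "a \<in> {1..p}"
  shows "I k a \<in> {1..n}"
  using assms unfolding multi_indices_def by (blast dest: PiE_mem)

lemma mom_bounded:
  assumes "I \<in> multi_indices n p r" "B \<subseteq> {1..r}"
  shows "\<bar>mom I B\<bar> \<le> C ^ card B"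
proof -
  have "(\<lambda>\<omega>. \<Prod>k\<in>B. val (I k) \<omega>) \<in> borel_measurable M"
    using assms(2) multi_indicesD[OF assms(1)]
    by (intro borel_measurable_prod val_measurable) (meson atLeastAtMost_iff subsetD)
  then have int: "integrable M (\<lambda>\<omega>. \<Prod>k\<in>B. val (I k) \<omega>)"
    using prod_val_bounded by (intro integrable_const_bound[where B = "C ^ card B"]) auto
  have "\<bar>mom I B\<bar> \<le> (\<integral>\<omega>. \<bar>\<Prod>k\<in>B. val (I k) \<omega>\<bar> \<partial>M)" unfolding mom_def by (rule integral_abs_bound)
  also have "\<dots> \<le> (\<integral>\<omega>. C ^ card B \<partial>M)"
    using int prod_val_bounded by (intro integral_mono) auto
  finally show ?thesis by (simp add: prob_space)
qed

lemma kernel_composite_measurable: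
  assumes "\<And>k a. k \<in> B \<Longrightarrow> a \<in> {1..p} \<Longrightarrow> f k a \<in> J"
  shows "(\<lambda>z. \<Prod>k\<in>B. g (\<lambda>a. z (f k a))) \<in> borel_measurable (PiM J (\<lambda>_. borel))"
proof (rule borel_measurable_prod)
  fix k assume k: "k \<in> B"
  have "(\<lambda>z. \<lambda>a\<in>{1..p}. z (f k a)) \<in> measurable (PiM J (\<lambda>_. borel)) (PiM {1..p} (\<lambda>_. borel))"
    using assms[OF k] by (intro measurable_restrict measurable_component_singleton)
  from measurable_comp[OF this g_measurable]
  show "(\<lambda>z. g (\<lambda>a. z (f k a))) \<in> borel_measurable (PiM J (\<lambda>_. borel))"
    by (simp only: comp_def g_restrict)
qed

text \<open>\<open>J\<close> labels the distinct sample points in use; \<open>\<sigma>\<close> gives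
  the position of a label in the sample and \<open>f\<close> the label in each slot.\<close>

lemma mom_eq_integral:
  assumes J: "finite J" "J \<noteq> {}" "inj_on \<sigma> J" "\<And>j. j \<in> J \<Longrightarrow> \<sigma> j \<ge> 1"
    and f: "\<And>k a. k \<in> B \<Longrightarrow> a \<in> {1..p} \<Longrightarrow> f k a \<in> J \<and> I k a = \<sigma> (f k a)"
  shows "mom I B = (\<integral>z. (\<Prod>k\<in>B. g (\<lambda>a. z (f k a))) \<partial>PiM J (\<lambda>_. \<mu>))"
proof -
  define F where "F z = (\<Prod>k\<in>B. g (\<lambda>a. z (f k a)))" for z
  have "mom I B = (\<integral>\<omega>. F (\<lambda>j\<in>J. X (\<sigma> j) \<omega>) \<partial>M)"
    unfolding mom_def
  proof (intro Bochner_Integration.integral_cong refl)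
    fix \<omega>
    show "(\<Prod>k\<in>B. val (I k) \<omega>) = F (\<lambda>j\<in>J. X (\<sigma> j) \<omega>)"
      unfolding F_def
    proof (intro prod.cong refl)
      fix k assume k: "k \<in> B"
      have "restrict (\<lambda>a. X (I k a) \<omega>) {1..p} = restrict (\<lambda>a. (\<lambda>j\<in>J. X (\<sigma> j) \<omega>) (f k a)) {1..p}"
        using f[OF k] by (auto simp: fun_eq_iff)
      then show "val (I k) \<omega> = g (\<lambda>a. (\<lambda>j\<in>J. X (\<sigma> j) \<omega>) (f k a))"
        unfolding val_def by (metis g_restrict)
    qed
  qed
  also have "\<dots> = (\<integral>z. F z \<partial>PiM J (\<lambda>_. \<mu>))"
    using kernel_composite_measurable[of B f J] f
    by (intro expectation_reindex J) (auto simp: F_def[abs_def])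
  finally show ?thesis by (simp add: F_def)
qed

lemma ex1_Sp_block:
  assumes "k \<in> {1..r}" "a \<in> {1..p}"
  shows "\<exists>!b. b \<in> Sp p r I \<and> (k - 1) * p + a \<in> b"
  using flat_range[OF assms] set_partitionsD(2,4)[OF Sp_in_set_partitions[of p r I]] by blast

text \<open>With the parts of the common partition as labels, both moments become the same integral,
  whatever the sizes \<open>n\<close> and \<open>n'\<close>.\<close>

lemma mom_cong_Sp:
  assumes I: "I \<in> multi_indices n p r" "I' \<in> multi_indices n' p r" and Sp: "Sp p r I = Sp p r I'"
    and B: "B \<subseteq> {1..r}" and r: "r \<ge> 1"
  shows "mom I B = mom I' B"
proof -
  define \<pi> where "\<pi> = Sp p r I"
  have \<pi>: "\<pi> \<in> set_partitions (p * r)" using Sp_in_set_partitions by (simp add: \<pi>_def)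
  note D = set_partitionsD[OF \<pi>]
  define blk where "blk k a = (THE b. b \<in> \<pi> \<and> (k - 1) * p + a \<in> b)" for k a
  have blk: "blk k a \<in> \<pi>" "(k - 1) * p + a \<in> blk k a" if "k \<in> {1..r}" "a \<in> {1..p}" for k a
    using theI'[OF ex1_Sp_block[OF that, of I]] by (auto simp: blk_def \<pi>_def)
  have ne: "\<pi> \<noteq> {}" using D(2) p r by force
  have main: "mom I B = (\<integral>z. (\<Prod>k\<in>B. g (\<lambda>a. z (blk k a))) \<partial>PiM \<pi> (\<lambda>_. \<mu>))"
    if I: "I \<in> multi_indices n p r" and Sp: "Sp p r I = \<pi>" for I n
  proof -
    define \<sigma> where "\<sigma> b = flat_index p I (SOME j. j \<in> b)" for b
    have some: "(SOME j. j \<in> b) \<in> b" if "b \<in> \<pi>" for b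
      using D(3)[OF that] by (intro some_in_eq[THEN iffD2]) auto
    have \<sigma>: "\<sigma> b = flat_index p I j" if "b \<in> \<pi>" "j \<in> b" for b j
      using that some[OF that(1)] Sp by (auto simp: \<sigma>_def Sp_def)
    have inj: "inj_on \<sigma> \<pi>"
    proof (rule inj_onI)
      fix b b' assume b: "b \<in> \<pi>" "b' \<in> \<pi>" "\<sigma> b = \<sigma> b'"
      obtain c where c: "b = {j \<in> {1..p * r}. flat_index p I c = flat_index p I j}"
        using b(1) Sp by (auto simp: Sp_def)
      let ?j = "SOME j. j \<in> b'"
      have "?j \<in> {1..p * r}" using some[OF b(2)] D(3)[OF b(2)] by blast
      moreover have "flat_index p I ?j = flat_index p I c"
        using b(3) some[OF b(1)] c unfolding \<sigma>_def by auto
      ultimately have "?j \<in> b" using c by simp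
      then show "b = b'" using D(4)[OF b(1,2)] some[OF b(2)] by blast
    qed
    show ?thesis
    proof (rule mom_eq_integral[OF D(1) ne inj])
      fix b assume b: "b \<in> \<pi>"
      let ?j = "SOME j. j \<in> b"
      have j: "?j \<in> {1..p * r}" using some[OF b] D(3)[OF b] by blast
      show "\<sigma> b \<ge> 1"
        using multi_indicesD[OF I flat_coords(1,2)[OF j]] by (simp add: \<sigma>_def flat_index_def)
    next
      fix k a assume ka: "k \<in> B" "a \<in> {1..p}"
      then have k: "k \<in> {1..r}" using B by auto
      have "\<sigma> (blk k a) = flat_index p I ((k - 1) * p + a)" by (rule \<sigma>[OF blk[OF k ka(2)]])
      also have "\<dots> = I k a" using flat_index_eq[OF ka(2), of I k] k by simp
      finally show "blk k a \<in> \<pi> \<and> I k a = \<sigma> (blk k a)" using blk(1)[OF k ka(2)] by simp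
    qed
  qed
  show ?thesis using main[OF I(1)] main[OF I(2)] Sp by (simp add: \<pi>_def)
qed

end

section \<open>Vanishing of mixed moments for a degenerate kernel\<close>

lemma homogeneously_vanishingE:
  assumes "homogeneously_vanishing p r (Sp p r I)" "p \<ge> 1"
  obtains k l0 where "k \<in> {1..r}" "l0 \<in> {1..p}"
    "\<And>l k' l'. l \<in> {1..p} - {l0} \<Longrightarrow> k' \<in> {1..r} \<Longrightarrow> l' \<in> {1..p} \<Longrightarrow> I k l = I k' l' \<Longrightarrow> k' = k \<and> l' = l"
proof -
  obtain k where k: "k \<in> {1..r}" "card {j \<in> {(k - 1) * p + 1..k * p}. {j} \<in> Sp p r I} \<ge> p - 1"
    using assms(1) by (auto simp: homogeneously_vanishing_def)
  let ?j = "\<lambda>k l. (k - 1) * p + l"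
  define G where "G = {l \<in> {1..p}. {?j k l} \<in> Sp p r I}"
  have kp: "k * p = (k - 1) * p + p" using k(1) by (cases k) auto
  have "{j \<in> {(k - 1) * p + 1..k * p}. {j} \<in> Sp p r I} = ?j k ` G"
  proof (rule subset_antisym; rule subsetI)
    fix j assume j: "j \<in> {j \<in> {(k - 1) * p + 1..k * p}. {j} \<in> Sp p r I}"
    then have "j = ?j k (j - (k - 1) * p)" "j - (k - 1) * p \<in> {1..p}" using kp by auto
    then show "j \<in> ?j k ` G" using j unfolding G_def by (intro image_eqI[of _ _ "j - (k - 1) * p"]) auto
  qed (auto simp: G_def kp)
  then have "card G \<ge> p - 1" using k(2) card_image_le[of G "?j k"] by (simp add: G_def)
  moreover have "card ({1..p} - G) = p - card G" by (subst card_Diff_subset) (auto simp: G_def)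
  ultimately have "card ({1..p} - G) \<le> 1" by simp
  then obtain l0 where l0: "l0 \<in> {1..p}" "{1..p} - G \<subseteq> {l0}"
  proof (cases "{1..p} - G = {}")
    case True
    \<comment> \<open>All entries of the row are singletons, so the exceptional entry is arbitrary;
      1 is available since \<open>p \<ge> 1\<close>.\<close>
    show ?thesis by (rule that[of 1]) (use True assms(2) in auto)
  next
    case False
    then obtain l where l: "l \<in> {1..p} - G" by blast
    then have "{1..p} - G \<subseteq> {l}"
      using \<open>card ({1..p} - G) \<le> 1\<close> card_le_Suc0_iff_eq[of "{1..p} - G"] by auto
    then show ?thesis using that[of l] l by blast
  qed
  show thesis
  proof (rule that[OF k(1) l0(1)])
    fix l k' l' assume l: "l \<in> {1..p} - {l0}" and k': "k' \<in> {1..r}" and l': "l' \<in> {1..p}" and eq: "I k l = I k' l'"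
    have lp: "l \<in> {1..p}" and "l \<in> G" using l l0(2) by auto
    then have s: "{?j k l} \<in> Sp p r I" by (simp add: G_def)
    then obtain c where c: "{?j k l} = {b \<in> {1..p * r}. flat_index p I c = flat_index p I b}"
      by (auto simp: Sp_def)
    have "?j k' l' \<in> {1..p * r}" by (rule flat_range[OF k' l'])
    moreover have "flat_index p I (?j k l) = flat_index p I (?j k' l')"
      using flat_index_eq[OF lp, of I k] flat_index_eq[OF l', of I k'] k(1) k' eq by simp
    moreover have "flat_index p I c = flat_index p I (?j k l)" using c by blast
    ultimately have "?j k' l' = ?j k l" using c by auto
    \<comment> \<open>Uniqueness of quotient and remainder modulo \<open>p\<close> turns equal flat
      positions into equal coordinates.\<close>
    then have e: "(l' - 1) + (k' - 1) * p = (l - 1) + (k - 1) * p" using lp l' by simp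
    have lt: "l - 1 < p" "l' - 1 < p" using lp l' by auto
    have "((l' - 1) + (k' - 1) * p) mod p = l' - 1" "((l - 1) + (k - 1) * p) mod p = l - 1"
      "((l' - 1) + (k' - 1) * p) div p = k' - 1" "((l - 1) + (k - 1) * p) div p = k - 1"
      using lt by simp_all
    then have "l' - 1 = l - 1" "k' - 1 = k - 1" using e by metis+
    then show "k' = k \<and> l' = l" using lp l' k(1) k' by auto
  qed
qed

text \<open>The conditional expectation of the kernel given any one argument vanishes: the Hoeffding
  decomposition has no first-order term.\<close>

locale degenerate_sample = kernel_sample M \<mu> X p g C
  for M :: "'w measure" and \<mu> :: "'a::polish_space measure" and X p g C +
  assumes degenerate: "\<And>l x. l \<in> {1..p} \<Longrightarrow> (\<integral>z. g (z(l := x)) \<partial>PiM ({1..p} - {l}) (\<lambda>_. \<mu>)) = 0"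
begin

text \<open>Integrate first over the sample points that occur in row \<open>k\<close> alone. Only
  the factor of this row depends on them, and degeneracy makes its integral 0. One \<open>k\<close>
  serves every \<open>B\<close> containing it, as \<open>cum_eq_0\<close> requires.\<close>

lemma mom_vanishing:
  assumes I: "I \<in> multi_indices n p r" and hv: "homogeneously_vanishing p r (Sp p r I)"
  obtains k where "k \<in> {1..r}" "\<And>B. B \<subseteq> {1..r} \<Longrightarrow> k \<in> B \<Longrightarrow> mom I B = 0"
proof -
  obtain k l0 where k: "k \<in> {1..r}" and l0: "l0 \<in> {1..p}"
    and uniq: "\<And>l k' l'. l \<in> {1..p} - {l0} \<Longrightarrow> k' \<in> {1..r} \<Longrightarrow> l' \<in> {1..p} \<Longrightarrow> I k l = I k' l' \<Longrightarrow> k' = k \<and> l' = l"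
    using homogeneously_vanishingE[OF hv p] by blast
  have Ipos: "I k' l' \<in> {1..n}" if "k' \<in> {1..r}" "l' \<in> {1..p}" for k' l'
    using multi_indicesD[OF I that] .
  let ?L = "{1..p} - {l0}"
  \<comment> \<open>The points private to row \<open>k\<close>; the point at entry
    \<open>l0\<close>, possibly shared with other rows, stays in \<open>J0\<close>.\<close>
  define J1 where "J1 = I k ` ?L"
  define J0 where "J0 = {1..n} - J1"
  have J1: "J1 \<subseteq> {1..n}" using Ipos[OF k] by (auto simp: J1_def)
  have fin: "finite J0" "finite J1" by (auto simp: J0_def J1_def)
  have disj: "J0 \<inter> J1 = {}" and un: "J0 \<union> J1 = {1..n}" using J1 by (auto simp: J0_def)
  have inJ0: "I k' l' \<in> J0" if "k' \<in> {1..r}" "l' \<in> {1..p}" "k' \<noteq> k \<or> l' = l0" for k' l'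
  proof -
    have "I k' l' \<notin> J1"
    proof
      assume "I k' l' \<in> J1"
      then obtain l where l: "I k' l' = I k l" "l \<in> ?L" unfolding J1_def by (rule imageE)
      have "k' = k \<and> l' = l" by (rule uniq[OF l(2) that(1,2) l(1)[symmetric]])
      then show False using that(3) l(2) by auto
    qed
    then show ?thesis using Ipos[OF that(1,2)] by (simp add: J0_def)
  qed
  have inj: "inj_on (I k) ?L"
    using uniq[OF _ k] by (intro inj_onI) blast
  have "1 \<le> n" using Ipos[OF k l0] by simp
  interpret \<mu>: prob_space \<mu> by (rule prob_space_\<mu>)
  interpret PP: product_sigma_finite "\<lambda>_::nat. \<mu>" by standard
  have "mom I B = 0" if B: "B \<subseteq> {1..r}" "k \<in> B" for B
  proof -
    define F where "F z = (\<Prod>k\<in>B. g (\<lambda>a. z (I k a)))" for z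
    have finB: "finite B" using B(1) finite_subset by blast
    have F_meas: "F \<in> borel_measurable (PiM {1..n} (\<lambda>_. borel))"
      unfolding F_def using Ipos B(1) by (intro kernel_composite_measurable) auto
    have "mom I B = (\<integral>z. F z \<partial>PiM {1..n} (\<lambda>_. \<mu>))"
      unfolding F_def using Ipos B(1) \<open>1 \<le> n\<close>
      by (intro mom_eq_integral[where \<sigma> = "\<lambda>i. i"]) auto
    also have "\<dots> = (\<integral>x. (\<integral>y. F (merge J0 J1 (x, y)) \<partial>PiM J1 (\<lambda>_. \<mu>)) \<partial>PiM J0 (\<lambda>_. \<mu>))"
    proof -
      interpret P: prob_space "PiM {1..n} (\<lambda>_. \<mu>)" by (rule prob_space_PiM_\<mu>)
      have "integrable (PiM {1..n} (\<lambda>_. \<mu>)) F"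
      proof (rule P.integrable_const_bound[where B = "C ^ card B"])
        have "\<bar>F z\<bar> \<le> C ^ card B" for z
        proof -
          have "\<bar>F z\<bar> \<le> (\<Prod>k\<in>B. C)" unfolding F_def abs_prod by (intro prod_mono) (auto simp: g_bounded)
          then show ?thesis by simp
        qed
        then show "AE z in PiM {1..n} (\<lambda>_. \<mu>). norm (F z) \<le> C ^ card B" by simp
        show "F \<in> borel_measurable (PiM {1..n} (\<lambda>_. \<mu>))" using F_meas by (simp add: measurable_PiM_\<mu>)
      qed
      then show ?thesis using PP.product_integral_fold[OF disj fin, of F] by (simp add: un)
    qed
    also have "\<dots> = (\<integral>x. 0 \<partial>PiM J0 (\<lambda>_. \<mu>))"
    proof (intro Bochner_Integration.integral_cong refl)
      fix x :: "nat \<Rightarrow> 'a"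
      define A where "A = (\<Prod>k'\<in>B - {k}. g (\<lambda>a. x (I k' a)))"
      define h where "h w = g (w(l0 := x (I k l0)))" for w
      have F_eq: "F (merge J0 J1 (x, y)) = A * h (\<lambda>a\<in>?L. y (I k a))" for y
      proof -
        have "g (\<lambda>a. merge J0 J1 (x, y) (I k' a)) = g (\<lambda>a. x (I k' a))" if "k' \<in> B - {k}" for k'
        proof -
          have "restrict (\<lambda>a. merge J0 J1 (x, y) (I k' a)) {1..p} = restrict (\<lambda>a. x (I k' a)) {1..p}"
          proof (rule restrict_ext)
            fix a assume a: "a \<in> {1..p}"
            have "I k' a \<in> J0" using that B(1) a by (intro inJ0) auto
            then show "merge J0 J1 (x, y) (I k' a) = x (I k' a)" by (simp add: merge_def)
          qed
          then show ?thesis by (metis g_restrict)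
        qed
        then have "F (merge J0 J1 (x, y)) = g (\<lambda>a. merge J0 J1 (x, y) (I k a)) * A"
          unfolding F_def A_def by (subst prod.remove[OF finB B(2)]) simp
        moreover have "restrict (\<lambda>a. merge J0 J1 (x, y) (I k a)) {1..p}
          = restrict ((\<lambda>a\<in>?L. y (I k a))(l0 := x (I k l0))) {1..p}"
          using inJ0[OF k l0] disj by (auto simp: fun_eq_iff J1_def merge_def)
        then have "g (\<lambda>a. merge J0 J1 (x, y) (I k a)) = h (\<lambda>a\<in>?L. y (I k a))"
          unfolding h_def by (metis g_restrict)
        ultimately show ?thesis by simp
      qed
      have h_meas: "h \<in> borel_measurable (PiM ?L (\<lambda>_. borel))"
      proof -
        have "(\<lambda>w. w(l0 := x (I k l0))) \<in> measurable (PiM ?L (\<lambda>_. borel)) (PiM {1..p} (\<lambda>_. borel))"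
          using l0 by (intro measurable_fun_upd[where J = ?L]) auto
        from measurable_comp[OF this g_measurable] show ?thesis by (simp add: h_def[abs_def] comp_def)
      qed
      have t_meas: "(\<lambda>y. \<lambda>a\<in>?L. y (I k a)) \<in> measurable (PiM J1 (\<lambda>_. \<mu>)) (PiM ?L (\<lambda>_. \<mu>))"
        by (intro measurable_restrict measurable_component_singleton) (auto simp: J1_def)
      have "(\<integral>y. h (\<lambda>a\<in>?L. y (I k a)) \<partial>PiM J1 (\<lambda>_. \<mu>))
        = (\<integral>w. h w \<partial>distr (PiM J1 (\<lambda>_. \<mu>)) (PiM ?L (\<lambda>_. \<mu>)) (\<lambda>y. \<lambda>a\<in>?L. y (I k a)))"
        using h_meas by (intro integral_distr[symmetric] t_meas) (simp add: measurable_PiM_\<mu>)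
      also have "distr (PiM J1 (\<lambda>_. \<mu>)) (PiM ?L (\<lambda>_. \<mu>)) (\<lambda>y. \<lambda>a\<in>?L. y (I k a)) = PiM ?L (\<lambda>_. \<mu>)"
        using inj by (intro distr_PiM_reindex prob_space_\<mu>) (auto simp: J1_def)
      also have "(\<integral>w. h w \<partial>PiM ?L (\<lambda>_. \<mu>)) = 0" unfolding h_def by (rule degenerate[OF l0])
      finally have "(\<integral>y. h (\<lambda>a\<in>?L. y (I k a)) \<partial>PiM J1 (\<lambda>_. \<mu>)) = 0" .
      then show "(\<integral>y. F (merge J0 J1 (x, y)) \<partial>PiM J1 (\<lambda>_. \<mu>)) = 0"
        by (simp only: F_eq integral_mult_right_zero mult_zero_right)
    qed
    finally show ?thesis by simp
  qed
  then show thesis using that[OF k] by blast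
qed

end

section \<open>Moments and cumulants of the summed kernel\<close>

context kernel_sample
begin

definition stat :: "nat \<Rightarrow> 'w \<Rightarrow> real" where
  "stat n \<omega> = (\<Sum>i\<in>PiE {1..p} (\<lambda>_. {1..n}). val i \<omega>)"

lemma val_index_measurable: "i \<in> PiE {1..p} (\<lambda>_. {1..n}) \<Longrightarrow> val i \<in> borel_measurable M"
  by (intro val_measurable) (auto dest: PiE_mem)

lemma stat_measurable: "stat n \<in> borel_measurable M"
  unfolding stat_def by (intro borel_measurable_sum val_index_measurable)

lemma stat_bounded: "\<bar>stat n \<omega>\<bar> \<le> real (n ^ p) * C"
proof -
  have "\<bar>stat n \<omega>\<bar> \<le> (\<Sum>i\<in>PiE {1..p} (\<lambda>_. {1..n}). C)"
    unfolding stat_def by (intro order_trans[OF sum_abs] sum_mono val_bounded)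
  then show ?thesis by (simp add: card_PiE)
qed

lemma stat_power_integrable: "integrable M (\<lambda>\<omega>. stat n \<omega> ^ k)"
proof (rule integrable_const_bound[where B = "(real (n ^ p) * C) ^ k"])
  show "AE \<omega> in M. norm (stat n \<omega> ^ k) \<le> (real (n ^ p) * C) ^ k"
    unfolding real_norm_def power_abs by (intro AE_I2 power_mono stat_bounded) auto
  show "(\<lambda>\<omega>. stat n \<omega> ^ k) \<in> borel_measurable M" using stat_measurable by measurable
qed

lemma expectation_stat_power:
  assumes "finite B"
  shows "(\<integral>\<omega>. stat n \<omega> ^ card B \<partial>M) = (\<Sum>f\<in>PiE B (\<lambda>_. PiE {1..p} (\<lambda>_. {1..n})). mom f B)"
proof -
  let ?J = "PiE {1..p} (\<lambda>_. {1..n}) :: (nat \<Rightarrow> nat) set"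
  have "(\<integral>\<omega>. stat n \<omega> ^ card B \<partial>M) = (\<integral>\<omega>. (\<Sum>f\<in>PiE B (\<lambda>_. ?J). \<Prod>k\<in>B. val (f k) \<omega>) \<partial>M)"
    using prod_sum_PiE[OF assms, of "\<lambda>_. ?J" "\<lambda>k i. val i _"] by (simp add: stat_def finite_PiE)
  also have "\<dots> = (\<Sum>f\<in>PiE B (\<lambda>_. ?J). mom f B)"
    unfolding mom_def
  proof (rule Bochner_Integration.integral_sum)
    fix f assume "f \<in> PiE B (\<lambda>_. ?J)"
    then have "(\<lambda>\<omega>. \<Prod>k\<in>B. val (f k) \<omega>) \<in> borel_measurable M"
      by (intro borel_measurable_prod val_index_measurable) (auto dest: PiE_mem)
    then show "integrable M (\<lambda>\<omega>. \<Prod>k\<in>B. val (f k) \<omega>)"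
      using prod_val_bounded by (intro integrable_const_bound[where B = "C ^ card B"]) auto
  qed
  finally show ?thesis .
qed

lemma mom_restrict: "mom (restrict f B) B = mom f B"
  unfolding mom_def by (intro Bochner_Integration.integral_cong prod.cong refl) simp

lemma cum_stat:
  assumes "r \<ge> 1"
  shows "cum 1 (\<lambda>B. \<integral>\<omega>. stat n \<omega> ^ card B \<partial>M) {1..r} = (\<Sum>I\<in>multi_indices n p r. cum 1 (mom I) {1..r})"
  unfolding multi_indices_def
proof (rule cum_multilinear[where m' = "\<lambda>B f. mom f B"])
  fix B :: "nat set" assume "B \<subseteq> {1..r}"
  then show "(\<integral>\<omega>. stat n \<omega> ^ card B \<partial>M) = (\<Sum>f\<in>PiE B (\<lambda>_. PiE {1..p} (\<lambda>_. {1..n})). mom f B)"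
    by (intro expectation_stat_power) (auto intro: finite_subset)
qed (use assms mom_restrict in auto)

text \<open>Choosing a multi-index for each partition makes moments a function of the partition; by
  \<open>mom_cong_Sp\<close> the choice is immaterial.\<close>

definition rep :: "nat \<Rightarrow> nat set set \<Rightarrow> nat \<Rightarrow> nat \<Rightarrow> nat" where
  "rep r \<pi> = (SOME I. (\<exists>n. I \<in> multi_indices n p r) \<and> Sp p r I = \<pi>)"

lemma rep:
  assumes "\<pi> \<in> set_partitions (p * r)"
  obtains n where "rep r \<pi> \<in> multi_indices n p r" "Sp p r (rep r \<pi>) = \<pi>"
proof -
  have "\<exists>I. (\<exists>n. I \<in> multi_indices n p r) \<and> Sp p r I = \<pi>" using ex_Sp[OF assms] by metis
  from someI_ex[OF this] show thesis using that unfolding rep_def by blast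
qed

lemma mom_rep:
  assumes "I \<in> multi_indices n p r" "B \<subseteq> {1..r}" "r \<ge> 1"
  shows "mom (rep r (Sp p r I)) B = mom I B"
proof -
  obtain n' where "rep r (Sp p r I) \<in> multi_indices n' p r" "Sp p r (rep r (Sp p r I)) = Sp p r I"
    using rep[OF Sp_in_set_partitions] .
  then show ?thesis using assms by (intro mom_cong_Sp) auto
qed

lemma cum_rep:
  assumes "I \<in> multi_indices n p r" "r \<ge> 1"
  shows "cum 1 (mom (rep r (Sp p r I))) {1..r} = cum 1 (mom I) {1..r}"
  using assms by (intro cum_cong mom_rep) auto

text \<open>When no part meets both rows, the two rows use disjoint sets of sample points, so the
  kernel values are independent and their covariance is 0.\<close>

lemma cum_rep_split:
  assumes \<pi>: "\<pi> \<in> set_partitions (p * 2)" and split: "\<And>B. B \<in> \<pi> \<Longrightarrow> B \<subseteq> {1..p} \<or> B \<subseteq> {p + 1..2 * p}"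
  shows "cum 1 (mom (rep 2 \<pi>)) {1..2} = 0"
proof -
  define I where "I = rep 2 \<pi>"
  obtain n where I: "I \<in> multi_indices n p 2" "Sp p 2 I = \<pi>" using rep[OF \<pi>] unfolding I_def .
  note pos = multi_indicesD[OF I(1)]
  define V1 where "V1 = I 1 ` {1..p}"
  define V2 where "V2 = I 2 ` {1..p}"
  have fin: "finite V1" "finite V2" by (auto simp: V1_def V2_def)
  have V: "V1 \<subseteq> {1..n}" "V2 \<subseteq> {1..n}" using pos by (auto simp: V1_def V2_def)
  have ne: "V1 \<noteq> {}" "V2 \<noteq> {}" using p by (auto simp: V1_def V2_def)
  have disj: "V1 \<inter> V2 = {}"
  proof (rule ccontr)
    assume "V1 \<inter> V2 \<noteq> {}"
    then obtain y where "y \<in> V1" "y \<in> V2" by blast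
    then obtain a b where ab': "a \<in> {1..p}" "y = I 1 a" "b \<in> {1..p}" "y = I 2 b"
      unfolding V1_def V2_def by blast
    then have ab: "a \<in> {1..p}" "b \<in> {1..p}" "I 1 a = I 2 b" by auto
    have fl: "flat_index p I a = I 1 a" "flat_index p I (p + b) = I 2 b"
      using flat_index_eq[OF ab(1), of I 1] flat_index_eq[OF ab(2), of I 2] by (simp_all add: numeral_2_eq_2)
    let ?B = "{j \<in> {1..p * 2}. flat_index p I a = flat_index p I j}"
    have "?B \<in> \<pi>" using ab(1) unfolding I(2)[symmetric] Sp_def by auto
    moreover have B: "a \<in> ?B" "p + b \<in> ?B" using ab fl by auto
    ultimately have "?B \<subseteq> {1..p} \<or> ?B \<subseteq> {p + 1..2 * p}" by (intro split)
    then have "p + b \<in> {1..p} \<or> a \<in> {p + 1..2 * p}" using B by blast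
    then show False using ab by auto
  qed
  interpret \<mu>: prob_space \<mu> by (rule prob_space_\<mu>)
  interpret PP: product_sigma_finite "\<lambda>_::nat. \<mu>" by standard
  define G where "G k z = g (\<lambda>a. z (I k a))" for k and z :: "nat \<Rightarrow> 'a"
  have ge: "j \<ge> 1" if "j \<in> V1 \<or> j \<in> V2" for j using V that by auto
  have in1: "I 1 a \<in> V1" and in2: "I 2 a \<in> V2" if "a \<in> {1..p}" for a
    using that by (auto simp: V1_def V2_def)
  have "mom I {1} = (\<integral>z. (\<Prod>k\<in>{1}. g (\<lambda>a. z (I k a))) \<partial>PiM V1 (\<lambda>_. \<mu>))"
    by (rule mom_eq_integral[OF fin(1) ne(1), where \<sigma> = "\<lambda>i. i"]) (use ge in1 in auto)
  then have m1: "mom I {1} = (\<integral>z. G 1 z \<partial>PiM V1 (\<lambda>_. \<mu>))" by (simp add: G_def)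
  have "mom I {2} = (\<integral>z. (\<Prod>k\<in>{2}. g (\<lambda>a. z (I k a))) \<partial>PiM V2 (\<lambda>_. \<mu>))"
    by (rule mom_eq_integral[OF fin(2) ne(2), where \<sigma> = "\<lambda>i. i"]) (use ge in2 in auto)
  then have m2: "mom I {2} = (\<integral>z. G 2 z \<partial>PiM V2 (\<lambda>_. \<mu>))" by (simp add: G_def)
  define F where "F z = G 1 z * G 2 z" for z
  have F: "F = (\<lambda>z. \<Prod>k\<in>{1, 2}. g (\<lambda>a. z (I k a)))" by (auto simp: F_def G_def)
  have in12: "I k a \<in> V1 \<union> V2" if "k \<in> {1, 2}" "a \<in> {1..p}" for k a using that in1 in2 by auto
  have "F \<in> borel_measurable (PiM (V1 \<union> V2) (\<lambda>_. borel))"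
    unfolding F by (rule kernel_composite_measurable) (rule in12)
  then have F_meas: "F \<in> borel_measurable (PiM (V1 \<union> V2) (\<lambda>_. \<mu>))" by (simp add: measurable_PiM_\<mu>)
  have "mom I {1, 2} = (\<integral>z. F z \<partial>PiM (V1 \<union> V2) (\<lambda>_. \<mu>))"
    unfolding F by (rule mom_eq_integral[where \<sigma> = "\<lambda>i. i"]) (use fin ne ge in12 in auto)
  also have "\<dots> = (\<integral>x. (\<integral>y. F (merge V1 V2 (x, y)) \<partial>PiM V2 (\<lambda>_. \<mu>)) \<partial>PiM V1 (\<lambda>_. \<mu>))"
  proof (rule PP.product_integral_fold[OF disj fin])
    interpret P: prob_space "PiM (V1 \<union> V2) (\<lambda>_. \<mu>)" by (rule prob_space_PiM_\<mu>)
    have "\<bar>F z\<bar> \<le> C * C" for z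
      unfolding F_def G_def abs_mult using C_nonneg by (intro mult_mono g_bounded) auto
    then show "integrable (PiM (V1 \<union> V2) (\<lambda>_. \<mu>)) F"
      using F_meas by (intro P.integrable_const_bound[where B = "C * C"]) auto
  qed
  also have "\<dots> = (\<integral>x. (\<integral>y. G 1 x * G 2 y \<partial>PiM V2 (\<lambda>_. \<mu>)) \<partial>PiM V1 (\<lambda>_. \<mu>))"
  proof (intro Bochner_Integration.integral_cong refl)
    fix x y :: "nat \<Rightarrow> 'a"
    have "restrict (\<lambda>a. merge V1 V2 (x, y) (I 1 a)) {1..p} = restrict (\<lambda>a. x (I 1 a)) {1..p}"
      by (rule restrict_ext) (auto simp: merge_def V1_def)
    then have "G 1 (merge V1 V2 (x, y)) = G 1 x" unfolding G_def by (metis g_restrict)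
    moreover have "restrict (\<lambda>a. merge V1 V2 (x, y) (I 2 a)) {1..p} = restrict (\<lambda>a. y (I 2 a)) {1..p}"
    proof (rule restrict_ext)
      fix a assume "a \<in> {1..p}"
      then have "I 2 a \<in> V2" by (auto simp: V2_def)
      then show "merge V1 V2 (x, y) (I 2 a) = y (I 2 a)" using disj by (auto simp: merge_def)
    qed
    then have "G 2 (merge V1 V2 (x, y)) = G 2 y" unfolding G_def by (metis g_restrict)
    ultimately show "F (merge V1 V2 (x, y)) = G 1 x * G 2 y" by (simp add: F_def)
  qed
  also have "\<dots> = mom I {1} * mom I {2}"
    by (simp only: m1 m2 integral_mult_right_zero integral_mult_left_zero)
  finally have "mom I {1, 2} = mom I {1} * mom I {2}" .
  moreover have "{1..2} = {1, 2 :: nat}" by auto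
  ultimately show ?thesis using cum_pair[of "1 :: nat" 2 "mom I"] by (simp add: I_def)
qed

text \<open>
  Expanding the product over the choices of \<open>val\<close> or \<open>c\<close> in each slot, a constant slot is independent of the
  others and kills the cumulant.
\<close>

lemma cum_shift:
  fixes c :: real
  assumes I: "I \<in> multi_indices n p r" and "r \<ge> 1"
  shows "cum 1 (\<lambda>B. \<integral>\<omega>. (\<Prod>k\<in>B. val (I k) \<omega> + c) \<partial>M) {1..r} = cum 1 (mom I) {1..r} + (if r = 1 then c else 0)"
proof (cases "r = 1")
  case True
  have "val (I 1) \<in> borel_measurable M"
    using multi_indicesD[OF I, of 1] \<open>r \<ge> 1\<close> by (intro val_measurable) auto
  then have "integrable M (val (I 1))"
    using val_bounded by (intro integrable_const_bound[where B = C]) auto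
  then show ?thesis using True cum_singleton[of "1 :: nat"] by (simp add: mom_def prob_space)
next
  case False
  define m' where "m' B f = (\<integral>\<omega>. (\<Prod>k\<in>B. if f k then val (I k) \<omega> else c) \<partial>M)" for B and f :: "nat \<Rightarrow> bool"
  have meas: "val (I k) \<in> borel_measurable M" if "k \<in> {1..r}" for k
    using multi_indicesD[OF I that] by (intro val_measurable) auto
  have int: "integrable M (\<lambda>\<omega>. \<Prod>k\<in>B. if f k then val (I k) \<omega> else c)" if "B \<subseteq> {1..r}" for B f
  proof (rule integrable_const_bound[where B = "(C + \<bar>c\<bar>) ^ card B"])
    have "norm (\<Prod>k\<in>B. if f k then val (I k) \<omega> else c) \<le> (\<Prod>k\<in>B. C + \<bar>c\<bar>)" for \<omega>
      unfolding real_norm_def abs_prod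
    proof (intro prod_mono conjI)
      show "\<bar>if f k then val (I k) \<omega> else c\<bar> \<le> C + \<bar>c\<bar>" for k
        using val_bounded[of "I k" \<omega>] C_nonneg by auto
    qed auto
    then show "AE \<omega> in M. norm (\<Prod>k\<in>B. if f k then val (I k) \<omega> else c) \<le> (C + \<bar>c\<bar>) ^ card B" by simp
    show "(\<lambda>\<omega>. \<Prod>k\<in>B. if f k then val (I k) \<omega> else c) \<in> borel_measurable M"
      using that meas by (intro borel_measurable_prod measurable_If) auto
  qed
  have "cum 1 (\<lambda>B. \<integral>\<omega>. (\<Prod>k\<in>B. val (I k) \<omega> + c) \<partial>M) {1..r}
    = (\<Sum>f\<in>PiE {1..r} (\<lambda>_. UNIV). cum 1 (\<lambda>B. m' B f) {1..r})"
  proof (rule cum_multilinear)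
    fix B :: "nat set" assume B: "B \<subseteq> {1..r}"
    then have finB: "finite B" by (rule finite_subset) simp
    have "(\<Prod>k\<in>B. val (I k) \<omega> + c) = (\<Sum>f\<in>PiE B (\<lambda>_. UNIV). \<Prod>k\<in>B. if f k then val (I k) \<omega> else c)" for \<omega>
    proof -
      have "(\<Prod>k\<in>B. val (I k) \<omega> + c) = (\<Prod>k\<in>B. \<Sum>b\<in>UNIV. if b then val (I k) \<omega> else c)"
        by (simp add: UNIV_bool add.commute)
      also have "\<dots> = (\<Sum>f\<in>PiE B (\<lambda>_. UNIV). \<Prod>k\<in>B. if f k then val (I k) \<omega> else c)"
        by (rule prod_sum_PiE[OF finB]) simp
      finally show ?thesis .
    qed
    then show "(\<integral>\<omega>. (\<Prod>k\<in>B. val (I k) \<omega> + c) \<partial>M) = (\<Sum>f\<in>PiE B (\<lambda>_. UNIV). m' B f)"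
      unfolding m'_def by (simp only:) (rule Bochner_Integration.integral_sum[OF int[OF B]])
  next
    fix B f show "m' B f = m' B (restrict f B)"
      unfolding m'_def by (intro Bochner_Integration.integral_cong prod.cong refl) simp
  qed (use \<open>r \<ge> 1\<close> in auto)
  also have "\<dots> = (\<Sum>f\<in>{\<lambda>k\<in>{1..r}. True}. cum 1 (\<lambda>B. m' B f) {1..r})"
  proof (rule sum.mono_neutral_right)
    show "finite (PiE {1..r} (\<lambda>_. UNIV :: bool set))" by (intro finite_PiE) auto
    show "\<forall>f\<in>PiE {1..r} (\<lambda>_. UNIV) - {\<lambda>k\<in>{1..r}. True}. cum 1 (\<lambda>B. m' B f) {1..r} = 0"
    proof
      fix f :: "nat \<Rightarrow> bool" assume f: "f \<in> PiE {1..r} (\<lambda>_. UNIV) - {\<lambda>k\<in>{1..r}. True}"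
      have "\<exists>k\<in>{1..r}. \<not> f k"
      proof (rule ccontr)
        assume "\<not> (\<exists>k\<in>{1..r}. \<not> f k)"
        then have "f = (\<lambda>k\<in>{1..r}. True)" using f by (intro ext) (auto simp: PiE_def extensional_def)
        then show False using f by simp
      qed
      then obtain k where k: "k \<in> {1..r}" "\<not> f k" by blast
      have rem: "m' B f = c * m' (B - {k}) f" if "B \<subseteq> {1..r}" "k \<in> B" for B
      proof -
        have "finite B" using that(1) by (rule finite_subset) simp
        then have "(\<Prod>j\<in>B. if f j then val (I j) \<omega> else c)
          = c * (\<Prod>j\<in>B - {k}. if f j then val (I j) \<omega> else c)" for \<omega>
          using that(2) k(2) by (subst prod.remove[of _ k]) auto
        then show ?thesis unfolding m'_def by simp
      qed
      have single: "m' {k} f = c" using k by (simp add: m'_def prob_space)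
      have empty: "m' {} f = 1" by (simp add: m'_def prob_space)
      \<comment> \<open>The root 1 has to lie in \<open>S\<close>, so the constant slot is isolated
        as \<open>S\<close> itself when \<open>k = 1\<close> and as its complement
        otherwise.\<close>
      define S where "S = (if k = 1 then {1} else - {k})"
      show "cum 1 (\<lambda>B. m' B f) {1..r} = 0"
      proof (rule cum_indep_eq_0[where S = S])
        show "\<not> {1..r} \<subseteq> S" using k(1) \<open>r \<ge> 1\<close> False unfolding S_def by (auto intro: exI[of _ 2] simp: subset_iff)
        fix B :: "nat set" assume B: "B \<subseteq> {1..r}"
        show "m' B f = m' (B \<inter> S) f * m' (B - S) f"
        proof (cases "k \<in> B")
          case True
          then show ?thesis
            using rem[OF B True] single
            by (cases "k = 1") (auto simp: S_def Int_absorb1 Diff_Compl Diff_eq[symmetric] Int_insert_right)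
        next
          case nk: False
          show ?thesis
          proof (cases "k = 1")
            case True
            then have "B \<inter> S = {}" "B - S = B" using nk by (auto simp: S_def)
            then show ?thesis using empty by simp
          next
            case False
            then have "B \<inter> S = B" "B - S = {}" using nk by (auto simp: S_def)
            then show ?thesis by (simp only: empty mult_1_right)
          qed
        qed
      qed (use \<open>r \<ge> 1\<close> empty in \<open>auto simp: S_def\<close>)
    qed
  qed auto
  also have "\<dots> = cum 1 (mom I) {1..r}"
  proof -
    have "cum 1 (\<lambda>B. m' B (\<lambda>k\<in>{1..r}. True)) {1..r} = cum 1 (mom I) {1..r}"
      by (rule cum_cong) (auto simp: m'_def mom_def subset_iff intro!: Bochner_Integration.integral_cong prod.cong)
    then show ?thesis by simp
  qed
  finally show ?thesis using False by simp
qed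

end

section \<open>Limits of moments and cumulants of the degenerate statistic\<close>

context degenerate_sample
begin

text \<open>Order 0 is set apart because the expansion over partitions is established for orders at
  least 1.\<close>

definition limit_moment :: "nat \<Rightarrow> real" where
  "limit_moment k = (if k = 0 then 1 else \<Sum>\<pi>\<in>leading_partitions p k. mom (rep k \<pi>) {1..k})"

lemma rep_vanishing:
  assumes "\<pi> \<in> set_partitions (p * r)" "homogeneously_vanishing p r \<pi>"
  shows "\<exists>k\<in>{1..r}. \<forall>B. B \<subseteq> {1..r} \<longrightarrow> k \<in> B \<longrightarrow> mom (rep r \<pi>) B = 0"
proof -
  obtain n where R: "rep r \<pi> \<in> multi_indices n p r" "Sp p r (rep r \<pi>) = \<pi>" using rep[OF assms(1)] .
  have hv: "homogeneously_vanishing p r (Sp p r (rep r \<pi>))" unfolding R(2) by (rule assms(2))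
  show ?thesis by (rule mom_vanishing[OF R(1) hv]) blast
qed

lemma expectation_stat_power_tendsto:
  "(\<lambda>n. (\<integral>\<omega>. stat n \<omega> ^ k \<partial>M) / (real n ^ (p - 1)) ^ k) \<longlonglongrightarrow> limit_moment k"
proof (cases "k = 0")
  case True
  then show ?thesis by (simp add: limit_moment_def prob_space)
next
  case False
  then have k: "k \<ge> 1" by simp
  have "\<exists>R. coeff R 0 = (\<Sum>\<pi>\<in>leading_partitions p k. mom (rep k \<pi>) {1..k}) \<and>
    (\<forall>n\<ge>1. (\<Sum>I\<in>multi_indices n p k. mom I {1..k}) = real n ^ ((p - 1) * k) * poly R (1 / real n))"
  proof (rule sum_multi_indices_expansion[OF k])
    show "mom I {1..k} = mom (rep k (Sp p k I)) {1..k}" if "I \<in> multi_indices n p k" for n I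
      using mom_rep[OF that _ k] by simp
    show "mom (rep k \<pi>) {1..k} = 0" if "\<pi> \<in> set_partitions (p * k)" "homogeneously_vanishing p k \<pi>" for \<pi>
      using rep_vanishing[OF that] by blast
  qed
  then obtain R where R: "coeff R 0 = (\<Sum>\<pi>\<in>leading_partitions p k. mom (rep k \<pi>) {1..k})"
    "\<And>n. n \<ge> 1 \<Longrightarrow> (\<Sum>I\<in>multi_indices n p k. mom I {1..k}) = real n ^ ((p - 1) * k) * poly R (1 / real n)"
    by blast
  have "(\<integral>\<omega>. stat n \<omega> ^ k \<partial>M) / (real n ^ (p - 1)) ^ k = poly R (1 / real n)" if "n \<ge> 1" for n
    using expectation_stat_power[of "{1..k}" n] R(2)[OF that] that
    by (simp add: multi_indices_def power_mult)
  then have "\<forall>\<^sub>F n in sequentially. poly R (1 / real n) = (\<integral>\<omega>. stat n \<omega> ^ k \<partial>M) / (real n ^ (p - 1)) ^ k"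
    by (intro eventually_sequentiallyI[of 1]) simp
  from Lim_transform_eventually[OF poly_inverse_tendsto this] show ?thesis
    using False R(1) by (simp add: limit_moment_def)
qed

text \<open>Each leading partition contributes at most \<open>C ^ k\<close>; the other factors bound
  the number of these partitions.\<close>

lemma limit_moment_bound: "\<bar>limit_moment k\<bar> \<le> (C * (real p * exp 1)\<^sup>2) ^ k * fact k"
proof (cases "k = 0")
  case False
  have "\<bar>limit_moment k\<bar> \<le> (\<Sum>\<pi>\<in>leading_partitions p k. C ^ k)"
    using False unfolding limit_moment_def
  proof (simp only: if_False, intro order_trans[OF sum_abs] sum_mono)
    fix \<pi> assume "\<pi> \<in> leading_partitions p k"
    then have \<pi>: "\<pi> \<in> set_partitions (p * k)" by (simp add: leading_partitions_def)
    obtain n where n: "rep k \<pi> \<in> multi_indices n p k" "Sp p k (rep k \<pi>) = \<pi>" using rep[OF \<pi>] .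
    from mom_bounded[OF n(1), of "{1..k}"] show "\<bar>mom (rep k \<pi>) {1..k}\<bar> \<le> C ^ k" by simp
  qed
  also have "\<dots> = real (card (leading_partitions p k)) * C ^ k" by simp
  also have "\<dots> \<le> (((real p * exp 1)\<^sup>2) ^ k * fact k) * C ^ k"
    by (intro mult_right_mono card_leading_partitions_le zero_le_power C_nonneg)
  finally show ?thesis by (simp add: power_mult_distrib mult_ac)
qed (simp add: limit_moment_def)

lemma cum_stat_expansion:
  assumes "r \<ge> 1"
  shows "\<exists>R. coeff R 0 = (\<Sum>\<pi>\<in>leading_partitions p r. cum 1 (mom (rep r \<pi>)) {1..r}) \<and>
    (\<forall>n\<ge>1. cum 1 (\<lambda>B. \<integral>\<omega>. stat n \<omega> ^ card B \<partial>M) {1..r} = real n ^ ((p - 1) * r) * poly R (1 / real n))"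
  unfolding cum_stat[OF assms]
proof (rule sum_multi_indices_expansion[OF assms])
  show "cum 1 (mom I) {1..r} = cum 1 (mom (rep r (Sp p r I))) {1..r}" if "I \<in> multi_indices n p r" for n I
    using cum_rep[OF that assms] by simp
  show "cum 1 (mom (rep r \<pi>)) {1..r} = 0"
    if \<pi>: "\<pi> \<in> set_partitions (p * r)" "homogeneously_vanishing p r \<pi>" for \<pi>
  proof -
    obtain k where k: "k \<in> {1..r}" "\<And>B. B \<subseteq> {1..r} \<Longrightarrow> k \<in> B \<Longrightarrow> mom (rep r \<pi>) B = 0"
      using rep_vanishing[OF \<pi>] by blast
    show ?thesis using assms k by (intro cum_eq_0[where k = k]) auto
  qed
qed

text \<open>The cumulants of the normalised statistic converge in two ways: by continuity to the
  cumulants of the limit moments, and by their own expansion to the sum on the right. Uniqueness of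
  limits replaces a combinatorial identity between partitions.\<close>

lemma cum_limit_moment:
  assumes "r \<ge> 1"
  shows "cum 1 (\<lambda>B. limit_moment (card B)) {1..r} = (\<Sum>\<pi>\<in>leading_partitions p r. cum 1 (mom (rep r \<pi>)) {1..r})"
proof -
  obtain R where R: "coeff R 0 = (\<Sum>\<pi>\<in>leading_partitions p r. cum 1 (mom (rep r \<pi>)) {1..r})"
    "\<And>n. n \<ge> 1 \<Longrightarrow> cum 1 (\<lambda>B. \<integral>\<omega>. stat n \<omega> ^ card B \<partial>M) {1..r} = real n ^ ((p - 1) * r) * poly R (1 / real n)"
    using cum_stat_expansion[OF assms] by blast
  define m where "m n B = (1 / real n ^ (p - 1)) ^ card B * (\<integral>\<omega>. stat n \<omega> ^ card B \<partial>M)" for n and B :: "nat set"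
  have "(\<lambda>n. m n B) \<longlonglongrightarrow> limit_moment (card B)" for B
    using expectation_stat_power_tendsto[of "card B"] by (simp add: m_def power_one_over divide_inverse mult.commute power_inverse)
  then have "(\<lambda>n. cum 1 (m n) {1..r}) \<longlonglongrightarrow> cum 1 (\<lambda>B. limit_moment (card B)) {1..r}"
    using assms by (intro tendsto_cum) auto
  moreover have "(\<lambda>n. cum 1 (m n) {1..r}) \<longlonglongrightarrow> coeff R 0"
  proof (rule Lim_transform_eventually[OF poly_inverse_tendsto])
    have "cum 1 (m n) {1..r} = poly R (1 / real n)" if "n \<ge> 1" for n
    proof -
      have "cum 1 (m n) {1..r} = (1 / real n ^ (p - 1)) ^ card {1..r} * cum 1 (\<lambda>B. \<integral>\<omega>. stat n \<omega> ^ card B \<partial>M) {1..r}"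
        unfolding m_def using assms by (intro cum_scale) auto
      then show ?thesis using R(2)[OF that] that by (simp add: power_mult power_one_over)
    qed
    then show "\<forall>\<^sub>F n in sequentially. poly R (1 / real n) = cum 1 (m n) {1..r}"
      by (intro eventually_sequentiallyI[of 1]) simp
  qed
  ultimately show ?thesis using LIMSEQ_unique R(1) by metis
qed

lemma variance_stat: "variance (stat n) = cum 1 (\<lambda>B. \<integral>\<omega>. stat n \<omega> ^ card B \<partial>M) {1..2 :: nat}"
proof -
  have "{1..2} = {1, 2 :: nat}" by auto
  moreover have "variance (stat n) = (\<integral>\<omega>. (stat n \<omega>)\<^sup>2 \<partial>M) - (\<integral>\<omega>. stat n \<omega> \<partial>M)\<^sup>2"
    using stat_power_integrable[of n 1] stat_power_integrable[of n 2] by (intro variance_eq) auto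
  ultimately show ?thesis using cum_pair[of "1 :: nat" 2] by (simp add: power2_eq_square)
qed

text \<open>The formula for \<open>Y n\<close> holds from \<open>n = 1\<close> on, whereas the
  method of moments asks for a law at every index; a constant fills index 0.\<close>

lemma stat_limit_law:
  assumes "v > 0" and V: "(\<lambda>n. V n / real n ^ (2 * (p - 1))) \<longlonglongrightarrow> v"
    and Y: "\<And>n. n \<ge> 1 \<Longrightarrow> Y n = (\<lambda>\<omega>. stat n \<omega> / sqrt (V n))" and Y0: "Y 0 = (\<lambda>_. c)"
  obtains L where "real_distribution L" "weak_conv_m (\<lambda>n. distr M borel (Y n)) L"
    "\<And>k. integrable L (\<lambda>y. y ^ k)" "\<And>k. (\<integral>y. y ^ k \<partial>L) = limit_moment k / sqrt v ^ k"
    "\<And>k. \<bar>\<integral>y. y ^ k \<partial>L\<bar> \<le> 1 * (C * (real p * exp 1)\<^sup>2 / sqrt v) ^ k * fact k"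
proof -
  have Y_meas [measurable]: "Y n \<in> borel_measurable M" for n
    using Y[of n] Y0 stat_measurable[of n] by (cases "n = 0") auto
  have bd: "\<bar>limit_moment k / sqrt v ^ k\<bar> \<le> 1 * (C * (real p * exp 1)\<^sup>2 / sqrt v) ^ k * fact k" for k
    using divide_right_mono[OF limit_moment_bound[of k], of "sqrt v ^ k"] \<open>v > 0\<close>
    by (simp add: power_divide abs_divide)
  have int: "integrable M (\<lambda>\<omega>. Y n \<omega> ^ k)" for n k
  proof (cases "n = 0")
    case False
    then show ?thesis using Y[of n] stat_power_integrable[of n k] by (simp add: power_divide)
  qed (simp add: Y0)
  have mom: "(\<integral>y. y ^ k \<partial>distr M borel (Y n)) = (\<integral>\<omega>. Y n \<omega> ^ k \<partial>M)" for n k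
    by (rule integral_distr) auto
  have lim: "(\<lambda>n. \<integral>y. y ^ k \<partial>distr M borel (Y n)) \<longlonglongrightarrow> limit_moment k / sqrt v ^ k" for k
  proof (rule Lim_transform_eventually)
    \<comment> \<open>Numerator and denominator are both divided by
      \<open>(real n ^ (p - 1)) ^ k\<close>, so that each converges; the limit of the denominator is
      nonzero as \<open>v > 0\<close>.\<close>
    show "(\<lambda>n. ((\<integral>\<omega>. stat n \<omega> ^ k \<partial>M) / (real n ^ (p - 1)) ^ k) / sqrt (V n / real n ^ (2 * (p - 1))) ^ k)
      \<longlonglongrightarrow> limit_moment k / sqrt v ^ k"
      using \<open>v > 0\<close> by (intro tendsto_divide expectation_stat_power_tendsto tendsto_power tendsto_real_sqrt V) auto
    have "((\<integral>\<omega>. stat n \<omega> ^ k \<partial>M) / (real n ^ (p - 1)) ^ k) / sqrt (V n / real n ^ (2 * (p - 1))) ^ k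
      = (\<integral>y. y ^ k \<partial>distr M borel (Y n))" if "n \<ge> 1" for n
    proof -
      have "sqrt (real n ^ (2 * (p - 1))) = real n ^ (p - 1)"
        by (rule real_sqrt_unique) (simp_all add: mult.commute flip: power_mult)
      then show ?thesis using that unfolding mom by (simp add: Y[OF that] power_divide real_sqrt_divide)
    qed
    then show "\<forall>\<^sub>F n in sequentially. ((\<integral>\<omega>. stat n \<omega> ^ k \<partial>M) / (real n ^ (p - 1)) ^ k) / sqrt (V n / real n ^ (2 * (p - 1))) ^ k
      = (\<integral>y. y ^ k \<partial>distr M borel (Y n))"
      by (intro eventually_sequentiallyI[of 1]) simp
  qed
  show thesis
  proof (rule method_of_moments[of "\<lambda>n. distr M borel (Y n)" "\<lambda>k. limit_moment k / sqrt v ^ k"])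
    show "real_distribution (distr M borel (Y n))" for n by simp
    show "integrable (distr M borel (Y n)) (\<lambda>y. y ^ k)" for n k
      using int[of n k] by (subst integrable_distr_eq) auto
    show "(\<lambda>n. \<integral>y. y ^ k \<partial>distr M borel (Y n)) \<longlonglongrightarrow> limit_moment k / sqrt v ^ k" for k by (rule lim)
    show "\<bar>limit_moment k / sqrt v ^ k\<bar> \<le> 1 * (C * (real p * exp 1)\<^sup>2 / sqrt v) ^ k * fact k" for k by (rule bd)
    fix L assume L: "real_distribution L" "weak_conv_m (\<lambda>n. distr M borel (Y n)) L"
      "\<And>k. integrable L (\<lambda>y. y ^ k)" "\<And>k. (\<integral>y. y ^ k \<partial>L) = limit_moment k / sqrt v ^ k"
    show thesis using bd by (intro that[OF L]) (simp only: L(4))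
  qed
qed

end

section \<open>Empirical measures and finite averages\<close>

lemma PiM_uniform_count_measure:
  assumes "finite I" "finite A" "A \<noteq> {}"
  shows "PiM I (\<lambda>_. uniform_count_measure A) = uniform_count_measure (PiE I (\<lambda>_. A))"
proof -
  interpret A: prob_space "uniform_count_measure A" using assms by (intro prob_space_uniform_count_measure)
  interpret PP: product_sigma_finite "\<lambda>_. uniform_count_measure A" by standard
  have fin: "finite (PiE I (\<lambda>_. A))" using assms by (intro finite_PiE) auto
  show ?thesis
  proof (rule PP.PiM_eqI[symmetric, OF assms(1)])
    have "sets (PiM I (\<lambda>_. uniform_count_measure A)) = sets (PiM I (\<lambda>_. count_space A))"
      by (intro sets_PiM_cong refl sets_uniform_count_measure_count_space)
    also have "\<dots> = sets (count_space (PiE I (\<lambda>_. A)))"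
      using assms by (subst count_space_PiM_finite) (auto intro: countable_finite)
    finally show "sets (uniform_count_measure (PiE I (\<lambda>_. A))) = sets (PiM I (\<lambda>_. uniform_count_measure A))"
      by (simp add: sets_uniform_count_measure_count_space)
    fix B assume "\<And>i. i \<in> I \<Longrightarrow> B i \<in> sets (uniform_count_measure A)"
    then have B: "B i \<subseteq> A" if "i \<in> I" for i using that by (auto simp: sets_uniform_count_measure)
    have "emeasure (uniform_count_measure (PiE I (\<lambda>_. A))) (PiE I B)
      = ennreal (real (card (PiE I B)) / real (card (PiE I (\<lambda>_. A))))"
      using B by (intro emeasure_uniform_count_measure fin) (auto simp: PiE_iff)
    also have "\<dots> = ennreal (\<Prod>i\<in>I. real (card (B i)) / real (card A))"
      using assms(1) by (simp add: card_PiE prod_dividef)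
    also have "\<dots> = (\<Prod>i\<in>I. ennreal (real (card (B i)) / real (card A)))" by (rule prod_ennreal[symmetric]) simp
    also have "\<dots> = (\<Prod>i\<in>I. emeasure (uniform_count_measure A) (B i))"
      using B assms(2) by (intro prod.cong refl) (simp add: emeasure_uniform_count_measure)
    finally show "emeasure (uniform_count_measure (PiE I (\<lambda>_. A))) (PiE I B)
      = (\<Prod>i\<in>I. emeasure (uniform_count_measure A) (B i))" .
  qed
qed

text \<open>The empirical measure is the image of the uniform measure on the indices, and products
  commute with images. The integral thus becomes an average over all multi-indices, those with
  repetitions included.\<close>

lemma Phi_sample_eq_S_stat:
  fixes X :: "nat \<Rightarrow> 'w \<Rightarrow> 'a::polish_space"
  assumes \<phi>: "continuous_map (powertop_real (pairs p)) euclideanreal \<phi>" and n: "n \<ge> 1"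
  shows "Phi_sample X p \<phi> n \<omega> = S_stat X p \<phi> n \<omega> / real n ^ p"
proof -
  let ?U = "uniform_count_measure {1..n}"
  let ?x = "\<lambda>i. X i \<omega>"
  interpret U: prob_space ?U using n by (intro prob_space_uniform_count_measure) auto
  have x: "?x \<in> measurable ?U borel" by (simp add: measurable_def sets_uniform_count_measure space_uniform_count_measure)
  have m: "compose {1..p} ?x \<in> measurable (PiM {1..p} (\<lambda>_. ?U)) (PiM {1..p} (\<lambda>_. borel))"
    unfolding compose_def using x by measurable
  have "Phi_sample X p \<phi> n \<omega> = (\<integral>z. \<phi> (dist_vector p z) \<partial>PiM {1..p} (\<lambda>_. distr ?U borel ?x))"
    by (simp add: Phi_sample_def Phi_def empirical_measure_def)
  also have "PiM {1..p} (\<lambda>_. distr ?U borel ?x) = distr (PiM {1..p} (\<lambda>_. ?U)) (PiM {1..p} (\<lambda>_. borel)) (compose {1..p} ?x)"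
  proof -
    have "PiM {1..p} (\<lambda>_. distr ?U borel ?x) = distr (PiM {1..p} (\<lambda>_. ?U)) (PiM {1..p} (\<lambda>_. distr ?U borel ?x)) (compose {1..p} ?x)"
    proof -
      have "distr (PiM {1..p} (\<lambda>_. ?U)) (PiM {1..p} (\<lambda>_. distr ?U borel ?x)) (compose {1..p} ?x)
        = PiM {1..p} (\<lambda>_. distr ?U (distr ?U borel ?x) ?x)"
        using x by (intro distr_PiM_finite_prob_space' U.prob_space_axioms U.prob_space_distr) auto
      also have "distr ?U (distr ?U borel ?x) ?x = distr ?U borel ?x" by (intro distr_cong) auto
      finally show ?thesis ..
    qed
    also have "\<dots> = distr (PiM {1..p} (\<lambda>_. ?U)) (PiM {1..p} (\<lambda>_. borel)) (compose {1..p} ?x)"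
      by (intro distr_cong sets_PiM_cong refl) simp
    finally show ?thesis .
  qed
  also have "(\<integral>z. \<phi> (dist_vector p z) \<partial>\<dots>) = (\<integral>i. \<phi> (dist_vector p (compose {1..p} ?x i)) \<partial>PiM {1..p} (\<lambda>_. ?U))"
    by (rule integral_distr[OF m dist_vector_measurable[OF \<phi>]])
  also have "\<dots> = (\<integral>i. \<phi> (dist_vector p (\<lambda>a. ?x (i a))) \<partial>uniform_count_measure (PiE {1..p} (\<lambda>_. {1..n})))"
  proof -
    have "dist_vector p (compose {1..p} ?x i) = dist_vector p (\<lambda>a. ?x (i a))" for i
      by (rule dist_vector_cong) (simp add: compose_def)
    then show ?thesis using n by (simp add: PiM_uniform_count_measure)
  qed
  also have "\<dots> = S_stat X p \<phi> n \<omega> / real n ^ p"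
    unfolding uniform_count_measure_def
    by (subst lebesgue_integral_point_measure_finite)
       (auto simp: finite_PiE S_stat_def card_PiE sum_divide_distrib)
  finally show ?thesis .
qed

text \<open>For \<open>n = 0\<close> the uniform measure lives on the empty set and the sample is
  not consulted.\<close>

lemma Phi_sample_0: "Phi_sample X p \<phi> 0 \<omega> = Phi_sample X p \<phi> 0 \<omega>'"
proof -
  have "empirical_measure X 0 \<omega> = empirical_measure X 0 \<omega>'"
    unfolding empirical_measure_def by (intro distr_cong) (auto simp: space_uniform_count_measure)
  then show ?thesis by (simp add: Phi_sample_def)
qed

lemma (in prob_space) var_affine:
  assumes "integrable M f"
  shows "var M (\<lambda>\<omega>. f \<omega> / a + b) = var M f / a\<^sup>2"
proof -
  have "expectation (\<lambda>\<omega>. f \<omega> / a + b) = expectation f / a + b" using assms by (simp add: prob_space)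
  then have "(f \<omega> / a + b - expectation (\<lambda>\<omega>. f \<omega> / a + b))\<^sup>2 = (f \<omega> - expectation f)\<^sup>2 / a\<^sup>2" for \<omega>
    by (simp add: power_divide flip: diff_divide_distrib)
  then show ?thesis by (simp add: var_def)
qed

lemma homogeneous_degenerate_sample:
  fixes \<mu> :: "'a::polish_space measure"
  assumes hom: "compact_homogeneous_space TYPE('g) \<mu>" and M: "prob_space M"
    and indep: "prob_space.indep_vars M (\<lambda>_. borel) X {1..}"
    and distr: "\<And>i. i \<ge> 1 \<Longrightarrow> distr M borel (X i) = \<mu>" and p: "p \<ge> 1"
    and \<phi>: "continuous_map (powertop_real (pairs p)) euclideanreal \<phi>"
  shows "\<exists>C. degenerate_sample M \<mu> X p (\<lambda>x. \<phi> (dist_vector p x) - Phi p \<phi> \<mu>) C"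
proof -
  interpret prob_space M by fact
  interpret iid_sample M \<mu> X by unfold_locales (fact indep, fact distr)
  obtain D where D: "\<And>x y :: 'a. dist x y \<le> D"
    and trans: "\<And>x y :: 'a. \<exists>\<tau>. \<tau> x = y \<and> (\<forall>u v. dist (\<tau> u) (\<tau> v) = dist u v) \<and> distr \<mu> borel \<tau> = \<mu>"
    by (rule compact_homogeneous_spaceE[OF hom]) blast
  obtain C where C: "\<And>x :: nat \<Rightarrow> 'a. \<bar>\<phi> (dist_vector p x)\<bar> \<le> C"
    by (rule dist_vector_bounded[OF \<phi> D]) blast
  let ?\<Phi> = "Phi p \<phi> \<mu>"
  have "degenerate_sample M \<mu> X p (\<lambda>x. \<phi> (dist_vector p x) - ?\<Phi>) (C + \<bar>?\<Phi>\<bar>)"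
  proof unfold_locales
    show "(\<lambda>x :: nat \<Rightarrow> 'a. \<phi> (dist_vector p x) - ?\<Phi>) \<in> borel_measurable (PiM {1..p} (\<lambda>_. borel))"
      by (rule borel_measurable_diff[OF dist_vector_measurable[OF \<phi>] borel_measurable_const])
    show "\<phi> (dist_vector p (restrict x {1..p})) - ?\<Phi> = \<phi> (dist_vector p x) - ?\<Phi>" for x :: "nat \<Rightarrow> 'a"
      using dist_vector_cong[of p "restrict x {1..p}" x] by simp
    show "\<bar>\<phi> (dist_vector p x) - ?\<Phi>\<bar> \<le> C + \<bar>?\<Phi>\<bar>" for x :: "nat \<Rightarrow> 'a"
      using C[of x] by linarith
    fix l :: nat and x :: 'a assume l: "l \<in> {1..p}"
    let ?J = "{1..p} - {l}"
    interpret J: prob_space "PiM ?J (\<lambda>_. \<mu>)" by (rule prob_space_PiM_\<mu>)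
    have "(\<lambda>z. z(l := x)) \<in> measurable (PiM ?J (\<lambda>_. borel)) (PiM {1..p} (\<lambda>_. borel))"
      using l by (intro measurable_fun_upd[where J = ?J]) auto
    from measurable_comp[OF this dist_vector_measurable[OF \<phi>]]
    have "(\<lambda>z. \<phi> (dist_vector p (z(l := x)))) \<in> borel_measurable (PiM ?J (\<lambda>_. \<mu>))"
      by (simp add: comp_def measurable_PiM_\<mu>)
    then have "integrable (PiM ?J (\<lambda>_. \<mu>)) (\<lambda>z. \<phi> (dist_vector p (z(l := x))))"
      using C by (intro J.integrable_const_bound[where B = C]) auto
    then have "(\<integral>z. \<phi> (dist_vector p (z(l := x))) - ?\<Phi> \<partial>PiM ?J (\<lambda>_. \<mu>))
      = (\<integral>z. \<phi> (dist_vector p (z(l := x))) \<partial>PiM ?J (\<lambda>_. \<mu>)) - (\<integral>z. ?\<Phi> \<partial>PiM ?J (\<lambda>_. \<mu>))"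
      by (rule Bochner_Integration.integral_diff[OF _ J.integrable_const])
    also have "(\<integral>z. ?\<Phi> \<partial>PiM ?J (\<lambda>_. \<mu>)) = ?\<Phi>"
      by (simp only: lebesgue_integral_const J.prob_space scaleR_one)
    also have "(\<integral>z. \<phi> (dist_vector p (z(l := x))) \<partial>PiM ?J (\<lambda>_. \<mu>)) = ?\<Phi>"
      by (rule homogeneous_degenerate[OF prob_space_\<mu> sets_\<mu> trans \<phi> C l])
    finally show "(\<integral>z. \<phi> (dist_vector p (z(l := x))) - ?\<Phi> \<partial>PiM ?J (\<lambda>_. \<mu>)) = 0"
      by (simp only: diff_self)
  qed (fact p)
  then show ?thesis by blast
qed

section \<open>Cumulants attached to set partitions\<close>

context degenerate_sample
begin

text \<open>This justifies the definite description in \<open>kappa\<close>: all multi-indices with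
  partition \<open>\<pi>\<close> give one value, and \<open>rep\<close> provides at least one of
  them. Adding the constant \<open>c\<close> back to the kernel affects order 1 alone.\<close>

lemma kappa_eq_cum:
  assumes g: "g = (\<lambda>x. \<phi> (dist_vector p x) - c)" and r: "r \<ge> 1" and \<pi>: "\<pi> \<in> set_partitions (p * r)"
  shows "kappa M X p r \<pi> \<phi> = cum 1 (mom (rep r \<pi>)) {1..r} + (if r = 1 then c else 0)"
proof -
  have g': "g x = \<phi> (dist_vector p x) - c" for x by (simp add: g)
  have val: "\<phi> (dist_vector p (\<lambda>a. X (i a) \<omega>)) = val i \<omega> + c" for i \<omega> by (simp add: val_def g')
  have jc: "joint_cumulant M r (\<lambda>k \<omega>. \<phi> (dist_vector p (\<lambda>a. X (I k a) \<omega>)))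
      = cum 1 (mom (rep r \<pi>)) {1..r} + (if r = 1 then c else 0)"
    if I: "I \<in> multi_indices n p r" "Sp p r I = \<pi>" for n I
  proof -
    have "joint_cumulant M r (\<lambda>k \<omega>. val (I k) \<omega> + c) = cum 1 (\<lambda>B. \<integral>\<omega>. (\<Prod>k\<in>B. val (I k) \<omega> + c) \<partial>M) {1..r}"
    proof (rule joint_cumulant_bounded[where C = "C + \<bar>c\<bar>"])
      show "(\<lambda>\<omega>. val (I k) \<omega> + c) \<in> borel_measurable M" if "k \<in> {1..r}" for k
        using multi_indicesD[OF I(1) that] by (intro borel_measurable_add val_measurable) auto
      show "\<bar>val (I k) \<omega> + c\<bar> \<le> C + \<bar>c\<bar>" for k \<omega> using val_bounded[of "I k" \<omega>] by linarith
    qed (use r prob_space_axioms in auto)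
    also have "\<dots> = cum 1 (mom I) {1..r} + (if r = 1 then c else 0)" by (rule cum_shift[OF I(1) r])
    also have "cum 1 (mom I) {1..r} = cum 1 (mom (rep r \<pi>)) {1..r}" using cum_rep[OF I(1) r] I(2) by simp
    finally show ?thesis by (simp only: val)
  qed
  obtain n where R: "rep r \<pi> \<in> multi_indices n p r" "Sp p r (rep r \<pi>) = \<pi>" using rep[OF \<pi>] .
  show ?thesis
    unfolding kappa_def
  proof (rule the_equality)
    show "\<forall>n. \<forall>I\<in>multi_indices n p r. Sp p r I = \<pi> \<longrightarrow>
        joint_cumulant M r (\<lambda>k \<omega>. \<phi> (dist_vector p (\<lambda>a. X (I k a) \<omega>)))
        = cum 1 (mom (rep r \<pi>)) {1..r} + (if r = 1 then c else 0)"
      using jc by blast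
    show "x = cum 1 (mom (rep r \<pi>)) {1..r} + (if r = 1 then c else 0)"
      if "\<forall>n. \<forall>I\<in>multi_indices n p r. Sp p r I = \<pi> \<longrightarrow>
        joint_cumulant M r (\<lambda>k \<omega>. \<phi> (dist_vector p (\<lambda>a. X (I k a) \<omega>))) = x" for x
      using that R jc[OF R] by auto
  qed
qed

text \<open>In order 1 the constant occurs once for each leading partition,
  \<open>p choose 2\<close> times in all, which is what \<open>limit_cumulant\<close> subtracts.
  Only the centred kernel remains.\<close>

lemma limit_cumulant_eq:
  assumes g: "g = (\<lambda>x. \<phi> (dist_vector p x) - Phi p \<phi> \<mu>)" and r: "r \<ge> 1"
  shows "limit_cumulant M \<mu> X p \<phi> r
    = (1 / sqrt (sigma2_hom M X p \<phi>)) ^ r * (\<Sum>\<pi>\<in>leading_partitions p r. cum 1 (mom (rep r \<pi>)) {1..r})"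
proof -
  let ?s = "sqrt (sigma2_hom M X p \<phi>)" and ?c = "if r = 1 then Phi p \<phi> \<mu> else 0"
  have "(\<Sum>\<pi>\<in>leading_partitions p r. kappa M X p r \<pi> \<phi>)
    = (\<Sum>\<pi>\<in>leading_partitions p r. cum 1 (mom (rep r \<pi>)) {1..r} + ?c)"
    by (intro sum.cong refl kappa_eq_cum[OF g r]) (simp add: leading_partitions_def)
  also have "\<dots> = (\<Sum>\<pi>\<in>leading_partitions p r. cum 1 (mom (rep r \<pi>)) {1..r}) + real (card (leading_partitions p r)) * ?c"
    by (simp add: sum.distrib)
  finally have "a_coeff M X p \<phi> r = 1 / ?s ^ r *
      ((\<Sum>\<pi>\<in>leading_partitions p r. cum 1 (mom (rep r \<pi>)) {1..r}) + real (card (leading_partitions p r)) * ?c)"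
    by (simp add: a_coeff_def leading_partitions_def)
  moreover have "real (card (leading_partitions p r)) * ?c = (if r = 1 then real (p choose 2) * Phi p \<phi> \<mu> else 0)"
    using card_leading_partitions_1[of p] by simp
  ultimately show ?thesis
    by (cases "r = 1") (simp_all add: limit_cumulant_def power_one_over add_divide_distrib)
qed

end

section \<open>Limit law and variance of the normalised statistic\<close>

theorem theorem5p7:
  fixes \<mu> :: "'a::polish_space measure"
    and M :: "'w measure"
    and X :: "nat \<Rightarrow> 'w \<Rightarrow> 'a"
    and p :: nat
    and \<phi> :: "(nat \<times> nat \<Rightarrow> real) \<Rightarrow> real"
  assumes "mm_space \<mu>"
    and "compact_homogeneous_space TYPE('g) \<mu>"
    and "prob_space M"
    and "prob_space.indep_vars M (\<lambda>_. borel) X {1..}"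
    and "\<And>i. i \<ge> 1 \<Longrightarrow> distr M borel (X i) = \<mu>"
    and "p \<ge> 1"
    and "continuous_map (powertop_real (pairs p)) euclideanreal \<phi>"
    and "sigma2_hom M X p \<phi> > 0"
  shows
    "sigma2_hom_seq M X p \<phi> \<longlonglongrightarrow> sigma2_hom M X p \<phi> \<and>
     sigma2_hom M X p \<phi> =
       (\<Sum>(k1, l1, k2, l2) \<in> {(k1, l1, k2, l2). {k1, l1, k2, l2} \<subseteq> {1..p} \<and> k1 < k2 \<and> l1 \<noteq> l2}.
          kappa M X p 2 (pair_partition p k1 l1 k2 l2) \<phi>) \<and>
     (\<exists>L. real_distribution L \<and>
        weak_conv_m (\<lambda>n. distr M borel (Y_stat M \<mu> X p \<phi> n)) L \<and>
        exponential_moments L \<and>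
        (\<forall>r\<ge>1. law_cumulant r L = limit_cumulant M \<mu> X p \<phi> r) \<and>
        (\<forall>N. real_distribution N \<and> exponential_moments N \<and>
           (\<forall>r\<ge>1. law_cumulant r N = limit_cumulant M \<mu> X p \<phi> r) \<longrightarrow> N = L) \<and>
        (\<forall>N. real_distribution N \<and>
           (\<forall>k. integrable N (\<lambda>y. y ^ k) \<and> (\<integral>y. y ^ k \<partial>N) = (\<integral>y. y ^ k \<partial>L)) \<longrightarrow> N = L)) \<and>
     (\<lambda>n. sqrt (var M (Phi_sample X p \<phi> n))) \<in> \<Theta>(\<lambda>n. 1 / real n) \<and>
     (\<exists>P :: real poly.
        (\<forall>n\<ge>1. var M (Phi_sample X p \<phi> n) = poly P (1 / real n)) \<and>
        coeff P 0 = 0 \<and> coeff P 1 = 0 \<and> coeff P 2 = sigma2_hom M X p \<phi>)"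
proof -
  note \<phi> = assms(7)
  define \<Phi> where "\<Phi> = Phi p \<phi> \<mu>"
  define g :: "(nat \<Rightarrow> 'a) \<Rightarrow> real" where "g = (\<lambda>x. \<phi> (dist_vector p x) - Phi p \<phi> \<mu>)"
  obtain C where "degenerate_sample M \<mu> X p g C"
    using homogeneous_degenerate_sample[OF assms(2-7)] unfolding g_def by blast
  then interpret D: degenerate_sample M \<mu> X p g C .
  define v where "v = sigma2_hom M X p \<phi>"
  define V where "V n = var M (D.stat n)" for n
  have stat_int: "integrable M (D.stat n)" for n using D.stat_power_integrable[of n 1] by simp
  have g: "g x = \<phi> (dist_vector p x) - \<Phi>" for x by (simp add: g_def \<Phi>_def)
  have S_eq: "S_stat X p \<phi> n \<omega> = D.stat n \<omega> + real n ^ p * \<Phi>" for n \<omega>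
    by (simp add: S_stat_def D.stat_def D.val_def g sum_subtractf card_PiE)
  have "var M (S_stat X p \<phi> n) = V n" for n
    using D.var_affine[OF stat_int[of n], of 1 "real n ^ p * \<Phi>"] by (simp add: V_def S_eq[abs_def])
  then have seq_V: "sigma2_hom_seq M X p \<phi> = (\<lambda>n. V n / real n ^ (2 * (p - 1)))"
    by (simp add: sigma2_hom_seq_def fun_eq_iff)
  obtain R where R: "coeff R 0 = (\<Sum>\<pi>\<in>leading_partitions p 2. cum 1 (D.mom (D.rep 2 \<pi>)) {1..2})"
    "\<And>n. n \<ge> 1 \<Longrightarrow> V n = real n ^ ((p - 1) * 2) * poly R (1 / real n)"
    using D.cum_stat_expansion[of 2] D.variance_stat unfolding V_def var_def by auto
  have seq_R: "sigma2_hom_seq M X p \<phi> n = poly R (1 / real n)" if "n \<ge> 1" for n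
    using R(2)[OF that] that by (simp add: seq_V mult.commute)
  \<comment> \<open>\<open>sigma2_hom\<close> is defined with \<open>lim\<close>; here the sequence
    is shown to converge, so that its value is a genuine limit.\<close>
  have lim_R: "sigma2_hom_seq M X p \<phi> \<longlonglongrightarrow> coeff R 0"
    by (rule Lim_transform_eventually[OF poly_inverse_tendsto], rule eventually_sequentiallyI[of 1])
       (simp add: seq_R)
  then have v_R: "v = coeff R 0" unfolding v_def sigma2_hom_def by (rule limI)
  have v: "v > 0" using assms(8) by (simp add: v_def)
  have lim_v: "sigma2_hom_seq M X p \<phi> \<longlonglongrightarrow> v" using lim_R v_R by simp

  have v_sum: "v = (\<Sum>(k1, l1, k2, l2)\<in>cross_indices p. kappa M X p 2 (pair_partition p k1 l1 k2 l2) \<phi>)"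
  proof -
    have "v = (\<Sum>(k1, l1, k2, l2)\<in>cross_indices p. cum 1 (D.mom (D.rep 2 (pair_partition p k1 l1 k2 l2))) {1..2})"
      unfolding v_R R(1)
    proof (rule sum_leading_2)
      fix \<pi> assume "\<pi> \<in> leading_partitions p 2" and *: "\<And>B. B \<in> \<pi> \<Longrightarrow> B \<subseteq> {1..p} \<or> B \<subseteq> {p + 1..2 * p}"
      then have "\<pi> \<in> set_partitions (p * 2)" by (simp add: leading_partitions_def)
      then show "cum 1 (D.mom (D.rep 2 \<pi>)) {1..2} = 0" using * by (rule D.cum_rep_split)
    qed
    also have "\<dots> = (\<Sum>(k1, l1, k2, l2)\<in>cross_indices p. kappa M X p 2 (pair_partition p k1 l1 k2 l2) \<phi>)"
    proof (intro sum.cong refl, clarify)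
      fix k1 l1 k2 l2 assume "(k1, l1, k2, l2) \<in> cross_indices p"
      then have "pair_partition p k1 l1 k2 l2 \<in> set_partitions (p * 2)"
        using pair_partition_props(1) by (auto simp: leading_partitions_def)
      then show "cum 1 (D.mom (D.rep 2 (pair_partition p k1 l1 k2 l2))) {1..2}
          = kappa M X p 2 (pair_partition p k1 l1 k2 l2) \<phi>"
        using D.kappa_eq_cum[OF g_def, of 2] by simp
    qed
    finally show ?thesis .
  qed

  have Phi_eq: "Phi_sample X p \<phi> n \<omega> = D.stat n \<omega> / real n ^ p + \<Phi>" if "n \<ge> 1" for n \<omega>
    using Phi_sample_eq_S_stat[OF \<phi> that, of X \<omega>] that by (simp add: S_eq add_divide_distrib)
  have var_Phi: "var M (Phi_sample X p \<phi> n) = V n / (real n ^ p)\<^sup>2" if "n \<ge> 1" for n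
  proof -
    have "Phi_sample X p \<phi> n = (\<lambda>\<omega>. D.stat n \<omega> / real n ^ p + \<Phi>)" using Phi_eq[OF that] by (rule ext)
    then show ?thesis using D.var_affine[OF stat_int[of n]] by (simp add: V_def)
  qed
  have var_seq: "var M (Phi_sample X p \<phi> n) = sigma2_hom_seq M X p \<phi> n / (real n)\<^sup>2" if "n \<ge> 1" for n
  proof -
    \<comment> \<open>The identity \<open>2 * p = 2 * (p - 1) + 2\<close> relies on
      \<open>p \<ge> 1\<close>, as the subtraction is truncated.\<close>
    have "(real n ^ p)\<^sup>2 = real n ^ (2 * (p - 1)) * (real n)\<^sup>2"
      using assms(6) by (cases p) (simp_all add: power_mult_distrib mult.commute flip: power_mult)
    then show ?thesis using var_Phi[OF that] by (simp add: seq_V)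
  qed

  have Y_eq: "Y_stat M \<mu> X p \<phi> n = (\<lambda>\<omega>. D.stat n \<omega> / sqrt (V n))" if "n \<ge> 1" for n
    using that by (simp add: Y_stat_def fun_eq_iff Phi_eq var_Phi real_sqrt_divide \<Phi>_def)
  \<comment> \<open>The value at index 0 does not matter for the limit; its being constant makes it
    a bounded random variable.\<close>
  have Y0: "Y_stat M \<mu> X p \<phi> 0 = (\<lambda>_. Y_stat M \<mu> X p \<phi> 0 undefined)"
  proof
    fix \<omega>
    show "Y_stat M \<mu> X p \<phi> 0 \<omega> = Y_stat M \<mu> X p \<phi> 0 undefined"
      unfolding Y_stat_def by (simp only: Phi_sample_0[of X p \<phi> \<omega> undefined])
  qed
  define K where "K = C * (real p * exp 1)\<^sup>2 / sqrt v"
  obtain L where L: "real_distribution L" "weak_conv_m (\<lambda>n. distr M borel (Y_stat M \<mu> X p \<phi> n)) L"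
    and int_L: "\<And>k. integrable L (\<lambda>y. y ^ k)"
    and mom_L: "\<And>k. (\<integral>y. y ^ k \<partial>L) = D.limit_moment k / sqrt v ^ k"
    and bd_L: "\<And>k. \<bar>\<integral>y. y ^ k \<partial>L\<bar> \<le> 1 * K ^ k * fact k"
    unfolding K_def by (rule D.stat_limit_law[OF v lim_v[unfolded seq_V] Y_eq Y0]) blast+
  have exp_L: "exponential_moments L"
    using moments_imp_exponential[OF L(1) int_L bd_L] exponential_momentsI[OF L(1)] by metis
  have cum_L: "law_cumulant r L = limit_cumulant M \<mu> X p \<phi> r" if "r \<ge> 1" for r
  proof -
    have "law_cumulant r L = cum 1 (\<lambda>B. (1 / sqrt v) ^ card B * D.limit_moment (card B)) {1..r}"
      unfolding law_cumulant_eq_cum[OF L(1) exp_L that] mom_L by (simp add: power_one_over)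
    also have "\<dots> = (1 / sqrt v) ^ card {1..r} * cum 1 (\<lambda>B. D.limit_moment (card B)) {1..r}"
      using that by (intro cum_scale) auto
    finally show ?thesis
      using D.cum_limit_moment[OF that] D.limit_cumulant_eq[OF g_def that] by (simp add: v_def)
  qed
  have uniq: "N = L"
    if N: "real_distribution N" "\<And>k. integrable N (\<lambda>y. y ^ k)" "\<And>k. (\<integral>y. y ^ k \<partial>N) = (\<integral>y. y ^ k \<partial>L)" for N
    by (rule moments_bounded_determine[OF L(1) N(1) int_L N(2) bd_L N(3)])
  \<comment> \<open>Exponential moments of \<open>N\<close> allow its cumulants to be read as
    \<open>cum\<close> of its moments; inverting the recursion then gives equal moments.\<close>
  have uniq_cum: "N = L"
    if N: "real_distribution N" "exponential_moments N"
      and eq: "\<And>r. r \<ge> 1 \<Longrightarrow> law_cumulant r N = limit_cumulant M \<mu> X p \<phi> r" for N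
  proof (rule uniq[OF N(1)])
    interpret N: real_distribution N by fact
    interpret L: real_distribution L by fact
    obtain \<epsilon> where \<epsilon>: "\<epsilon> > 0" "integrable N (\<lambda>y. exp (\<epsilon> * \<bar>y\<bar>))" using exponential_momentsE[OF N] .
    show "integrable N (\<lambda>y. y ^ k)" for k by (rule integrable_power_of_exp[OF _ \<epsilon>]) simp
    show "(\<integral>y. y ^ k \<partial>N) = (\<integral>y. y ^ k \<partial>L)" for k
    proof (rule cum_card_inject[where r = k])
      show "(\<integral>y. y ^ 0 \<partial>N) = (\<integral>y. y ^ 0 \<partial>L)" using N.prob_space L.prob_space by simp
      show "cum 1 (\<lambda>B. \<integral>y. y ^ card B \<partial>N) {1..r} = cum 1 (\<lambda>B. \<integral>y. y ^ card B \<partial>L) {1..r}"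
        if "r \<ge> 1" for r :: nat
        using eq[OF that] cum_L[OF that] law_cumulant_eq_cum[OF N that] law_cumulant_eq_cum[OF L(1) exp_L that]
        by simp
    qed
  qed

  have theta: "(\<lambda>n. sqrt (var M (Phi_sample X p \<phi> n))) \<in> \<Theta>(\<lambda>n. 1 / real n)"
  proof (rule bigthetaI_tendsto)
    show "sqrt v \<noteq> 0" using v by simp
    show "(\<lambda>n. sqrt (var M (Phi_sample X p \<phi> n)) / (1 / real n)) \<longlonglongrightarrow> sqrt v"
    proof (rule Lim_transform_eventually)
      show "(\<lambda>n. sqrt (sigma2_hom_seq M X p \<phi> n)) \<longlonglongrightarrow> sqrt v" by (intro tendsto_real_sqrt lim_v)
      show "\<forall>\<^sub>F n in sequentially. sqrt (sigma2_hom_seq M X p \<phi> n) = sqrt (var M (Phi_sample X p \<phi> n)) / (1 / real n)"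
        by (rule eventually_sequentiallyI[of 1]) (simp add: var_seq real_sqrt_divide)
    qed
  qed
  have poly: "\<exists>P :: real poly. (\<forall>n\<ge>1. var M (Phi_sample X p \<phi> n) = poly P (1 / real n)) \<and>
        coeff P 0 = 0 \<and> coeff P 1 = 0 \<and> coeff P 2 = v"
  \<comment> \<open>Dividing by the square of \<open>n\<close> shifts the coefficients of
    \<open>R\<close> by two degrees, which leaves 0 in degrees 0 and 1 and the limit variance in
    degree 2.\<close>
  proof (intro exI[of _ "monom 1 2 * R"] conjI allI impI)
    show "var M (Phi_sample X p \<phi> n) = poly (monom 1 2 * R) (1 / real n)" if "n \<ge> 1" for n
      using var_seq[OF that] seq_R[OF that] by (simp add: poly_monom power_one_over)
  qed (simp_all add: coeff_monom_mult v_R)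
  show ?thesis
    using lim_v v_sum L exp_L cum_L uniq uniq_cum theta poly
    unfolding v_def cross_indices_def by blast
qed

end
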